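(* Let $\beta>1$ be the real solution of $\beta^3=2\beta^2-\beta+1$, and let $T:[0,1)\to[0,1)$ be defined by $$T(x)=\begin{cases}\beta x&\text{if }x<\frac1\beta\\ \beta^2\big(x-\frac1\beta\big)&\text{if }\frac1\beta\le x<\frac1\beta+\frac1{\beta^2}\\ \beta^4\big(x-\frac1\beta-\frac1{\beta^2}\big)&\text{if }\frac1\beta+\frac1{\beta^2}\le x<1.\end{cases}$$ Let $c$ be a positive $7$-dimensional column-vector and let $$M_0=\begin{pmatrix}1&0&0&0&0&0&0\\0&0&1&0&0&0&0\\0&0&0&1&1&0&0\\0&0&0&0&0&0&0\\1&0&0&0&0&0&1\\0&0&0&0&1&0&0\\0&1&0&0&0&0&0\end{pmatrix},\quad M_1=\begin{pmatrix}0&0&1&1&0&0&0\\0&0&0&0&0&1&0\\0&0&0&1&1&0&0\\1&0&0&0&0&0&0\\0&0&1&0&0&0&0\\0&0&0&0&0&0&0\\0&0&0&0&0&0&0\end{pmatrix},\quad M_2=\begin{pmatrix}1&0&0&0&1&0&1\\0&0&0&0&0&0&0\\1&0&0&0&0&0&1\\0&0&0&1&1&0&0\\0&0&0&0&1&0&0\\0&0&0&0&0&0&0\\0&0&0&0&0&0&0\end{pmatrix}.$$ Then: (i) the sequence $c_{\omega,n}=\frac{M_{\omega_1}\cdots M_{\omega_n}c}{\Vert M_{\omega_1}\cdots M_{\omega_n}c\Vert}$ converges, as $n\to\infty$, uniformly on $\omega\in\{0,1,2\}^{\mathbb N}$; (ii) the measure $\nu_{\beta,2}\big(\frac{\cdot}{\beta-1}\big)$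 on $[0,1]$ (that is, $B\mapsto\nu_{\beta,2}\big(\frac1{\beta-1}B\big)$) has the weak-Gibbs property with respect to $T$.
   Context: $\Vert X\Vert$ denotes the sum of the absolute values of the entries of $X$. A vector is positive if all its entries are $>0$. $\nu_{\beta,2}$ is the Bernoulli convolution associated to $\beta$ and the probability vector $(\frac12,\frac12)$: the distribution of $\sum_{n=1}^\infty\frac{\omega_n}{\beta^n}$, where the $\omega_n$ are independent and take each of the values $0,1$ with probability $\frac12$. It is supported in $[0,\frac1{\beta-1}]$. Weak-Gibbs property. Let $\Omega_b=\{0,\dots,b-1\}^{\mathbb N}$ with the product topology, $\sigma$ the shift $\sigma((\omega_n)_n)=(\omega_{n+1})_n$, and $[\omega_1\dots\omega_n]:=\{\xi\in\Omega_b:\xi_1=\omega_1,\dots,\xi_n=\omega_n\}$. A probability measure $\nu$ on $\Omega_b$ has the weak-Gibbs property if there exists a continuous map $\Phi:\Omega_b\to\mathbb R$ such that $$\lim_{n\to\infty}\Big(\frac{\nu([\omega_1\dots\omega_n])}{\exp\big(\sum_{k=0}^{n-1}\Phi(\sigma^k\omega)\big)}\Big)^{1/n}=1\quad\text{uniformly on }\omega\in\Omega_b.$$ Let $S_0,\dots,S_{b-1}:[0,1]\to[0,1]$ be affine contractions such that $[0,1)$ is the disjoint union of the sets $S_k([0,1))$, and let $T$ be the inverse map, $T(x)=S_k^{-1}(x)$ for $x\in S_k([0,1))$. A probability measure $\mu$ on $[0,1]$ has the weak-Gibbs property with respect to $T$ if there is a probability measure $\nu$ on $\Omega_b$ having the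 weak-Gibbs property such that $\mu\big(S_{\omega_1}\circ\cdots\circ S_{\omega_n}([0,1))\big)=\nu([\omega_1\dots\omega_n])$ for all $n$ and all $\omega_1\dots\omega_n$. For the map $T$ of the claim, $b=3$, $S_0(x)=\frac x\beta$, $S_1(x)=\frac1\beta+\frac x{\beta^2}$, $S_2(x)=\frac1\beta+\frac1{\beta^2}+\frac x{\beta^4}$. *)

theory Defs
  imports "HOL-Probability.Probability" "HOL-Library.Numeral_Type"
begin

subsection \<open>Symbolic space and the weak-Gibbs property\<close>

text \<open>
  Sequences are indexed from 0: the n-th letter of the usual notation is \<open>\<omega> (n - 1)\<close>.
  \<open>nat\<close> carries the discrete topology and \<open>nat \<Rightarrow> nat\<close> the product topology, so
  \<open>continuous_on (Omega b)\<close> refers to the product topology on \<open>Omega b\<close>.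
\<close>

definition Omega :: "nat \<Rightarrow> (nat \<Rightarrow> nat) set" where
  "Omega b = {\<omega>. \<forall>i. \<omega> i < b}"

definition shift :: "(nat \<Rightarrow> nat) \<Rightarrow> (nat \<Rightarrow> nat)" where
  "shift \<omega> = (\<lambda>n. \<omega> (Suc n))"

definition cylinder :: "nat \<Rightarrow> nat list \<Rightarrow> (nat \<Rightarrow> nat) set" where
  "cylinder b w = {\<xi> \<in> Omega b. \<forall>i < length w. \<xi> i = w ! i}"

definition pref :: "(nat \<Rightarrow> nat) \<Rightarrow> nat \<Rightarrow> nat list" where
  "pref \<omega> n = map \<omega> [0..<n]"

definition weak_gibbs :: "nat \<Rightarrow> (nat \<Rightarrow> nat) measure \<Rightarrow> bool" where
  "weak_gibbs b \<nu> \<longleftrightarrow>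
     prob_space \<nu> \<and> space \<nu> = Omega b \<and> sets \<nu> = sets (restrict_space borel (Omega b)) \<and>
     (\<exists>\<Phi> :: (nat \<Rightarrow> nat) \<Rightarrow> real. continuous_on (Omega b) \<Phi> \<and>
        uniform_limit (Omega b)
          (\<lambda>n \<omega>. root n (measure \<nu> (cylinder b (pref \<omega> n))
                         / exp (\<Sum>k<n. \<Phi> ((shift ^^ k) \<omega>))))
          (\<lambda>_. 1) sequentially)"

subsection \<open>The weak-Gibbs property with respect to an expanding map of the unit interval\<close>

definition affine_contraction :: "(real \<Rightarrow> real) \<Rightarrow> bool" where
  "affine_contraction f \<longleftrightarrow> f ` {0..1} \<subseteq> {0..1} \<and>
     (\<exists>r t. \<bar>r\<bar> < 1 \<and> (\<forall>x\<in>{0..1}. f x = r * x + t))"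

definition affine_partition_system :: "nat \<Rightarrow> (nat \<Rightarrow> real \<Rightarrow> real) \<Rightarrow> bool" where
  "affine_partition_system b S \<longleftrightarrow>
     (\<forall>k<b. affine_contraction (S k)) \<and>
     disjoint_family_on (\<lambda>k. S k ` {0..<1}) {..<b} \<and>
     (\<Union>k<b. S k ` {0..<1}) = {0..<1}"

definition inverse_map_of :: "nat \<Rightarrow> (nat \<Rightarrow> real \<Rightarrow> real) \<Rightarrow> (real \<Rightarrow> real) \<Rightarrow> bool" where
  "inverse_map_of b S T \<longleftrightarrow> (\<forall>k<b. \<forall>x\<in>{0..<1}. T (S k x) = x)"

fun comp_word :: "(nat \<Rightarrow> real \<Rightarrow> real) \<Rightarrow> nat list \<Rightarrow> real \<Rightarrow> real" where
  "comp_word S [] = id"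
| "comp_word S (k # w) = S k \<circ> comp_word S w"

text \<open>
  The conditions on \<open>S\<close> and \<open>T\<close> are part of the predicate, so asserting it includes the
  claim that \<open>T\<close> really is the inverse map of the system \<open>S\<close>.
\<close>

definition weak_gibbs_wrt ::
    "nat \<Rightarrow> (nat \<Rightarrow> real \<Rightarrow> real) \<Rightarrow> (real \<Rightarrow> real) \<Rightarrow> real measure \<Rightarrow> bool" where
  "weak_gibbs_wrt b S T \<mu> \<longleftrightarrow>
     affine_partition_system b S \<and> inverse_map_of b S T \<and>
     prob_space \<mu> \<and> space \<mu> = {0..1} \<and> sets \<mu> = sets (restrict_space borel {0..1}) \<and>
     (\<exists>\<nu>. weak_gibbs b \<nu> \<and>
        (\<forall>w. set w \<subseteq> {..<b} \<longrightarrow>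
             measure \<mu> (comp_word S w ` {0..<1}) = measure \<nu> (cylinder b w)))"

subsection \<open>The Bernoulli convolution\<close>

definition bernoulli_convolution2 :: "real \<Rightarrow> real measure" where
  "bernoulli_convolution2 \<beta> =
     distr (\<Pi>\<^sub>M i\<in>(UNIV :: nat set). measure_pmf (pmf_of_set {0, 1 :: nat})) borel
       (\<lambda>\<omega>. \<Sum>n. real (\<omega> n) / \<beta> ^ Suc n)"

text \<open>
  The measure \<open>B \<mapsto> \<nu> (1/(\<beta>-1) B)\<close> on the Borel sets of \<open>[0,1]\<close>: for \<open>\<beta> > 1\<close> the set
  \<open>1/(\<beta>-1) B\<close> is the preimage of \<open>B\<close> under multiplication by \<open>\<beta> - 1\<close>.
\<close>

definition scaled_bernoulli_convolution2 :: "real \<Rightarrow> real measure" where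
  "scaled_bernoulli_convolution2 \<beta> =
     restrict_space (distr (bernoulli_convolution2 \<beta>) borel (\<lambda>x. (\<beta> - 1) * x)) {0..1}"

lemma emeasure_scaled_bernoulli_convolution2:
  assumes "\<beta> > 1" "B \<in> sets borel" "B \<subseteq> {0..1}"
  shows "emeasure (scaled_bernoulli_convolution2 \<beta>) B
           = emeasure (bernoulli_convolution2 \<beta>) ((\<lambda>x. 1 / (\<beta> - 1) * x) ` B)"
proof -
  have "(\<lambda>x. (\<beta> - 1) * x) -` B = (\<lambda>x. 1 / (\<beta> - 1) * x) ` B"
  proof (intro equalityI subsetI)
    fix x assume "x \<in> (\<lambda>x. (\<beta> - 1) * x) -` B"
    moreover have "x = 1 / (\<beta> - 1) * ((\<beta> - 1) * x)" using assms(1) by simp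
    ultimately show "x \<in> (\<lambda>x. 1 / (\<beta> - 1) * x) ` B" by blast
  qed (use assms(1) in auto)
  moreover have "sets (bernoulli_convolution2 \<beta>) = sets borel"
      "space (bernoulli_convolution2 \<beta>) = UNIV"
    by (simp_all add: bernoulli_convolution2_def)
  moreover have "(\<lambda>x. (\<beta> - 1) * x) \<in> measurable (bernoulli_convolution2 \<beta>) borel"
    by (simp add: bernoulli_convolution2_def)
  ultimately show ?thesis
    using assms(2,3)
    by (simp add: scaled_bernoulli_convolution2_def emeasure_restrict_space emeasure_distr)
qed

subsection \<open>The map T, its inverse branches, and the matrices\<close>

text \<open>Only the values of \<open>T_map \<beta>\<close> on \<open>{0..<1}\<close> matter.\<close>

definition T_map :: "real \<Rightarrow> real \<Rightarrow> real" where
  "T_map \<beta> x =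
     (if x < 1 / \<beta> then \<beta> * x
      else if x < 1 / \<beta> + 1 / \<beta>\<^sup>2 then \<beta>\<^sup>2 * (x - 1 / \<beta>)
      else \<beta> ^ 4 * (x - 1 / \<beta> - 1 / \<beta>\<^sup>2))"

definition S_map :: "real \<Rightarrow> nat \<Rightarrow> real \<Rightarrow> real" where
  "S_map \<beta> k x =
     (if k = 0 then x / \<beta>
      else if k = 1 then 1 / \<beta> + x / \<beta>\<^sup>2
      else 1 / \<beta> + 1 / \<beta>\<^sup>2 + x / \<beta> ^ 4)"

definition M0 :: "real ^ 7 ^ 7" where
  "M0 = vector [
     vector [1,0,0,0,0,0,0],
     vector [0,0,1,0,0,0,0],
     vector [0,0,0,1,1,0,0],
     vector [0,0,0,0,0,0,0],
     vector [1,0,0,0,0,0,1],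
     vector [0,0,0,0,1,0,0],
     vector [0,1,0,0,0,0,0]]"

definition M1 :: "real ^ 7 ^ 7" where
  "M1 = vector [
     vector [0,0,1,1,0,0,0],
     vector [0,0,0,0,0,1,0],
     vector [0,0,0,1,1,0,0],
     vector [1,0,0,0,0,0,0],
     vector [0,0,1,0,0,0,0],
     vector [0,0,0,0,0,0,0],
     vector [0,0,0,0,0,0,0]]"

definition M2 :: "real ^ 7 ^ 7" where
  "M2 = vector [
     vector [1,0,0,0,1,0,1],
     vector [0,0,0,0,0,0,0],
     vector [1,0,0,0,0,0,1],
     vector [0,0,0,1,1,0,0],
     vector [0,0,0,0,1,0,0],
     vector [0,0,0,0,0,0,0],
     vector [0,0,0,0,0,0,0]]"

definition M_mat :: "nat \<Rightarrow> real ^ 7 ^ 7" where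
  "M_mat k = [M0, M1, M2] ! k"

fun mat_word :: "nat list \<Rightarrow> real ^ 7 ^ 7" where
  "mat_word [] = mat 1"
| "mat_word (k # w) = M_mat k ** mat_word w"

definition abs_sum :: "real ^ 'n \<Rightarrow> real" where
  "abs_sum x = (\<Sum>i\<in>UNIV. \<bar>x $ i\<bar>)"

definition c_seq :: "real ^ 7 \<Rightarrow> nat \<Rightarrow> (nat \<Rightarrow> nat) \<Rightarrow> real ^ 7" where
  "c_seq c n \<omega> =
     (mat_word (pref \<omega> n) *v c) /\<^sub>R abs_sum (mat_word (pref \<omega> n) *v c)"

end

theory Submission
  imports Defs
begin

text \<open>
  The seven-dimensional vectors are masses: on the cell of a word \<open>w\<close> the self-similarity of the Bernoulli
  convolution expresses the masses of finitely many translates of the cell of \<open>k # w\<close> through those of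
  the cell of \<open>w\<close>, and suitable sums of these translates transform by \<open>M_mat k\<close> up to a factor
  \<open>1/2\<close>, \<open>1/4\<close> or \<open>1/16\<close>. So both parts concern the directions of \<open>mat_word w *v c\<close>.

  By a tree argument it is enough that, for a single sequence \<open>\<omega>\<close>, the directions of all
  \<open>mat_word (pref \<omega> n @ u) *v c\<close> become close to each other. If the letter 1 or the pair 20 occurs
  infinitely often, each occurrence contracts the ratios of the entries of two such vectors by a fixed factor.
  Otherwise \<open>\<omega>\<close> ends with \<open>000\<dots>\<close> or \<open>222\<dots>\<close>, where the products are parabolic: one coordinate stays
  constant, the sum of the entries grows linearly, and the direction converges at rate \<open>1/n\<close>.

  For the weak-Gibbs property, the logarithm of \<open>abs_sum (mat_word w *v c)\<close> is a Birkhoff sum up to \<open>o(n)\<close>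
  because the increments converge uniformly, and the coordinate giving the mass of a cylinder is at least
  a multiple of \<open>1/n\<close> of that sum of entries.
\<close>

subsection \<open>Coordinates in dimension seven\<close>

text \<open>The obstacle is that no rate of contraction is uniform: the matrices have zero rows and
  columns, and along runs of 0 or 2 only a rate 1/n is available. Compactness replaces a rate, which
  is why closeness is asked for all continuations of a prefix and not only for the tails of one
  sequence. Zero entries also rule out a lower bound on every coordinate. What survives are the
  shares of \<open>y $ 3\<close>, \<open>y $ 1 + y $ 7\<close> and \<open>y $ 4 + y $ 5\<close>: the
  third entry of an image is always one of the last two, and the cone below is what closes these
  bounds under all three matrices. At a switch entries 6 and 7 vanish and entries 1, 3 and 5 get a
  definite share. Every product of five matrices has, among its columns 1 to 5, a dominating one
  with index 1, 3 or 5, so the five letters in front of a switch contract. The parabolic runs are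
  also where a factor of order n may be lost between the sum of the entries and the coordinate that
  gives the mass of a cylinder; the n-th root forgets it.\<close>

lemma exhaust_7:
  fixes x :: 7
  shows "x = 1 \<or> x = 2 \<or> x = 3 \<or> x = 4 \<or> x = 5 \<or> x = 6 \<or> x = 7"
proof (induct x)
  case (of_int z)
  then have "z = 0 \<or> z = 1 \<or> z = 2 \<or> z = 3 \<or> z = 4 \<or> z = 5 \<or> z = 6" by fastforce
  then show ?case by auto
qed

lemma forall_7: "(\<forall>i::7. P i) \<longleftrightarrow> P 1 \<and> P 2 \<and> P 3 \<and> P 4 \<and> P 5 \<and> P 6 \<and> P 7"
  by (metis exhaust_7)

lemma UNIV_7: "UNIV = {1, 2, 3, 4, 5, 6, 7::7}"
  using exhaust_7 by blast

lemma sum_7: "sum f (UNIV::7 set) = f 1 + f 2 + f 3 + f 4 + f 5 + f 6 + f 7"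
  unfolding UNIV_7 by (simp add: ac_simps)

lemma vector_7:
  "(vector [a, b, c, d, e, f, g] :: 'a::zero ^ 7) $ 1 = a"
  "(vector [a, b, c, d, e, f, g] :: 'a ^ 7) $ 2 = b"
  "(vector [a, b, c, d, e, f, g] :: 'a ^ 7) $ 3 = c"
  "(vector [a, b, c, d, e, f, g] :: 'a ^ 7) $ 4 = d"
  "(vector [a, b, c, d, e, f, g] :: 'a ^ 7) $ 5 = e"
  "(vector [a, b, c, d, e, f, g] :: 'a ^ 7) $ 6 = f"
  "(vector [a, b, c, d, e, f, g] :: 'a ^ 7) $ 7 = g"
  by (simp_all add: vector_def)

lemma M0_mult:
  "(M0 *v y) $ 1 = y $ 1"
  "(M0 *v y) $ 2 = y $ 3"
  "(M0 *v y) $ 3 = y $ 4 + y $ 5"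
  "(M0 *v y) $ 4 = 0"
  "(M0 *v y) $ 5 = y $ 1 + y $ 7"
  "(M0 *v y) $ 6 = y $ 5"
  "(M0 *v y) $ 7 = y $ 2"
  by (simp_all add: matrix_vector_mult_def M0_def vector_7 sum_7 del: vec_lambda_eta)

lemma M1_mult:
  "(M1 *v y) $ 1 = y $ 3 + y $ 4"
  "(M1 *v y) $ 2 = y $ 6"
  "(M1 *v y) $ 3 = y $ 4 + y $ 5"
  "(M1 *v y) $ 4 = y $ 1"
  "(M1 *v y) $ 5 = y $ 3"
  "(M1 *v y) $ 6 = 0"
  "(M1 *v y) $ 7 = 0"
  by (simp_all add: matrix_vector_mult_def M1_def vector_7 sum_7 del: vec_lambda_eta)

lemma M2_mult:
  "(M2 *v y) $ 1 = y $ 1 + y $ 5 + y $ 7"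
  "(M2 *v y) $ 2 = 0"
  "(M2 *v y) $ 3 = y $ 1 + y $ 7"
  "(M2 *v y) $ 4 = y $ 4 + y $ 5"
  "(M2 *v y) $ 5 = y $ 5"
  "(M2 *v y) $ 6 = 0"
  "(M2 *v y) $ 7 = 0"
  by (simp_all add: matrix_vector_mult_def M2_def vector_7 sum_7 del: vec_lambda_eta)

lemma M_mat_simps: "M_mat 0 = M0" "M_mat (Suc 0) = M1" "M_mat 1 = M1" "M_mat 2 = M2"
  by (simp_all add: M_mat_def)

lemmas M_mult = M_mat_simps M0_mult M1_mult M2_mult

lemma mat_word_Cons: "mat_word (k # w) *v y = M_mat k *v (mat_word w *v y)"
  by (simp add: matrix_vector_mul_assoc)

lemma mat_word_append: "mat_word (v @ w) *v y = mat_word v *v (mat_word w *v y)"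
  by (induction v) (simp_all add: mat_word_Cons del: mat_word.simps(2))

lemma letter_cases:
  assumes "k < (3::nat)"
  obtains "k = 0" | "k = 1" | "k = 2"
  using assms by linarith

definition nonneg_vec :: "real ^ 'n \<Rightarrow> bool" where
  "nonneg_vec y \<longleftrightarrow> (\<forall>i. 0 \<le> y $ i)"

lemma nonneg_vec_7:
  "nonneg_vec (y :: real ^ 7) \<longleftrightarrow>
    0 \<le> y $ 1 \<and> 0 \<le> y $ 2 \<and> 0 \<le> y $ 3 \<and> 0 \<le> y $ 4 \<and> 0 \<le> y $ 5 \<and> 0 \<le> y $ 6 \<and> 0 \<le> y $ 7"
  by (simp add: nonneg_vec_def forall_7)

lemma abs_sum_nonneg_7:
  "nonneg_vec (y :: real ^ 7) \<Longrightarrow>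
    abs_sum y = y $ 1 + y $ 2 + y $ 3 + y $ 4 + y $ 5 + y $ 6 + y $ 7"
  by (simp add: abs_sum_def sum_7 nonneg_vec_7)

lemma nonneg_M_mat:
  assumes "k < 3" "nonneg_vec y"
  shows "nonneg_vec (M_mat k *v y)"
  using assms(1) by (cases rule: letter_cases) (use assms(2) in \<open>simp_all add: nonneg_vec_7 M_mult\<close>)

lemma nonneg_mat_word:
  "set w \<subseteq> {..<3} \<Longrightarrow> nonneg_vec y \<Longrightarrow> nonneg_vec (mat_word w *v y)"
  by (induction w) (simp_all add: mat_word_Cons nonneg_M_mat del: mat_word.simps(2))

lemma mat_word_mono:
  assumes "set w \<subseteq> {..<3}" "\<And>i. x $ i \<le> y $ i"
  shows "(mat_word w *v x) $ i \<le> (mat_word w *v y) $ i"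
proof -
  have "nonneg_vec (mat_word w *v (y - x))"
    using assms by (intro nonneg_mat_word) (auto simp: nonneg_vec_def)
  then show ?thesis by (simp add: nonneg_vec_def matrix_vector_mult_diff_distrib)
qed

subsection \<open>An invariant cone\<close>

text \<open>The inequalities were found by closing \<open>y\<^sub>1, y\<^sub>4, y\<^sub>5 \<le> 4 y\<^sub>3\<close> under pullback by the three
  matrices, discarding nonnegative combinations of inequalities already present.\<close>

definition balanced :: "real ^ 7 \<Rightarrow> bool" where
  "balanced y \<longleftrightarrow> nonneg_vec y \<and>
    y $ 1 \<le> 4 * y $ 3 \<and>
    y $ 5 \<le> 4 * y $ 3 \<and>
    y $ 4 \<le> 4 * y $ 3 \<and>
    y $ 3 \<le> 3 * y $ 4 + 4 * y $ 5 \<and>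
    y $ 5 \<le> 3 * y $ 1 + 3 * y $ 7 \<and>
    y $ 1 + y $ 7 \<le> 4 * y $ 4 + 4 * y $ 5 \<and>
    y $ 4 + y $ 5 \<le> 4 * y $ 1 + 4 * y $ 7 \<and>
    y $ 4 + y $ 5 \<le> 3 * y $ 1 + 4 * y $ 3 \<and>
    y $ 7 \<le> 2 * y $ 1 + 3 * y $ 2 \<and>
    y $ 2 \<le> 3 * y $ 1 + 4 * y $ 7 \<and>
    y $ 1 \<le> 3 * y $ 3 + 4 * y $ 4 \<and>
    y $ 2 \<le> 2 * y $ 1 + 3 * y $ 3 \<and>
    y $ 3 \<le> 3 * y $ 1 + 4 * y $ 2 \<and>
    y $ 6 \<le> 3 * y $ 3 + 3 * y $ 4 \<and>
    y $ 1 \<le> 3 * y $ 4 + 3 * y $ 5 \<and>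
    y $ 3 \<le> 4 * y $ 1 + 2 * y $ 4 + 3 * y $ 5 \<and>
    y $ 3 \<le> 2 * y $ 1 + 3 * y $ 4 + 3 * y $ 5 \<and>
    y $ 6 \<le> 2 * y $ 3 + 5 * y $ 4 + 3 * y $ 5 \<and>
    y $ 5 \<le> 3 * y $ 3 + 2 * y $ 4 + 4 * y $ 6 \<and>
    y $ 4 \<le> 3 * y $ 1 + 2 * y $ 3 \<and>
    y $ 1 + y $ 7 \<le> 3 * y $ 4 + 5 * y $ 5 \<and>
    y $ 4 + y $ 5 \<le> 5 * y $ 1 + 3 * y $ 7"

lemma balanced_M_mat:
  assumes "k < 3" "balanced y"
  shows "balanced (M_mat k *v y)"
  using assms(1)
proof (cases rule: letter_cases)
  case 1
  show ?thesis
    using assms(2) unfolding 1 balanced_def nonneg_vec_7 M_mult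
    by argo
next
  case 2
  show ?thesis
    using assms(2) unfolding 2 balanced_def nonneg_vec_7 M_mult
    by argo
next
  case 3
  show ?thesis
    using assms(2) unfolding 3 balanced_def nonneg_vec_7 M_mult
    by argo
qed

lemma balanced_mat_word:
  "set w \<subseteq> {..<3} \<Longrightarrow> balanced y \<Longrightarrow> balanced (mat_word w *v y)"
  by (induction w) (simp_all add: mat_word_Cons balanced_M_mat del: mat_word.simps(2))

text \<open>The cone inequalities chain: \<open>y $ 3\<close> controls entries 1, 4 and 5, these
  control 2 and 6, and then 7; the other two quantities are treated in the same way. The constants
  100 and 600 are generous.\<close>

lemma balanced_bounds:
  assumes "balanced y"
  shows "abs_sum y \<le> 100 * y $ 3" "abs_sum y \<le> 600 * (y $ 1 + y $ 7)"
    "abs_sum y \<le> 600 * (y $ 4 + y $ 5)"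
proof -
  have "nonneg_vec y" using assms by (simp add: balanced_def)
  then show "abs_sum y \<le> 100 * y $ 3" "abs_sum y \<le> 600 * (y $ 1 + y $ 7)"
    "abs_sum y \<le> 600 * (y $ 4 + y $ 5)"
    using assms unfolding abs_sum_nonneg_7[OF \<open>nonneg_vec y\<close>] balanced_def nonneg_vec_7
    by argo+
qed

subsection \<open>Uniform bounds along the orbit of a positive vector\<close>

text \<open>Single entries may vanish, so only these three shares are kept. The third entry of an
  image under \<open>M0\<close> or \<open>M1\<close> is \<open>y $ 4 + y $ 5\<close>, and under
  \<open>M2\<close> it is \<open>y $ 1 + y $ 7\<close>; this keeps all products away from 0.\<close>

definition well_spread :: "real \<Rightarrow> real ^ 7 \<Rightarrow> bool" where
  "well_spread \<delta> y \<longleftrightarrow> nonneg_vec y \<and> 0 < abs_sum y \<and>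
     \<delta> * abs_sum y \<le> y $ 3 \<and> \<delta> * abs_sum y \<le> y $ 1 + y $ 7 \<and>
     \<delta> * abs_sum y \<le> y $ 4 + y $ 5"

lemma balanced_pos_M_mat:
  assumes "k < 3" "balanced y" "0 < y $ 3"
  shows "0 < (M_mat k *v y) $ 3"
proof -
  have "0 < y $ 4 + y $ 5" "0 < y $ 1 + y $ 7"
    using assms(2,3) unfolding balanced_def nonneg_vec_7 by argo+
  with assms(1) show ?thesis by (cases rule: letter_cases) (simp_all add: M_mult)
qed

lemma balanced_pos_mat_word:
  "set w \<subseteq> {..<3} \<Longrightarrow> balanced y \<Longrightarrow> 0 < y $ 3 \<Longrightarrow> 0 < (mat_word w *v y) $ 3"
  by (induction w)
     (simp_all add: mat_word_Cons balanced_pos_M_mat balanced_mat_word del: mat_word.simps(2))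

text \<open>The constant vector is balanced, and \<open>c\<close> is comparable to it entry by entry.\<close>

lemma orbit_well_spread:
  assumes "\<forall>i. c $ i > 0"
  shows "\<exists>\<delta>>0. \<delta> \<le> 1 \<and> (\<forall>w. set w \<subseteq> {..<3} \<longrightarrow> well_spread \<delta> (mat_word w *v c))"
proof -
  define m where "m = Min (range (($) c))"
  define M where "M = Max (range (($) c))"
  define o1 :: "real ^ 7" where "o1 = (\<chi> i. 1)"
  have m: "m \<le> c $ i" and M: "c $ i \<le> M" for i
    by (simp_all add: m_def M_def)
  have m0: "0 < m" using assms by (simp add: m_def)
  have M0: "0 < M" using m[of 1] M[of 1] m0 by linarith
  have bal: "balanced o1" by (simp add: balanced_def nonneg_vec_7 o1_def)
  \<comment> \<open>By monotonicity the orbit of c lies entrywise between m and M times that of the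
    constant vector; 600 is the constant of \<open>balanced_bounds\<close>.\<close>
  have "well_spread (m / (600 * M)) (mat_word w *v c)" if w: "set w \<subseteq> {..<3}" for w
  proof -
    let ?y = "mat_word w *v c" and ?o = "mat_word w *v o1"
    have b: "balanced ?o" using balanced_mat_word[OF w bal] .
    have no: "nonneg_vec ?o" using b by (simp add: balanced_def)
    have p3: "0 < ?o $ 3" by (rule balanced_pos_mat_word[OF w bal]) (simp add: o1_def)
    have lo: "m * ?o $ i \<le> ?y $ i" for i
      using mat_word_mono[OF w, of "m *\<^sub>R o1" c i] m
      by (simp add: o1_def matrix_vector_mult_scaleR)
    have hi: "?y $ i \<le> M * ?o $ i" for i
      using mat_word_mono[OF w, of c "M *\<^sub>R o1" i] M
      by (simp add: o1_def matrix_vector_mult_scaleR)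
    have ny: "nonneg_vec ?y"
      by (rule nonneg_mat_word[OF w]) (use assms in \<open>auto simp: nonneg_vec_def less_imp_le\<close>)
    have N: "abs_sum ?y \<le> M * abs_sum ?o"
      unfolding abs_sum_nonneg_7[OF ny] abs_sum_nonneg_7[OF no] distrib_left
      by (intro add_mono hi)
    have "m / (600 * M) * abs_sum ?y \<le> m / (600 * M) * (M * abs_sum ?o)"
      using N m0 M0 by (intro mult_left_mono) auto
    also have "\<dots> = m * (abs_sum ?o / 600)" using M0 by simp
    finally have *: "m / (600 * M) * abs_sum ?y \<le> m * (abs_sum ?o / 600)" .
    have "abs_sum ?o / 600 \<le> ?o $ 3" "abs_sum ?o / 600 \<le> ?o $ 1 + ?o $ 7"
        "abs_sum ?o / 600 \<le> ?o $ 4 + ?o $ 5"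
      using balanced_bounds[OF b] p3 by argo+
    then have "m * (abs_sum ?o / 600) \<le> m * ?o $ 3"
        "m * (abs_sum ?o / 600) \<le> m * (?o $ 1 + ?o $ 7)"
        "m * (abs_sum ?o / 600) \<le> m * (?o $ 4 + ?o $ 5)"
      using m0 by (auto intro: mult_left_mono)
    then have 1: "m / (600 * M) * abs_sum ?y \<le> ?y $ 3"
        "m / (600 * M) * abs_sum ?y \<le> ?y $ 1 + ?y $ 7"
        "m / (600 * M) * abs_sum ?y \<le> ?y $ 4 + ?y $ 5"
      using * lo[of 3] lo[of 1] lo[of 7] lo[of 4] lo[of 5] distrib_left[of m "?o $ 1" "?o $ 7"]
        distrib_left[of m "?o $ 4" "?o $ 5"] by argo+
    have "0 < ?y $ 3" using lo[of 3] p3 m0 by (smt (verit) mult_pos_pos)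
    then have "0 < abs_sum ?y"
      using ny unfolding abs_sum_nonneg_7[OF ny] nonneg_vec_7 by linarith
    then show ?thesis using 1 ny by (simp add: well_spread_def)
  qed
  moreover have "0 < m / (600 * M)" "m / (600 * M) \<le> 1"
    using m0 M0 m[of 1] M[of 1] by (auto simp: divide_simps)
  ultimately show ?thesis by blast
qed

section \<open>The sum norm and normalisation to entry sum 1\<close>

lemma abs_sum_nonneg [simp]: "0 \<le> abs_sum x"
  by (simp add: abs_sum_def sum_nonneg)

lemma abs_sum_triangle: "abs_sum (x + y) \<le> abs_sum x + abs_sum y"
  unfolding abs_sum_def sum.distrib[symmetric] by (intro sum_mono) auto

lemma abs_sum_scaleR [simp]: "abs_sum (r *\<^sub>R x) = \<bar>r\<bar> * abs_sum x"
  by (simp add: abs_sum_def sum_distrib_left abs_mult)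

lemma abs_sum_minus_commute: "abs_sum (x - y) = abs_sum (y - x)"
  by (simp add: abs_sum_def abs_minus_commute)

lemma abs_sum_triangle_diff: "abs_sum (x - z) \<le> abs_sum (x - y) + abs_sum (y - z)"
  using abs_sum_triangle[of "x - y" "y - z"] by simp

text \<open>No column of the three matrices has a sum above 3.\<close>

lemma abs_sum_M_mat_le:
  assumes "k < 3"
  shows "abs_sum (M_mat k *v y) \<le> 3 * abs_sum y"
proof -
  have t: "\<bar>y $ i + y $ j\<bar> \<le> \<bar>y $ i\<bar> + \<bar>y $ j\<bar>" "0 \<le> \<bar>y $ i\<bar>" for i j
    by simp_all
  have t3: "\<bar>y $ 1 + y $ 5 + y $ 7\<bar> \<le> \<bar>y $ 1\<bar> + \<bar>y $ 5\<bar> + \<bar>y $ 7\<bar>"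
    by linarith
  note T = t(1)[of 1 7] t(1)[of 3 4] t(1)[of 4 5] t3
    t(2)[of 1] t(2)[of 2] t(2)[of 3] t(2)[of 4] t(2)[of 5] t(2)[of 6] t(2)[of 7]
  have "abs_sum (M0 *v y) \<le> 3 * abs_sum y" "abs_sum (M1 *v y) \<le> 3 * abs_sum y"
      "abs_sum (M2 *v y) \<le> 3 * abs_sum y"
    using T unfolding abs_sum_def sum_7 M_mult abs_zero by argo+
  with assms show ?thesis by (cases rule: letter_cases) (simp_all add: M_mat_simps)
qed

lemma abs_sum_M_mat_ge:
  assumes "k < 3" "well_spread \<delta> y"
  shows "\<delta> * abs_sum y \<le> abs_sum (M_mat k *v y)"
proof -
  have n: "nonneg_vec y" using assms by (simp add: well_spread_def)
  show ?thesis
    unfolding abs_sum_nonneg_7[OF nonneg_M_mat[OF assms(1) n]] using assms(1)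
    by (cases rule: letter_cases)
       (use assms(2) in \<open>simp_all add: M_mult well_spread_def nonneg_vec_7\<close>)
qed

definition unit_sum :: "real ^ 'n \<Rightarrow> real ^ 'n" where
  "unit_sum x = x /\<^sub>R abs_sum x"

lemma unit_sum_scaleR: "0 < r \<Longrightarrow> unit_sum (r *\<^sub>R x) = unit_sum x"
  by (simp add: unit_sum_def)

text \<open>The difference splits into a change of the vector and a change of the normalising
  factor, and each costs at most \<open>abs_sum (x - y) / abs_sum x\<close>. Only x appears in the
  denominator, so x may be chosen as the vector of known size.\<close>

lemma unit_sum_diff_le:
  assumes "0 < abs_sum x" "0 < abs_sum y"
  shows "abs_sum (unit_sum x - unit_sum y) \<le> 2 * abs_sum (x - y) / abs_sum x"
proof -
  let ?a = "abs_sum x" and ?b = "abs_sum y"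
  have "unit_sum x - unit_sum y = (1 / ?a) *\<^sub>R (x - y) + (1 / ?a - 1 / ?b) *\<^sub>R y"
    by (simp add: unit_sum_def algebra_simps inverse_eq_divide)
  then have "abs_sum (unit_sum x - unit_sum y) \<le> abs_sum (x - y) / ?a + \<bar>1 / ?a - 1 / ?b\<bar> * ?b"
    using abs_sum_triangle[of "(1 / ?a) *\<^sub>R (x - y)" "(1 / ?a - 1 / ?b) *\<^sub>R y"] assms
    by simp
  moreover have "\<bar>1 / ?a - 1 / ?b\<bar> * ?b = \<bar>?b - ?a\<bar> / ?a"
  proof -
    have "1 / ?a - 1 / ?b = (?b - ?a) / (?a * ?b)" using assms by (simp add: field_simps)
    then show ?thesis using assms by (simp add: abs_mult)
  qed
  moreover have "\<bar>?b - ?a\<bar> \<le> abs_sum (x - y)"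
    using abs_sum_triangle[of "x - y" y] abs_sum_triangle[of "y - x" x]
    by (simp add: abs_sum_minus_commute[of y x])
  ultimately have "abs_sum (unit_sum x - unit_sum y) \<le> abs_sum (x - y) / ?a + abs_sum (x - y) / ?a"
    using assms by (smt (verit) divide_right_mono)
  then show ?thesis by simp
qed

subsection \<open>Contraction of the ratios at a change of letter\<close>

text \<open>In every row, entry j dominates the entries of columns 1 to 5 up to the factor 8; it
  vanishes only where they all do. Columns 6 and 7 are exempt because images under \<open>M1\<close>
  and \<open>M2\<close> have zero entries there.\<close>

definition full_column :: "nat list \<Rightarrow> 7 \<Rightarrow> bool" where
  "full_column B j \<longleftrightarrow> (\<forall>z i. nonneg_vec z \<longrightarrow> z $ 6 = 0 \<longrightarrow> z $ 7 = 0 \<longrightarrow>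
     (mat_word B *v z) $ i \<le> 8 * abs_sum z * (mat_word B *v axis j 1) $ i)"

text \<open>Domination between columns survives multiplication by a nonnegative matrix from the
  left, so a list of suffixes is enough to settle all words of length 5.\<close>

lemma full_column_Cons:
  assumes "full_column B j" "k < 3"
  shows "full_column (k # B) j"
proof -
  have "(mat_word (k # B) *v z) $ i \<le> 8 * abs_sum z * (mat_word (k # B) *v axis j 1) $ i"
    if "nonneg_vec z" "z $ 6 = 0" "z $ 7 = 0" for z i
    using mat_word_mono[of "[k]" "mat_word B *v z" "(8 * abs_sum z) *\<^sub>R (mat_word B *v axis j 1)" i]
      assms that
    by (simp add: full_column_def matrix_vector_mult_scaleR matrix_vector_mul_assoc)
  then show ?thesis by (simp add: full_column_def)
qed

text \<open>Every word of length 5 has one of the following words as a suffix.\<close>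

lemma full_columns:
  "full_column [0,0,0,0] 1" "full_column [1,0,0,0] 1" "full_column [2,0,0,0] 1"
  "full_column [1,0,0] 1" "full_column [2,0,0] 1" "full_column [0,1,1,0] 1"
  "full_column [1,1,1,0] 1" "full_column [2,1,1,0] 1" "full_column [2,0] 1"
  "full_column [1,0,0,1,1] 1" "full_column [2,0,0,1,1] 1" "full_column [2,0,1,1] 1"
  "full_column [2,1,1,1] 1" "full_column [1,0,0,2] 1" "full_column [2,0,0,2] 1"
  "full_column [2,0,2] 1" "full_column [1,0,1,2] 1" "full_column [2,0,1,2] 1"
  "full_column [2,1,2] 1"
  "full_column [0,0,0,1] 3" "full_column [1,0,0,1] 3" "full_column [2,0,0,1] 3"
  "full_column [1,0,1] 3" "full_column [2,0,1] 3" "full_column [0,1,1,1] 3"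
  "full_column [1,1,1,1] 3" "full_column [2,1] 3"
  "full_column [0,0,0,1,0] 5" "full_column [1,0,0,1,0] 5" "full_column [2,0,0,1,0] 5"
  "full_column [1,0,1,0] 5" "full_column [2,0,1,0] 5" "full_column [2,1,0] 5"
  "full_column [0,0,0,1,1] 5" "full_column [1,0,1,1] 5" "full_column [2,1,1] 5"
  "full_column [0,0,0,2] 5" "full_column [1,0,2] 5" "full_column [0,0,1,2] 5"
  "full_column [1,1,2] 5" "full_column [2,2] 5"
  unfolding full_column_def forall_7
  by (simp_all add: mat_word_Cons M_mult axis_def abs_sum_nonneg_7 nonneg_vec_7 del: mat_word.simps(2))

lemma full_column_length_5:
  assumes "set B \<subseteq> {..<3}" "length B = 5"
  shows "\<exists>j\<in>{1, 3, 5}. full_column B j"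
proof -
  obtain a b c d e where B: "B = [a, b, c, d, e]"
    using assms(2) by (auto simp: numeral_eq_Suc length_Suc_conv)
  have "a < 3" "b < 3" "c < 3" "d < 3" "e < 3" using assms(1) B by auto
  then show ?thesis unfolding B
    by (elim letter_cases; hypsubst) (blast intro: full_columns full_column_Cons)+
qed

definition ratio_between :: "real \<Rightarrow> real \<Rightarrow> real ^ 7 \<Rightarrow> real ^ 7 \<Rightarrow> bool" where
  "ratio_between a b x y \<longleftrightarrow> (\<forall>i. a * y $ i \<le> x $ i \<and> x $ i \<le> b * y $ i)"

lemma ratio_between_mat_word:
  assumes "set w \<subseteq> {..<3}" "ratio_between a b x y"
  shows "ratio_between a b (mat_word w *v x) (mat_word w *v y)"
  using mat_word_mono[OF assms(1), of "a *\<^sub>R y" x] mat_word_mono[OF assms(1), of x "b *\<^sub>R y"] assms(2)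
  by (simp add: ratio_between_def matrix_vector_mult_scaleR)

text \<open>The vectors reached after an initial letter 1 or an initial pair 20.\<close>

definition switched :: "real \<Rightarrow> real ^ 7 \<Rightarrow> bool" where
  "switched \<delta> z \<longleftrightarrow> nonneg_vec z \<and> 0 < abs_sum z \<and> z $ 6 = 0 \<and> z $ 7 = 0 \<and>
     (\<forall>j\<in>{1, 3, 5}. \<delta> * abs_sum z \<le> z $ j)"

lemma axis_le:
  assumes "nonneg_vec z"
  shows "(z $ j *\<^sub>R axis j 1) $ i \<le> z $ i"
  using assms by (simp add: nonneg_vec_def axis_def)

lemma mat_word_column_le:
  assumes "set B \<subseteq> {..<3}" "nonneg_vec z"
  shows "z $ j * (mat_word B *v axis j 1) $ i \<le> (mat_word B *v z) $ i"
  using mat_word_mono[OF assms(1) axis_le[OF assms(2)]]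
  by (simp add: matrix_vector_mult_scaleR)

text \<open>Entry j holds a share \<delta> of z, and column j dominates up to the factor 8. Hence
  the part of the image that comes from entry j alone is at least the fraction
  \<open>\<delta> / 8\<close> in every row.\<close>

lemma switched_column_bounds:
  assumes B: "set B \<subseteq> {..<3}" "full_column B j" "j \<in> {1, 3, 5}" and z: "switched \<delta> z"
  shows "\<delta> / 8 * (mat_word B *v z) $ i \<le> z $ j * (mat_word B *v axis j 1) $ i"
    and "\<delta> * abs_sum z * (mat_word B *v axis j 1) $ i \<le> (mat_word B *v z) $ i"
    and "(mat_word B *v z) $ i \<le> 8 * abs_sum z * (mat_word B *v axis j 1) $ i"
    and "0 \<le> (mat_word B *v axis j 1 :: real ^ 7) $ i"
proof -
  let ?e = "(mat_word B *v axis j 1 :: real ^ 7) $ i"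
  have "nonneg_vec (mat_word B *v axis j 1 :: real ^ 7)"
    by (intro nonneg_mat_word[OF B(1)]) (simp add: nonneg_vec_def axis_def)
  then show e: "0 \<le> ?e" by (simp add: nonneg_vec_def)
  show 3: "(mat_word B *v z) $ i \<le> 8 * abs_sum z * ?e"
    using B(2) z by (simp add: full_column_def switched_def)
  have zj: "\<delta> * abs_sum z \<le> z $ j" using z B(3) by (auto simp: switched_def)
  from mult_right_mono[OF zj e] have 4: "\<delta> * abs_sum z * ?e \<le> z $ j * ?e" .
  show "\<delta> * abs_sum z * ?e \<le> (mat_word B *v z) $ i"
    using 4 mat_word_column_le[OF B(1), of z j i] z by (simp add: switched_def)
  show "\<delta> / 8 * (mat_word B *v z) $ i \<le> z $ j * ?e"
  \<comment> \<open>The predicate \<open>switched\<close> says nothing about the sign of \<delta>;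
    for negative \<delta> the left side is nonpositive.\<close>
  proof (cases "0 \<le> \<delta>")
    case True
    have "\<delta> / 8 * (mat_word B *v z) $ i \<le> \<delta> / 8 * (8 * abs_sum z * ?e)"
      using 3 True by (intro mult_left_mono) auto
    also have "\<dots> = \<delta> * abs_sum z * ?e" by simp
    finally show ?thesis using 4 by linarith
  next
    case False
    have n: "nonneg_vec z" using z by (simp add: switched_def)
    have "0 \<le> (mat_word B *v z) $ i"
      using nonneg_mat_word[OF B(1) n] by (simp add: nonneg_vec_def)
    then have "\<delta> / 8 * (mat_word B *v z) $ i \<le> 0" using False by (simp add: mult_nonpos_nonneg)
    moreover have "0 \<le> z $ j * ?e" using n e by (simp add: nonneg_vec_def)
    ultimately show ?thesis by linarith
  qed
qed

text \<open>All rows of \<open>B\<close> give weight at least \<open>\<delta> / 8\<close> to the ratio \<open>x\<^sub>j / y\<^sub>j\<close> in the common full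
  column \<open>j\<close>, which pulls both ends of the range of ratios towards it.\<close>

lemma ratio_between_contract:
  assumes B: "set B \<subseteq> {..<3}" "length B = 5" and \<delta>: "0 < \<delta>" "\<delta> \<le> 1"
    and x: "switched \<delta> x" and y: "switched \<delta> y" and r: "ratio_between a b x y"
  shows "\<exists>a' b'. a \<le> a' \<and> b' - a' \<le> (1 - \<delta> / 8) * (b - a) \<and>
    ratio_between a' b' (mat_word B *v x) (mat_word B *v y)"
proof -
  obtain j where j: "j \<in> {1, 3, 5}" "full_column B j"
    using full_column_length_5[OF B] by blast
  define \<kappa> where "\<kappa> = \<delta> / 8"
  have \<kappa>: "0 \<le> \<kappa>" "\<kappa> \<le> 1" using \<delta> by (auto simp: \<kappa>_def)
  have "0 < \<delta> * abs_sum y" using \<delta> y by (simp add: switched_def)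
  moreover have "\<delta> * abs_sum y \<le> y $ j" using y j(1) by (auto simp: switched_def)
  ultimately have yj: "0 < y $ j" by linarith
  define l where "l = x $ j / y $ j"
  have xj: "x $ j = l * y $ j" using yj by (simp add: l_def)
  have "a * y $ j \<le> l * y $ j" "l * y $ j \<le> b * y $ j"
    using r by (auto simp: ratio_between_def simp flip: xj)
  then have l: "a \<le> l" "l \<le> b" using yj by auto
  have "ratio_between (a + \<kappa> * (l - a)) (b - \<kappa> * (b - l)) (mat_word B *v x) (mat_word B *v y)"
    unfolding ratio_between_def
  proof (intro allI conjI)
    fix i
    let ?e = "(mat_word B *v axis j 1 :: real ^ 7) $ i"
    have w: "\<kappa> * (mat_word B *v y) $ i \<le> y $ j * ?e"
      using switched_column_bounds(1)[OF B(1) j(2,1) y] by (simp add: \<kappa>_def)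
    \<comment> \<open>The column estimate is applied to the nonnegative vectors
      \<open>x - a *\<^sub>R y\<close> and \<open>b *\<^sub>R y - x\<close>, whose j-th entries are
      \<open>(l - a) * y $ j\<close> and \<open>(b - l) * y $ j\<close>.\<close>
    have nx: "nonneg_vec (x - a *\<^sub>R y)" "nonneg_vec (b *\<^sub>R y - x)"
      using r by (auto simp: ratio_between_def nonneg_vec_def)
    have "(l - a) * (\<kappa> * (mat_word B *v y) $ i) \<le> (l - a) * (y $ j * ?e)"
      using w l by (intro mult_left_mono) auto
    also have "\<dots> \<le> (mat_word B *v x) $ i - a * (mat_word B *v y) $ i"
      using mat_word_column_le[OF B(1) nx(1), of j i]
      by (simp add: matrix_vector_mult_diff_distrib matrix_vector_mult_scaleR xj algebra_simps)
    finally show "(a + \<kappa> * (l - a)) * (mat_word B *v y) $ i \<le> (mat_word B *v x) $ i"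
      by (simp add: algebra_simps)
    have "(b - l) * (\<kappa> * (mat_word B *v y) $ i) \<le> (b - l) * (y $ j * ?e)"
      using w l by (intro mult_left_mono) auto
    also have "\<dots> \<le> b * (mat_word B *v y) $ i - (mat_word B *v x) $ i"
      using mat_word_column_le[OF B(1) nx(2), of j i]
      by (simp add: matrix_vector_mult_diff_distrib matrix_vector_mult_scaleR xj algebra_simps)
    finally show "(mat_word B *v x) $ i \<le> (b - \<kappa> * (b - l)) * (mat_word B *v y) $ i"
      by (simp add: algebra_simps)
  qed
  moreover have "a \<le> a + \<kappa> * (l - a)" using \<kappa> l by simp
  moreover have "(b - \<kappa> * (b - l)) - (a + \<kappa> * (l - a)) = (1 - \<kappa>) * (b - a)"
    by (simp add: algebra_simps)
  ultimately show ?thesis unfolding \<kappa>_def by (metis order_refl)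
qed

text \<open>One block makes both images comparable to the same column, however different x and y
  were. So the ratios enter an interval whose endpoints have quotient
  \<open>(8 / \<delta>)\<^sup>2\<close>, independently of the two vectors; the later contractions
  start from it.\<close>

lemma ratio_between_init:
  assumes B: "set B \<subseteq> {..<3}" "length B = 5" and \<delta>: "0 < \<delta>" "\<delta> \<le> 1"
    and x: "switched \<delta> x" and y: "switched \<delta> y"
  shows "\<exists>a b. 0 < a \<and> b - a \<le> (8 / \<delta>)\<^sup>2 * a \<and>
    ratio_between a b (mat_word B *v x) (mat_word B *v y)"
proof -
  obtain j where j: "j \<in> {1, 3, 5}" "full_column B j"
    using full_column_length_5[OF B] by blast
  define r where "r = abs_sum x / abs_sum y"
  have Nx: "0 < abs_sum x" and Ny: "0 < abs_sum y" using x y by (auto simp: switched_def)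
  have r: "0 < r" using Nx Ny by (simp add: r_def)
  have xr: "abs_sum x = r * abs_sum y" using Ny by (simp add: r_def)
  have "ratio_between (\<delta> / 8 * r) (8 / \<delta> * r) (mat_word B *v x) (mat_word B *v y)"
    unfolding ratio_between_def
  proof (intro allI conjI)
    fix i
    let ?e = "(mat_word B *v axis j 1 :: real ^ 7) $ i"
    note X = switched_column_bounds(2,3)[OF B(1) j(2,1) x, of i]
    note Y = switched_column_bounds(2,3)[OF B(1) j(2,1) y, of i]
    have "\<delta> / 8 * r * (mat_word B *v y) $ i \<le> \<delta> / 8 * r * (8 * abs_sum y * ?e)"
      using Y r \<delta> by (intro mult_left_mono) auto
    also have "\<dots> = \<delta> * abs_sum x * ?e" by (simp add: xr)
    finally show "\<delta> / 8 * r * (mat_word B *v y) $ i \<le> (mat_word B *v x) $ i"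
      using X by linarith
    have "8 * abs_sum x * ?e = 8 / \<delta> * r * (\<delta> * abs_sum y * ?e)" using \<delta> by (simp add: xr)
    also have "\<dots> \<le> 8 / \<delta> * r * (mat_word B *v y) $ i"
      using Y r \<delta> by (intro mult_left_mono) auto
    finally show "(mat_word B *v x) $ i \<le> 8 / \<delta> * r * (mat_word B *v y) $ i"
      using X by linarith
  qed
  moreover have "8 / \<delta> * r - \<delta> / 8 * r \<le> (8 / \<delta>)\<^sup>2 * (\<delta> / 8 * r)"
    using \<delta> r by (simp add: power2_eq_square)
  moreover have "0 < \<delta> / 8 * r" using \<delta> r by simp
  ultimately show ?thesis by blast
qed

text \<open>Under \<open>M1\<close> the entries 1, 3 and 5 become \<open>y $ 3 + y $ 4\<close>,
  \<open>y $ 4 + y $ 5\<close> and \<open>y $ 3\<close>, all bounded below; dividing by 3 pays for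
  the growth of the sum.\<close>

lemma switched_one:
  assumes "well_spread \<delta> y" "0 < \<delta>"
  shows "switched (\<delta> / 3) (M1 *v y)"
proof -
  have n: "nonneg_vec y" and N: "0 < abs_sum y" and
    *: "\<delta> * abs_sum y \<le> y $ 3" "\<delta> * abs_sum y \<le> y $ 4 + y $ 5"
    using assms by (auto simp: well_spread_def)
  have nM: "nonneg_vec (M1 *v y)" using nonneg_M_mat[OF _ n, of 1] by (simp add: M_mat_simps)
  have "abs_sum (M1 *v y) \<le> 3 * abs_sum y"
    using abs_sum_M_mat_le[of 1 y] by (simp add: M_mat_simps)
  from mult_left_mono[OF this, of "\<delta> / 3"] assms(2)
  have up: "\<delta> / 3 * abs_sum (M1 *v y) \<le> \<delta> * abs_sum y" by simp
  have "\<delta> * abs_sum y \<le> abs_sum (M1 *v y)"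
    using abs_sum_M_mat_ge[of 1, OF _ assms(1)] by (simp add: M_mat_simps)
  then have "0 < abs_sum (M1 *v y)" using N assms(2) by (smt (verit) mult_pos_pos)
  moreover have "0 \<le> y $ 4" using n by (simp add: nonneg_vec_7)
  ultimately show ?thesis using nM up * by (auto simp: switched_def M1_mult)
qed

text \<open>\<open>M2\<close> alone does not suffice: it copies entry 5, for which no lower bound is
  at hand and which stays constant on a run of twos while entry 1 grows. Applying \<open>M0\<close>
  first fills entry 5 with \<open>y $ 1 + y $ 7\<close>. The sum may triple twice, hence 9.\<close>

lemma switched_two_zero:
  assumes "well_spread \<delta> y" "well_spread \<delta> (M0 *v y)" "0 < \<delta>"
  shows "switched (\<delta> / 9) (M2 *v (M0 *v y))"
proof -
  let ?x = "M0 *v y"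
  have n: "nonneg_vec ?x" and N: "0 < abs_sum ?x" and
    *: "\<delta> * abs_sum ?x \<le> ?x $ 1 + ?x $ 7" and y: "\<delta> * abs_sum y \<le> y $ 1 + y $ 7"
    using assms by (auto simp: well_spread_def)
  have nM: "nonneg_vec (M2 *v ?x)" using nonneg_M_mat[OF _ n, of 2] by (simp add: M_mat_simps)
  have 1: "abs_sum (M2 *v ?x) \<le> 3 * abs_sum ?x" and 2: "abs_sum ?x \<le> 3 * abs_sum y"
    using abs_sum_M_mat_le[of 2 ?x] abs_sum_M_mat_le[of 0 y] by (simp_all add: M_mat_simps)
  have "\<delta> / 9 * abs_sum (M2 *v ?x) \<le> \<delta> / 9 * (3 * abs_sum ?x)"
      "\<delta> / 3 * abs_sum ?x \<le> \<delta> / 3 * (3 * abs_sum y)"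
    using assms(3) 1 2 by (intro mult_left_mono; simp)+
  then have up: "\<delta> / 9 * abs_sum (M2 *v ?x) \<le> \<delta> / 3 * abs_sum ?x"
    "\<delta> / 3 * abs_sum ?x \<le> \<delta> * abs_sum y" by simp_all
  have pos: "0 < \<delta> * abs_sum ?x" using N assms(3) by simp
  then have up': "\<delta> / 3 * abs_sum ?x \<le> \<delta> * abs_sum ?x" by simp
  have "\<delta> * abs_sum ?x \<le> abs_sum (M2 *v ?x)"
    using abs_sum_M_mat_ge[of 2, OF _ assms(2)] by (simp add: M_mat_simps)
  then have "0 < abs_sum (M2 *v ?x)" using pos by linarith
  moreover have "\<delta> / 9 * abs_sum (M2 *v ?x) \<le> ?x $ 1 + ?x $ 5 + ?x $ 7"
      "\<delta> / 9 * abs_sum (M2 *v ?x) \<le> ?x $ 1 + ?x $ 7"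
      "\<delta> / 9 * abs_sum (M2 *v ?x) \<le> ?x $ 5"
    using up up' * y n unfolding nonneg_vec_7 M0_mult(5) by argo+
  ultimately show ?thesis using nM by (simp add: switched_def M2_mult)
qed

subsection \<open>Prefixes and a tree argument\<close>

lemma pref_0 [simp]: "pref \<omega> 0 = []"
  by (simp add: pref_def)

lemma length_pref [simp]: "length (pref \<omega> n) = n"
  by (simp add: pref_def)

lemma pref_Suc: "pref \<omega> (Suc n) = \<omega> 0 # pref (shift \<omega>) n"
  by (simp add: pref_def shift_def map_upt_Suc del: upt_Suc)

lemma shift_funpow: "(shift ^^ k) \<omega> i = \<omega> (i + k)"
  by (induction k arbitrary: i) (simp_all add: shift_def)

lemma shift_funpow_Suc: "(shift ^^ Suc k) \<omega> = (shift ^^ k) (shift \<omega>)"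
  by (simp add: funpow_swap1)

lemma pref_add: "pref \<omega> (m + n) = pref \<omega> m @ pref ((shift ^^ m) \<omega>) n"
  by (induction m arbitrary: \<omega>) (simp_all add: pref_Suc funpow_swap1)

lemma shift_Omega: "\<omega> \<in> Omega b \<Longrightarrow> shift \<omega> \<in> Omega b"
  by (simp add: Omega_def shift_def)

lemma shift_funpow_Omega: "\<omega> \<in> Omega b \<Longrightarrow> (shift ^^ k) \<omega> \<in> Omega b"
  by (simp add: Omega_def shift_funpow)

lemma set_pref: "\<omega> \<in> Omega b \<Longrightarrow> set (pref \<omega> n) \<subseteq> {..<b}"
  by (auto simp: Omega_def pref_def)

lemma pref_Suc_right: "pref \<omega> (Suc n) = pref \<omega> n @ [\<omega> n]"
  by (simp add: pref_def)

text \<open>Koenig's lemma for the b-ary tree. The predicate Q inside says that a word has good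
  extensions of every length; it passes from a word to some child.\<close>

lemma infinite_branch:
  assumes closed: "\<And>w v. P (w @ v) \<Longrightarrow> P w"
    and all: "\<And>n. \<exists>w. length w = n \<and> set w \<subseteq> {..<b} \<and> P w"
  shows "\<exists>\<omega>\<in>Omega b. \<forall>n. P (pref \<omega> n)"
proof -
  define Q where "Q w \<longleftrightarrow> (\<forall>n. \<exists>v. length v = n \<and> set v \<subseteq> {..<b} \<and> P (w @ v))" for w
  have Q0: "Q []" using all by (simp add: Q_def)
  have step: "\<exists>k<b. Q (w @ [k])" if "Q w" for w
  proof (rule ccontr)
    assume "\<not> (\<exists>k<b. Q (w @ [k]))"
    then have "\<forall>k. \<exists>n. k < b \<longrightarrow> \<not> (\<exists>v. length v = n \<and> set v \<subseteq> {..<b} \<and> P ((w @ [k]) @ v))"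
      unfolding Q_def by blast
    then obtain N where N: "\<And>k v. k < b \<Longrightarrow> length v = N k \<Longrightarrow> set v \<subseteq> {..<b} \<Longrightarrow> \<not> P ((w @ [k]) @ v)"
      by metis
    \<comment> \<open>If each letter k failed at some length \<open>N k\<close>, an extension longer
      than all these lengths would still have to pass through one of the letters.\<close>
    define m where "m = Max (insert 0 (N ` {..<b}))"
    have m: "N k \<le> m" if "k < b" for k using that by (simp add: m_def)
    obtain v where v: "length v = Suc m" "set v \<subseteq> {..<b}" "P (w @ v)"
      using \<open>Q w\<close> unfolding Q_def by blast
    then obtain k v' where kv: "v = k # v'" by (cases v) auto
    with v have k: "k < b" by auto
    have "P ((w @ [k]) @ take (N k) v')"
      using v(3) closed[of "w @ [k] @ take (N k) v'" "drop (N k) v'"] by (simp add: kv)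
    moreover have "length (take (N k) v') = N k" using v(1) m[OF k] by (simp add: kv)
    moreover have "set (take (N k) v') \<subseteq> {..<b}"
      using v(2) set_take_subset[of "N k" v'] by (auto simp: kv)
    ultimately show False using N[OF k] by blast
  qed
  then obtain f where f: "\<And>w. Q w \<Longrightarrow> f w < b \<and> Q (w @ [f w])" by metis
  define g where "g = rec_nat [] (\<lambda>_ w. w @ [f w])"
  have g: "g 0 = []" "g (Suc n) = g n @ [f (g n)]" for n by (simp_all add: g_def)
  have Qg: "Q (g n)" for n by (induction n) (use Q0 f in \<open>auto simp: g\<close>)
  define \<omega> where "\<omega> n = f (g n)" for n
  have "pref \<omega> n = g n" for n
    by (induction n) (simp_all add: g pref_Suc_right \<omega>_def)
  moreover have "P (g n)" for n
    using Qg[of n] closed unfolding Q_def by blast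
  moreover have "\<omega> \<in> Omega b" using f Qg by (auto simp: Omega_def \<omega>_def)
  ultimately show ?thesis by (intro bexI[of _ \<omega>]) simp_all
qed

subsection \<open>Contraction along a single sequence\<close>

locale positive_vector =
  fixes c :: "real ^ 7" and \<delta> :: real
  assumes c_pos: "\<And>i. 0 < c $ i"
    and \<delta>_pos: "0 < \<delta>" and \<delta>_le: "\<delta> \<le> 1"
    and spread: "\<And>w. set w \<subseteq> {..<3} \<Longrightarrow> well_spread \<delta> (mat_word w *v c)"
begin

abbreviation vec_of :: "nat list \<Rightarrow> real ^ 7" where
  "vec_of w \<equiv> mat_word w *v c"

lemma vec_of_Cons: "vec_of (k # w) = M_mat k *v vec_of w"
  by (rule mat_word_Cons)

lemma vec_of_nonneg: "set w \<subseteq> {..<3} \<Longrightarrow> nonneg_vec (vec_of w)"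
  using spread[of w] by (simp add: well_spread_def)

lemma vec_of_pos: "set w \<subseteq> {..<3} \<Longrightarrow> 0 < abs_sum (vec_of w)"
  using spread[of w] by (simp add: well_spread_def)

text \<open>The continuations u and v are arbitrary. A failure at \<open>w @ w'\<close> is then also
  a failure at w, with w' moved into the continuations, so failure is closed under prefixes as
  \<open>infinite_branch\<close> requires.\<close>

definition focusing :: "(nat \<Rightarrow> nat) \<Rightarrow> bool" where
  "focusing \<omega> \<longleftrightarrow> (\<forall>\<epsilon>>0. \<exists>n. \<forall>u v. set u \<subseteq> {..<3} \<longrightarrow> set v \<subseteq> {..<3} \<longrightarrow>
     abs_sum (unit_sum (vec_of (pref \<omega> n @ u)) - unit_sum (vec_of (pref \<omega> n @ v))) < \<epsilon>)"

text \<open>The action on directions is Lipschitz: 3 bounds the growth of the difference, \<delta>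
  the size of the image of a unit vector from below, and 2 comes from renormalising. Hence focusing
  of a tail carries over to the whole sequence.\<close>

lemma abs_sum_unit_M_mat:
  assumes k: "k < 3" and x: "well_spread \<delta> x" and y: "well_spread \<delta> y"
  shows "abs_sum (unit_sum (M_mat k *v x) - unit_sum (M_mat k *v y))
    \<le> 6 / \<delta> * abs_sum (unit_sum x - unit_sum y)"
proof -
  have unit: "M_mat k *v unit_sum z = (1 / abs_sum z) *\<^sub>R (M_mat k *v z)" for z
    by (simp add: unit_sum_def matrix_vector_mult_scaleR inverse_eq_divide)
  have pos: "\<delta> \<le> abs_sum (M_mat k *v unit_sum z)"
    and eq: "unit_sum (M_mat k *v unit_sum z) = unit_sum (M_mat k *v z)" if "well_spread \<delta> z" for z
  proof -
    have N: "0 < abs_sum z" using that by (simp add: well_spread_def)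
    show "\<delta> \<le> abs_sum (M_mat k *v unit_sum z)"
      using abs_sum_M_mat_ge[OF k that] N by (simp add: unit field_simps)
    show "unit_sum (M_mat k *v unit_sum z) = unit_sum (M_mat k *v z)"
      unfolding unit using N by (intro unit_sum_scaleR) simp
  qed
  let ?d = "abs_sum (unit_sum x - unit_sum y)"
  have "abs_sum (unit_sum (M_mat k *v x) - unit_sum (M_mat k *v y))
      \<le> 2 * abs_sum (M_mat k *v unit_sum x - M_mat k *v unit_sum y) / abs_sum (M_mat k *v unit_sum x)"
    using unit_sum_diff_le[of "M_mat k *v unit_sum x" "M_mat k *v unit_sum y"]
      pos[OF x] pos[OF y] \<delta>_pos by (simp add: eq[OF x] eq[OF y])
  also have "\<dots> \<le> 2 * (3 * ?d) / \<delta>"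
  proof (intro frac_le)
    show "2 * abs_sum (M_mat k *v unit_sum x - M_mat k *v unit_sum y) \<le> 2 * (3 * ?d)"
      using abs_sum_M_mat_le[OF k, of "unit_sum x - unit_sum y"]
      by (simp add: matrix_vector_mult_diff_distrib)
  qed (use pos[OF x] \<delta>_pos in auto)
  finally show ?thesis by simp
qed

lemma focusing_of_shift:
  assumes "focusing (shift \<omega>)" "\<omega> \<in> Omega 3"
  shows "focusing \<omega>"
  unfolding focusing_def
proof (intro allI impI)
  fix \<epsilon> :: real assume "0 < \<epsilon>"
  then have "0 < \<delta> / 6 * \<epsilon>" using \<delta>_pos by simp
  then obtain n where n: "\<And>u v. set u \<subseteq> {..<3} \<Longrightarrow> set v \<subseteq> {..<3} \<Longrightarrow>
     abs_sum (unit_sum (vec_of (pref (shift \<omega>) n @ u)) - unit_sum (vec_of (pref (shift \<omega>) n @ v)))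
       < \<delta> / 6 * \<epsilon>"
    using assms(1) unfolding focusing_def by blast
  have k: "\<omega> 0 < 3" using assms(2) by (simp add: Omega_def)
  note s = set_pref[OF shift_Omega[OF assms(2)], of n]
  have "abs_sum (unit_sum (vec_of (pref \<omega> (Suc n) @ u)) - unit_sum (vec_of (pref \<omega> (Suc n) @ v))) < \<epsilon>"
    if u: "set u \<subseteq> {..<3}" and v: "set v \<subseteq> {..<3}" for u v
  proof -
    have "abs_sum (unit_sum (vec_of (pref \<omega> (Suc n) @ u)) - unit_sum (vec_of (pref \<omega> (Suc n) @ v)))
      \<le> 6 / \<delta> * abs_sum (unit_sum (vec_of (pref (shift \<omega>) n @ u)) - unit_sum (vec_of (pref (shift \<omega>) n @ v)))"
      using s u v unfolding pref_Suc append_Cons vec_of_Cons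
      by (intro abs_sum_unit_M_mat k spread) auto
    also have "\<dots> < 6 / \<delta> * (\<delta> / 6 * \<epsilon>)"
      using n[OF u v] \<delta>_pos by (intro mult_strict_left_mono) auto
    finally show ?thesis using \<delta>_pos by simp
  qed
  then show "\<exists>n. \<forall>u v. set u \<subseteq> {..<3} \<longrightarrow> set v \<subseteq> {..<3} \<longrightarrow>
     abs_sum (unit_sum (vec_of (pref \<omega> n @ u)) - unit_sum (vec_of (pref \<omega> n @ v))) < \<epsilon>"
    by blast
qed

lemma focusing_of_shift_funpow:
  "focusing ((shift ^^ m) \<omega>) \<Longrightarrow> \<omega> \<in> Omega 3 \<Longrightarrow> focusing \<omega>"
proof (induction m arbitrary: \<omega>)
  case (Suc m)
  have "focusing (shift \<omega>)"
    by (rule Suc.IH[OF _ shift_Omega[OF Suc.prems(2)]]) (use Suc.prems(1) in \<open>simp only: shift_funpow_Suc\<close>)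
  then show ?case using Suc.prems(2) by (rule focusing_of_shift)
qed simp

text \<open>Meant for the two constant sequences, where all continuations share one limiting
  direction p with error of order 1/n. Starting at n = 2 leaves room for the coordinate identities
  that hold once two letters of the run have acted.\<close>

lemma focusing_of_limit:
  assumes "\<And>n u. 2 \<le> n \<Longrightarrow> set u \<subseteq> {..<3} \<Longrightarrow>
    real n * abs_sum (unit_sum (vec_of (pref \<omega> n @ u)) - p) \<le> K"
  shows "focusing \<omega>"
  unfolding focusing_def
proof (intro allI impI)
  fix \<epsilon> :: real assume \<epsilon>: "0 < \<epsilon>"
  obtain n0 where n0: "2 * K / \<epsilon> < real n0" using reals_Archimedean2 by blast
  define n where "n = max 2 n0"
  have n: "2 * K / \<epsilon> < real n" "2 \<le> n" using n0 by (auto simp: n_def)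
  have *: "abs_sum (unit_sum (vec_of (pref \<omega> n @ u)) - p) < \<epsilon> / 2" if "set u \<subseteq> {..<3}" for u
  proof -
    have "real n * abs_sum (unit_sum (vec_of (pref \<omega> n @ u)) - p) < real n * (\<epsilon> / 2)"
      using assms[OF n(2) that] n(1) \<epsilon> by (simp add: field_simps)
    then show ?thesis using n(2) by simp
  qed
  have "abs_sum (unit_sum (vec_of (pref \<omega> n @ u)) - unit_sum (vec_of (pref \<omega> n @ v))) < \<epsilon>"
    if "set u \<subseteq> {..<3}" "set v \<subseteq> {..<3}" for u v
    using abs_sum_triangle_diff[of "unit_sum (vec_of (pref \<omega> n @ u))" "unit_sum (vec_of (pref \<omega> n @ v))" p]
      *[OF that(1)] *[OF that(2)] abs_sum_minus_commute[of p] by simp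
  then show "\<exists>n. \<forall>u v. set u \<subseteq> {..<3} \<longrightarrow> set v \<subseteq> {..<3} \<longrightarrow>
     abs_sum (unit_sum (vec_of (pref \<omega> n @ u)) - unit_sum (vec_of (pref \<omega> n @ v))) < \<epsilon>"
    by blast
qed

section \<open>Sequences with infinitely many switches\<close>

definition switch :: "(nat \<Rightarrow> nat) \<Rightarrow> nat \<Rightarrow> bool" where
  "switch \<omega> p \<longleftrightarrow> \<omega> p = 1 \<or> \<omega> p = 2 \<and> \<omega> (Suc p) = 0"

lemma switched_mono:
  assumes "switched a z" "b \<le> a"
  shows "switched b z"
proof -
  have "b * abs_sum z \<le> a * abs_sum z" using assms(2) by (intro mult_right_mono) auto
  then show ?thesis using assms(1) unfolding switched_def by (meson order_trans)
qed

lemma switched_tail: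
  assumes "switch \<omega> 0" "\<omega> \<in> Omega 3" "2 \<le> n" "set u \<subseteq> {..<3}"
  shows "switched (\<delta> / 9) (vec_of (pref \<omega> n @ u))"
proof -
  obtain m where m: "n = Suc (Suc m)" using assms(3) by (metis Suc_le_D numeral_2_eq_2 Suc_le_mono)
  let ?w = "pref (shift (shift \<omega>)) m @ u"
  have w: "set ?w \<subseteq> {..<3}"
    using set_pref[OF shift_Omega[OF shift_Omega[OF assms(2)]]] assms(4) by simp
  have k: "\<omega> (Suc 0) < 3" using assms(2) by (simp add: Omega_def)
  have eq: "pref \<omega> n @ u = \<omega> 0 # \<omega> (Suc 0) # ?w" by (simp add: m pref_Suc shift_def)
  have s1: "set (\<omega> (Suc 0) # ?w) \<subseteq> {..<3}" using w k by simp
  show ?thesis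
  proof (cases "\<omega> 0 = 1")
    case True
    have "switched (\<delta> / 3) (M1 *v vec_of (\<omega> (Suc 0) # ?w))"
      by (intro switched_one spread s1 \<delta>_pos)
    then have "switched (\<delta> / 9) (M1 *v vec_of (\<omega> (Suc 0) # ?w))"
      by (rule switched_mono) (use \<delta>_pos in simp)
    then show ?thesis by (simp only: eq vec_of_Cons[of 1] True M_mat_simps)
  next
    case False
    then have *: "\<omega> 0 = 2" "\<omega> (Suc 0) = 0" using assms(1) by (auto simp: switch_def)
    have "switched (\<delta> / 9) (M2 *v (M0 *v vec_of ?w))"
      using switched_two_zero[OF spread[OF w]] spread[OF s1] \<delta>_pos
      unfolding * vec_of_Cons M_mat_simps by blast
    then show ?thesis unfolding eq vec_of_Cons * M_mat_simps .
  qed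
qed

text \<open>The matrices nearest the start of the sequence act last, so the induction adds a new
  contraction in front of the k found in a shifted sequence. The constants are those of one block
  for vectors that are switched with \<open>\<delta> / 9\<close>: the fraction (\<delta>/9)/8 =
  \<delta>/72, and the initial quotient (72/\<delta>) squared.\<close>

lemma ratio_between_switching:
  assumes "\<forall>m. \<exists>p\<ge>m. switch \<omega> p" "\<omega> \<in> Omega 3"
  shows "\<exists>n. \<forall>u v. set u \<subseteq> {..<3} \<longrightarrow> set v \<subseteq> {..<3} \<longrightarrow> (\<exists>a b. 0 < a \<and>
    b - a \<le> (1 - \<delta> / 72) ^ k * (72 / \<delta>)\<^sup>2 * a \<and>
    ratio_between a b (vec_of (pref \<omega> n @ u)) (vec_of (pref \<omega> n @ v)))"
  using assms
proof (induction k arbitrary: \<omega>)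
  \<comment> \<open>A switch at a position of at least 5 leaves room for the contracting block of
    five letters in front of it.\<close>
  have *: "\<exists>q. switch ((shift ^^ (q + 5)) \<omega>) 0" if sw: "\<forall>m. \<exists>p\<ge>m. switch \<omega> p" for \<omega>
  proof -
    obtain p where "5 \<le> p" "switch \<omega> p" using sw by blast
    then have "switch ((shift ^^ ((p - 5) + 5)) \<omega>) 0" by (simp add: switch_def shift_funpow)
    then show ?thesis by blast
  qed
  {
    case 0
    obtain q where q: "switch ((shift ^^ (q + 5)) \<omega>) 0" using *[OF 0(1)] by blast
    let ?\<omega> = "(shift ^^ (q + 5)) \<omega>" and ?B = "pref ((shift ^^ q) \<omega>) 5"
    have \<omega>: "?\<omega> \<in> Omega 3" using 0(2) by (rule shift_funpow_Omega)
    have B: "set ?B \<subseteq> {..<3}" "length ?B = 5"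
      using set_pref[OF shift_funpow_Omega[OF 0(2)]] by auto
    have "\<exists>a b. 0 < a \<and> b - a \<le> (72 / \<delta>)\<^sup>2 * a \<and>
        ratio_between a b (vec_of (pref \<omega> (q + 5 + 2) @ u)) (vec_of (pref \<omega> (q + 5 + 2) @ v))"
      if u: "set u \<subseteq> {..<3}" and v: "set v \<subseteq> {..<3}" for u v
    proof -
      have "switched (\<delta> / 9) (vec_of (pref ?\<omega> 2 @ u))" "switched (\<delta> / 9) (vec_of (pref ?\<omega> 2 @ v))"
        using q \<omega> u v by (intro switched_tail; simp)+
      from ratio_between_init[OF B _ _ this] obtain a b where
        ab: "0 < a" "b - a \<le> (72 / \<delta>)\<^sup>2 * a"
        "ratio_between a b (mat_word ?B *v vec_of (pref ?\<omega> 2 @ u)) (mat_word ?B *v vec_of (pref ?\<omega> 2 @ v))"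
        using \<delta>_pos \<delta>_le by auto
      from ratio_between_mat_word[OF set_pref[OF 0(2)] ab(3)]
      have "ratio_between a b (vec_of (pref \<omega> (q + 5 + 2) @ u)) (vec_of (pref \<omega> (q + 5 + 2) @ v))"
        unfolding pref_add[of \<omega> "q + 5" 2] pref_add[of \<omega> q 5] mat_word_append .
      then show ?thesis using ab by blast
    qed
    then show ?case unfolding power_0 mult_1 by blast
  next
    case (Suc k)
    obtain q where q: "switch ((shift ^^ (q + 5)) \<omega>) 0" using *[OF Suc.prems(1)] by blast
    let ?\<omega> = "(shift ^^ (q + 5)) \<omega>" and ?B = "pref ((shift ^^ q) \<omega>) 5"
    let ?g = "\<lambda>k. (1 - \<delta> / 72) ^ k * (72 / \<delta>)\<^sup>2"
    have \<omega>: "?\<omega> \<in> Omega 3" using Suc.prems(2) by (rule shift_funpow_Omega)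
    have B: "set ?B \<subseteq> {..<3}" "length ?B = 5"
      using set_pref[OF shift_funpow_Omega[OF Suc.prems(2)]] by auto
    have "\<exists>p\<ge>m. switch ?\<omega> p" for m
    proof -
      obtain p where "m + (q + 5) \<le> p" "switch \<omega> p" using Suc.prems(1) by blast
      then have "switch ?\<omega> (p - (q + 5))" "m \<le> p - (q + 5)"
        by (auto simp: switch_def shift_funpow Suc_diff_le)
      then show ?thesis by blast
    qed
    from Suc.IH[OF _ \<omega>] this obtain n' where n': "\<And>u v. set u \<subseteq> {..<3} \<Longrightarrow> set v \<subseteq> {..<3} \<Longrightarrow>
       \<exists>a b. 0 < a \<and> b - a \<le> ?g k * a \<and>
       ratio_between a b (vec_of (pref ?\<omega> n' @ u)) (vec_of (pref ?\<omega> n' @ v))" by blast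
    \<comment> \<open>Two further letters make sure that the prefix contains the whole switch at its
      start. The induction hypothesis absorbs them into the continuations.\<close>
    define n where "n = n' + 2"
    have "\<exists>a b. 0 < a \<and> b - a \<le> ?g (Suc k) * a \<and>
        ratio_between a b (vec_of (pref \<omega> (q + 5 + n) @ u)) (vec_of (pref \<omega> (q + 5 + n) @ v))"
      if u: "set u \<subseteq> {..<3}" and v: "set v \<subseteq> {..<3}" for u v
    proof -
      let ?r = "pref ((shift ^^ n') ?\<omega>) 2"
      have r: "set ?r \<subseteq> {..<3}" by (rule set_pref[OF shift_funpow_Omega[OF \<omega>]])
      have "\<exists>a b. 0 < a \<and> b - a \<le> ?g k * a \<and>
         ratio_between a b (vec_of (pref ?\<omega> n @ u)) (vec_of (pref ?\<omega> n @ v))"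
        using n'[of "?r @ u" "?r @ v"] r u v unfolding n_def pref_add append_assoc by simp
      then obtain a b where ab: "0 < a" "b - a \<le> ?g k * a"
         "ratio_between a b (vec_of (pref ?\<omega> n @ u)) (vec_of (pref ?\<omega> n @ v))" by blast
      have "switched (\<delta> / 9) (vec_of (pref ?\<omega> n @ u))" "switched (\<delta> / 9) (vec_of (pref ?\<omega> n @ v))"
        using q \<omega> u v by (intro switched_tail; simp add: n_def)+
      from ratio_between_contract[OF B _ _ this ab(3)] obtain a' b' where
        ab': "a \<le> a'" "b' - a' \<le> (1 - \<delta> / 72) * (b - a)"
        "ratio_between a' b' (mat_word ?B *v vec_of (pref ?\<omega> n @ u)) (mat_word ?B *v vec_of (pref ?\<omega> n @ v))"
        using \<delta>_pos \<delta>_le by auto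
      from ratio_between_mat_word[OF set_pref[OF Suc.prems(2)] ab'(3)]
      have 1: "ratio_between a' b' (vec_of (pref \<omega> (q + 5 + n) @ u)) (vec_of (pref \<omega> (q + 5 + n) @ v))"
        unfolding pref_add[of \<omega> "q + 5" n] pref_add[of \<omega> q 5] mat_word_append .
      have \<kappa>: "0 \<le> 1 - \<delta> / 72" using \<delta>_le by simp
      have "(1 - \<delta> / 72) * (b - a) \<le> (1 - \<delta> / 72) * (?g k * a)"
        using ab(2) \<kappa> by (rule mult_left_mono)
      also have "\<dots> = ?g (Suc k) * a" by simp
      also have "\<dots> \<le> ?g (Suc k) * a'" using ab'(1) \<kappa> by (intro mult_left_mono) auto
      finally show ?thesis using ab(1) ab' 1 by (intro exI[of _ a'] exI[of _ b']) auto
    qed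
    then show ?case by blast
  }
qed

lemma unit_sum_ratio_between:
  assumes "ratio_between a b x y" "0 < a" "nonneg_vec y" "0 < abs_sum x" "0 < abs_sum y"
  shows "abs_sum (unit_sum x - unit_sum y) \<le> 2 * (b - a) / a"
proof -
  have "abs_sum (a *\<^sub>R y - x) \<le> (b - a) * abs_sum y"
    unfolding abs_sum_def sum_distrib_left
  proof (intro sum_mono)
    fix i
    have "a * y $ i \<le> x $ i" "x $ i \<le> b * y $ i" "0 \<le> y $ i"
      using assms by (auto simp: ratio_between_def nonneg_vec_def)
    then show "\<bar>(a *\<^sub>R y - x) $ i\<bar> \<le> (b - a) * \<bar>y $ i\<bar>" by (simp add: algebra_simps)
  qed
  then have "2 * abs_sum (a *\<^sub>R y - x) / (a * abs_sum y) \<le> 2 * ((b - a) * abs_sum y) / (a * abs_sum y)"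
    using assms by (intro divide_right_mono) auto
  moreover have "abs_sum (unit_sum (a *\<^sub>R y) - unit_sum x) \<le> 2 * abs_sum (a *\<^sub>R y - x) / abs_sum (a *\<^sub>R y)"
    using assms by (intro unit_sum_diff_le) auto
  ultimately show ?thesis
    using assms by (simp add: unit_sum_scaleR abs_sum_minus_commute[of "unit_sum x"])
qed

lemma focusing_switching:
  assumes "\<forall>m. \<exists>p\<ge>m. switch \<omega> p" "\<omega> \<in> Omega 3"
  shows "focusing \<omega>"
  unfolding focusing_def
proof (intro allI impI)
  fix \<epsilon> :: real assume \<epsilon>: "0 < \<epsilon>"
  have "norm (1 - \<delta> / 72) < 1" using \<delta>_pos \<delta>_le by simp
  then have "(\<lambda>k. (1 - \<delta> / 72) ^ k) \<longlonglongrightarrow> 0" by (rule LIMSEQ_power_zero)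
  then have "(\<lambda>k. 2 * ((1 - \<delta> / 72) ^ k * (72 / \<delta>)\<^sup>2)) \<longlonglongrightarrow> 2 * (0 * (72 / \<delta>)\<^sup>2)"
    by (intro tendsto_mult tendsto_const)
  then have "eventually (\<lambda>k. 2 * ((1 - \<delta> / 72) ^ k * (72 / \<delta>)\<^sup>2) < \<epsilon>) sequentially"
    using \<epsilon> by (intro order_tendstoD) auto
  then obtain k where k: "2 * ((1 - \<delta> / 72) ^ k * (72 / \<delta>)\<^sup>2) < \<epsilon>"
    by (auto simp: eventually_sequentially)
  obtain n where n: "\<And>u v. set u \<subseteq> {..<3} \<Longrightarrow> set v \<subseteq> {..<3} \<Longrightarrow> \<exists>a b. 0 < a \<and>
    b - a \<le> (1 - \<delta> / 72) ^ k * (72 / \<delta>)\<^sup>2 * a \<and>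
    ratio_between a b (vec_of (pref \<omega> n @ u)) (vec_of (pref \<omega> n @ v))"
    using ratio_between_switching[OF assms] by metis
  have "abs_sum (unit_sum (vec_of (pref \<omega> n @ u)) - unit_sum (vec_of (pref \<omega> n @ v))) < \<epsilon>"
    if u: "set u \<subseteq> {..<3}" and v: "set v \<subseteq> {..<3}" for u v
  proof -
    obtain a b where ab: "0 < a" "b - a \<le> (1 - \<delta> / 72) ^ k * (72 / \<delta>)\<^sup>2 * a"
      "ratio_between a b (vec_of (pref \<omega> n @ u)) (vec_of (pref \<omega> n @ v))"
      using n[OF u v] by blast
    have s: "set (pref \<omega> n @ u) \<subseteq> {..<3}" "set (pref \<omega> n @ v) \<subseteq> {..<3}"
      using set_pref[OF assms(2), of n] u v by auto
    have "abs_sum (unit_sum (vec_of (pref \<omega> n @ u)) - unit_sum (vec_of (pref \<omega> n @ v))) \<le> 2 * (b - a) / a"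
      by (intro unit_sum_ratio_between ab vec_of_nonneg vec_of_pos s)
    also have "\<dots> \<le> 2 * ((1 - \<delta> / 72) ^ k * (72 / \<delta>)\<^sup>2)"
      using ab(1,2) by (simp add: divide_le_eq)
    finally show ?thesis using k by linarith
  qed
  then show "\<exists>n. \<forall>u v. set u \<subseteq> {..<3} \<longrightarrow> set v \<subseteq> {..<3} \<longrightarrow>
     abs_sum (unit_sum (vec_of (pref \<omega> n @ u)) - unit_sum (vec_of (pref \<omega> n @ v))) < \<epsilon>"
    by blast
qed

text \<open>The four quantities are rotated by \<open>M0\<close>, each of them gaining \<open>y\<^sub>1\<close>; hence their differences
  stay bounded by a multiple of \<open>y\<^sub>1\<close> while they grow linearly along a run of zeros.\<close>

definition phase :: "real ^ 7 \<Rightarrow> nat \<Rightarrow> real" where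
  "phase y i = [4 * y $ 3 + 3 * y $ 1, 4 * (y $ 4 + y $ 5) + 2 * y $ 1,
     4 * y $ 7 + 5 * y $ 1, 4 * y $ 2 + 4 * y $ 1] ! i"

lemma phase_simps:
  "phase y 0 = 4 * y $ 3 + 3 * y $ 1"
  "phase y (Suc 0) = 4 * (y $ 4 + y $ 5) + 2 * y $ 1"
  "phase y 2 = 4 * y $ 7 + 5 * y $ 1"
  "phase y 3 = 4 * y $ 2 + 4 * y $ 1"
  by (simp_all add: phase_def numeral_2_eq_2 numeral_3_eq_3)

text \<open>In the cycle where entry 3 receives 4 + 5, this sum receives 7 + 1, 7 receives 2 and 2
  receives 3, entry 1 is gained at only one of four places. The factor 4 and the offsets 3, 2, 5, 4
  spread this gain evenly.\<close>

lemma phase_M0: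
  "phase (M0 *v y) 0 = phase y (Suc 0) + y $ 1"
  "phase (M0 *v y) (Suc 0) = phase y 2 + y $ 1"
  "phase (M0 *v y) 2 = phase y 3 + y $ 1"
  "phase (M0 *v y) 3 = phase y 0 + y $ 1"
  by (simp_all add: phase_simps M0_mult)

definition in_phase :: "real \<Rightarrow> real ^ 7 \<Rightarrow> bool" where
  "in_phase K y \<longleftrightarrow> \<bar>phase y 0 - phase y (Suc 0)\<bar> \<le> K * y $ 1 \<and>
     \<bar>phase y (Suc 0) - phase y 2\<bar> \<le> K * y $ 1 \<and>
     \<bar>phase y 2 - phase y 3\<bar> \<le> K * y $ 1 \<and> \<bar>phase y 3 - phase y 0\<bar> \<le> K * y $ 1"

lemma in_phase_of_large:
  assumes "nonneg_vec y" "9 * abs_sum y \<le> K * y $ 1"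
  shows "in_phase K y"
proof -
  have "0 \<le> phase y 0" "0 \<le> phase y (Suc 0)" "0 \<le> phase y 2" "0 \<le> phase y 3"
    "phase y 0 \<le> 9 * abs_sum y" "phase y (Suc 0) \<le> 9 * abs_sum y"
    "phase y 2 \<le> 9 * abs_sum y" "phase y 3 \<le> 9 * abs_sum y"
    using assms(1) unfolding phase_simps abs_sum_nonneg_7[OF assms(1)] nonneg_vec_7 by argo+
  then show ?thesis using assms(2) unfolding in_phase_def by linarith
qed

text \<open>Letters 1 and 2 refill entry 1, which zeros leave constant. The next lemma is the
  counterpart for entry 5, which twos leave constant.\<close>

lemma M_mat_first_ge:
  assumes "well_spread \<delta> y" "k = 1 \<or> k = 2"
  shows "\<delta> / 3 * abs_sum (M_mat k *v y) \<le> (M_mat k *v y) $ 1"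
proof -
  have "\<delta> / 3 * abs_sum (M_mat k *v y) \<le> \<delta> / 3 * (3 * abs_sum y)"
    using abs_sum_M_mat_le[of k y] assms(2) \<delta>_pos by (intro mult_left_mono) auto
  moreover have "\<delta> * abs_sum y \<le> (M_mat k *v y) $ 1"
    using assms unfolding well_spread_def nonneg_vec_7 by (elim disjE; simp add: M_mult)
  ultimately show ?thesis by simp
qed

lemma M_mat_fifth_ge:
  assumes "well_spread \<delta> y" "k = 0 \<or> k = 1"
  shows "\<delta> / 3 * abs_sum (M_mat k *v y) \<le> (M_mat k *v y) $ 5"
proof -
  have "\<delta> / 3 * abs_sum (M_mat k *v y) \<le> \<delta> / 3 * (3 * abs_sum y)"
    using abs_sum_M_mat_le[of k y] assms(2) \<delta>_pos by (intro mult_left_mono) auto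
  moreover have "\<delta> * abs_sum y \<le> (M_mat k *v y) $ 5"
    using assms unfolding well_spread_def nonneg_vec_7 by (elim disjE; simp add: M_mult)
  ultimately show ?thesis by simp
qed

text \<open>A zero fixes entry 1 and permutes the four differences, so a bound K persists exactly.
  After a letter 1 or 2, entry 1 is at least the share \<open>\<delta> / 3\<close>, and the bound
  starts afresh with 9/(\<delta>/3) = 27/\<delta>. The other term of the maximum serves c
  itself.\<close>

lemma in_phase_vec_of: "\<exists>K\<ge>0. \<forall>w. set w \<subseteq> {..<3} \<longrightarrow> in_phase K (vec_of w)"
proof -
  define K where "K = max (9 * abs_sum c / c $ 1) (27 / \<delta>)"
  have K: "9 * abs_sum c / c $ 1 \<le> K" "27 / \<delta> \<le> K" by (auto simp: K_def)
  have K0: "0 \<le> K" using K(2) \<delta>_pos by (smt (verit) divide_pos_pos)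
  have "in_phase K (vec_of w)" if "set w \<subseteq> {..<3}" for w
    using that
  proof (induction w)
    case Nil
    have "9 * abs_sum c \<le> K * c $ 1" using K(1) c_pos[of 1] by (simp add: field_simps)
    then show ?case using vec_of_nonneg[of "[]"] by (simp add: in_phase_of_large)
  next
    case (Cons k w)
    let ?y = "vec_of w"
    have w: "set w \<subseteq> {..<3}" and k: "k < 3" using Cons.prems by auto
    show ?case
    proof (cases "k = 0")
      case True
      show ?thesis
        using Cons.IH[OF w] unfolding in_phase_def vec_of_Cons True M_mat_simps phase_M0 M0_mult
        by simp
    next
      case False
      then have "k = 1 \<or> k = 2" using k by linarith
      then have "27 / \<delta> * (\<delta> / 3 * abs_sum (M_mat k *v ?y)) \<le> 27 / \<delta> * (M_mat k *v ?y) $ 1"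
        using M_mat_first_ge[OF spread[OF w]] \<delta>_pos by (intro mult_left_mono) auto
      also have "\<dots> \<le> K * (M_mat k *v ?y) $ 1"
        using K(2) nonneg_M_mat[OF k vec_of_nonneg[OF w]]
        by (intro mult_right_mono) (auto simp: nonneg_vec_def)
      finally show ?thesis unfolding vec_of_Cons
        using \<delta>_pos by (intro in_phase_of_large nonneg_M_mat k vec_of_nonneg w) simp
    qed
  qed
  then show ?thesis using K0 by blast
qed

lemma pref_const: "pref (\<lambda>_. k) n = replicate n k"
  by (simp add: pref_def map_replicate_const)

lemma phase_zero_run:
  assumes "set u \<subseteq> {..<3}"
  shows "vec_of (replicate n 0 @ u) $ 1 = vec_of u $ 1 \<and>
    (\<forall>i\<in>{0, Suc 0, 2, 3}. real n * vec_of u $ 1 \<le> phase (vec_of (replicate n 0 @ u)) i)"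
proof (induction n)
  case 0
  then show ?case using vec_of_nonneg[OF assms] by (simp add: phase_simps nonneg_vec_7)
next
  case (Suc n)
  then show ?case
    by (simp only: replicate_Suc append_Cons vec_of_Cons M_mat_simps)
       (simp add: phase_M0 M0_mult distrib_right)
qed

lemma focusing_zeros: "focusing (\<lambda>_. 0)"
proof -
  obtain K where K: "0 \<le> K" "\<And>w. set w \<subseteq> {..<3} \<Longrightarrow> in_phase K (vec_of w)"
    using in_phase_vec_of by blast
  \<comment> \<open>The direction in which all phases agree and entry 1 is negligible: entries 2, 3,
    5 and 7 are then equal, entry 4 is 0 and entry 6 equals entry 3.\<close>
  define p :: "real ^ 7" where "p = vector [0, 1, 1, 0, 1, 1, 1]"
  have "real n * abs_sum (unit_sum (vec_of (pref (\<lambda>_. 0) n @ u)) - unit_sum p) \<le> 14 * (2 * K + 3)"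
    if n: "2 \<le> n" and u: "set u \<subseteq> {..<3}" for n u
  proof -
    obtain m where m: "n = Suc (Suc m)" using n by (metis Suc_le_D numeral_2_eq_2 Suc_le_mono)
    define y where "y = vec_of (replicate n 0 @ u)"
    have s: "set (replicate n 0 @ u) \<subseteq> {..<3}" "set (replicate m 0 @ u) \<subseteq> {..<3}" using u by auto
    have ny: "nonneg_vec y" and Ny: "0 < abs_sum y" and sy: "well_spread \<delta> y"
      unfolding y_def by (rule vec_of_nonneg[OF s(1)] vec_of_pos[OF s(1)] spread[OF s(1)])+
    have y3: "0 < y $ 3" using sy Ny \<delta>_pos unfolding well_spread_def by (smt (verit) mult_pos_pos)
    \<comment> \<open>Two zeros are needed: the outer one annihilates entry 4 and copies the old
      entry 5 into 6, the inner one annihilates the old entry 4, so that the new entry 3 is also the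
      old entry 5.\<close>
    have y46: "y $ 4 = 0" "y $ 6 = y $ 3"
      unfolding y_def m replicate_Suc append_Cons vec_of_Cons M_mat_simps M0_mult by simp_all
    have ph: "in_phase K y" unfolding y_def using s by (intro K(2))
    have "real n * y $ 1 \<le> phase y 0" using phase_zero_run[OF u, of n] by (simp add: y_def)
    then have n1: "real n * y $ 1 \<le> 7 * abs_sum y"
      using ny unfolding phase_simps abs_sum_nonneg_7[OF ny] nonneg_vec_7 by argo
    have "abs_sum (y - y $ 3 *\<^sub>R p) = \<bar>y $ 1\<bar> + \<bar>y $ 2 - y $ 3\<bar> + \<bar>y $ 5 - y $ 3\<bar> + \<bar>y $ 7 - y $ 3\<bar>"
      by (simp add: abs_sum_def sum_7 p_def vector_7 y46)
    also have "\<dots> \<le> (2 * K + 3) * y $ 1"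
    proof -
      define D where "D = K * y $ 1"
      have "0 \<le> y $ 1" "0 \<le> D" using ny K(1) by (auto simp: nonneg_vec_7 D_def)
      \<comment> \<open>Entries 7 and 3 are two phases apart, so their bound is doubled.\<close>
      moreover have "\<bar>y $ 2 - y $ 3\<bar> \<le> (D + y $ 1) / 4" "\<bar>y $ 5 - y $ 3\<bar> \<le> (D + y $ 1) / 4"
          "\<bar>y $ 7 - y $ 3\<bar> \<le> (2 * D + 2 * y $ 1) / 4"
        using ph calculation unfolding in_phase_def D_def[symmetric] phase_simps y46 abs_le_iff
        by argo+
      moreover have "\<bar>y $ 1\<bar> = y $ 1" using ny by (simp add: nonneg_vec_7)
      moreover have "(2 * K + 3) * y $ 1 = 2 * D + 3 * y $ 1" by (simp add: D_def distrib_right)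
      ultimately show ?thesis by argo
    qed
    finally have d: "abs_sum (y - y $ 3 *\<^sub>R p) \<le> (2 * K + 3) * y $ 1" .
    have "abs_sum (y $ 3 *\<^sub>R p) = 5 * y $ 3"
      using y3 by (simp add: abs_sum_def sum_7 p_def vector_7)
    then have "abs_sum (unit_sum y - unit_sum (y $ 3 *\<^sub>R p)) \<le> 2 * abs_sum (y - y $ 3 *\<^sub>R p) / abs_sum y"
      using y3 Ny by (intro unit_sum_diff_le) auto
    also have "\<dots> \<le> 2 * ((2 * K + 3) * y $ 1) / abs_sum y"
      using d Ny by (intro divide_right_mono) auto
    finally have "real n * abs_sum (unit_sum y - unit_sum p)
        \<le> real n * (2 * ((2 * K + 3) * y $ 1) / abs_sum y)"
      unfolding unit_sum_scaleR[OF y3] by (intro mult_left_mono) auto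
    also have "\<dots> = 2 * (2 * K + 3) * (real n * y $ 1) / abs_sum y" by simp
    also have "\<dots> \<le> 2 * (2 * K + 3) * (7 * abs_sum y) / abs_sum y"
      using n1 K(1) Ny by (intro divide_right_mono mult_left_mono) auto
    also have "\<dots> = 14 * (2 * K + 3)" using Ny by simp
    finally show ?thesis by (simp add: pref_const y_def)
  qed
  then show ?thesis by (rule focusing_of_limit)
qed

text \<open>The counterpart of \<open>in_phase_vec_of\<close> for runs of twos: \<open>M2\<close>
  preserves both \<open>y $ 4 - y $ 1 - y $ 7\<close> and \<open>y $ 5\<close>, while the letters 0
  and 1 give entry 5 the share \<open>\<delta> / 3\<close>, from which the bound starts
  afresh.\<close>

lemma excess_vec_of:
  "\<exists>K\<ge>0. \<forall>w. set w \<subseteq> {..<3} \<longrightarrow> \<bar>vec_of w $ 4 - vec_of w $ 1 - vec_of w $ 7\<bar> \<le> K * vec_of w $ 5"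
proof -
  define K where "K = max (abs_sum c / c $ 5) (3 / \<delta>)"
  have K: "abs_sum c / c $ 5 \<le> K" "3 / \<delta> \<le> K" by (auto simp: K_def)
  have K0: "0 \<le> K" using K(2) \<delta>_pos by (smt (verit) divide_pos_pos)
  have large: "\<bar>y $ 4 - y $ 1 - y $ 7\<bar> \<le> abs_sum y" if "nonneg_vec y" for y :: "real ^ 7"
    using that unfolding abs_sum_nonneg_7[OF that] nonneg_vec_7 by linarith
  have "\<bar>vec_of w $ 4 - vec_of w $ 1 - vec_of w $ 7\<bar> \<le> K * vec_of w $ 5" if "set w \<subseteq> {..<3}" for w
    using that
  proof (induction w)
    case Nil
    have "abs_sum c \<le> K * c $ 5" using K(1) c_pos[of 5] by (simp add: field_simps)
    then show ?case using large[of c] vec_of_nonneg[of "[]"] by simp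
  next
    case (Cons k w)
    let ?y = "vec_of w"
    have w: "set w \<subseteq> {..<3}" and k: "k < 3" using Cons.prems by auto
    show ?case
    proof (cases "k = 2")
      case True
      show ?thesis using Cons.IH[OF w] unfolding vec_of_Cons True M_mat_simps M2_mult by simp
    next
      case False
      then have "k = 0 \<or> k = 1" using k by linarith
      then have "3 / \<delta> * (\<delta> / 3 * abs_sum (M_mat k *v ?y)) \<le> 3 / \<delta> * (M_mat k *v ?y) $ 5"
        using M_mat_fifth_ge[OF spread[OF w]] \<delta>_pos by (intro mult_left_mono) auto
      also have "\<dots> \<le> K * (M_mat k *v ?y) $ 5"
        using K(2) nonneg_M_mat[OF k vec_of_nonneg[OF w]]
        by (intro mult_right_mono) (auto simp: nonneg_vec_def)
      finally show ?thesis unfolding vec_of_Cons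
        using large[OF nonneg_M_mat[OF k vec_of_nonneg[OF w]]] \<delta>_pos by simp
    qed
  qed
  then show ?thesis using K0 by blast
qed

lemma two_run:
  assumes "set u \<subseteq> {..<3}"
  shows "vec_of (replicate n 2 @ u) $ 5 = vec_of u $ 5 \<and>
    real n * vec_of u $ 5 \<le> vec_of (replicate n 2 @ u) $ 1"
proof (induction n)
  case 0
  then show ?case using vec_of_nonneg[OF assms] by (simp add: nonneg_vec_7)
next
  case (Suc n)
  have "set (replicate n 2 @ u) \<subseteq> {..<3}" using assms by auto
  from vec_of_nonneg[OF this] have "0 \<le> vec_of (replicate n 2 @ u) $ 7" by (simp add: nonneg_vec_7)
  with Suc show ?case
    by (simp only: replicate_Suc append_Cons vec_of_Cons M_mat_simps)
       (simp add: M2_mult distrib_right)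
qed

lemma focusing_twos: "focusing (\<lambda>_. 2)"
proof -
  obtain K where K: "0 \<le> K" "\<And>w. set w \<subseteq> {..<3} \<Longrightarrow>
      \<bar>vec_of w $ 4 - vec_of w $ 1 - vec_of w $ 7\<bar> \<le> K * vec_of w $ 5"
    using excess_vec_of by blast
  \<comment> \<open>On a run of twos entry 1 grows by at least entry 5 at each step; entries 3 and 4
    follow it up to a multiple of entry 5, which is constant.\<close>
  define p :: "real ^ 7" where "p = vector [1, 0, 1, 1, 0, 0, 0]"
  have "real n * abs_sum (unit_sum (vec_of (pref (\<lambda>_. 2) n @ u)) - unit_sum p) \<le> 2 * (K + 2)"
    if n: "2 \<le> n" and u: "set u \<subseteq> {..<3}" for n u
  proof -
    obtain m where m: "n = Suc m" using n by (cases n) auto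
    define y where "y = vec_of (replicate n 2 @ u)"
    have s: "set (replicate n 2 @ u) \<subseteq> {..<3}" using u by auto
    have ny: "nonneg_vec y" and Ny: "0 < abs_sum y"
      unfolding y_def by (rule vec_of_nonneg[OF s] vec_of_pos[OF s])+
    have y0: "y $ 2 = 0" "y $ 3 = y $ 1 - y $ 5" "y $ 6 = 0" "y $ 7 = 0"
      unfolding y_def m replicate_Suc append_Cons vec_of_Cons M_mat_simps M2_mult by simp_all
    have ex: "\<bar>y $ 4 - y $ 1\<bar> \<le> K * y $ 5" using K(2)[OF s] y0 by (simp add: y_def)
    have n5: "real n * y $ 5 \<le> y $ 1" using two_run[OF u, of n] by (simp add: y_def)
    have y5: "0 \<le> y $ 5" and "0 \<le> y $ 1" and le: "y $ 1 \<le> abs_sum y"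
      using ny by (simp_all add: nonneg_vec_7 abs_sum_nonneg_7)
    have y1: "0 < y $ 1"
    proof (rule ccontr)
      assume "\<not> 0 < y $ 1"
      with \<open>0 \<le> y $ 1\<close> have z: "y $ 1 = 0" by simp
      with n5 y5 n have "y $ 5 = 0" by (smt (verit) mult_pos_pos of_nat_0_less_iff zero_less_numeral less_le_trans)
      with z ex y0 have "abs_sum y = 0" by (simp add: abs_sum_def sum_7)
      with Ny show False by simp
    qed
    have "abs_sum (y - y $ 1 *\<^sub>R p) = \<bar>y $ 5\<bar> + \<bar>y $ 4 - y $ 1\<bar> + \<bar>y $ 5\<bar>"
      by (simp add: abs_sum_def sum_7 p_def vector_7 y0)
    also have "\<dots> \<le> (K + 2) * y $ 5" using ex y5 by (simp add: distrib_right)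
    finally have d: "abs_sum (y - y $ 1 *\<^sub>R p) \<le> (K + 2) * y $ 5" .
    have "abs_sum (y $ 1 *\<^sub>R p) = 3 * y $ 1"
      using y1 by (simp add: abs_sum_def sum_7 p_def vector_7)
    then have "abs_sum (unit_sum y - unit_sum (y $ 1 *\<^sub>R p)) \<le> 2 * abs_sum (y - y $ 1 *\<^sub>R p) / abs_sum y"
      using y1 Ny by (intro unit_sum_diff_le) auto
    also have "\<dots> \<le> 2 * ((K + 2) * y $ 5) / abs_sum y"
      using d Ny by (intro divide_right_mono) auto
    finally have "real n * abs_sum (unit_sum y - unit_sum p)
        \<le> real n * (2 * ((K + 2) * y $ 5) / abs_sum y)"
      unfolding unit_sum_scaleR[OF y1] by (intro mult_left_mono) auto
    also have "\<dots> = 2 * (K + 2) * (real n * y $ 5) / abs_sum y" by simp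
    also have "\<dots> \<le> 2 * (K + 2) * abs_sum y / abs_sum y"
      using n5 le K(1) Ny by (intro divide_right_mono mult_left_mono) auto
    also have "\<dots> = 2 * (K + 2)" using Ny by simp
    finally show ?thesis by (simp add: pref_const y_def)
  qed
  then show ?thesis by (rule focusing_of_limit)
qed

text \<open>Beyond the last switch only 0 and 2 occur and 2 is never followed by 0: a first 2 is
  repeated forever, and without one the tail is zero.\<close>

lemma focusing_all:
  assumes "\<omega> \<in> Omega 3"
  shows "focusing \<omega>"
proof (cases "\<forall>m. \<exists>p\<ge>m. switch \<omega> p")
  case True
  then show ?thesis using assms by (rule focusing_switching)
next
  case False
  then obtain m where m: "\<And>p. m \<le> p \<Longrightarrow> \<not> switch \<omega> p" by blast
  have letter: "\<omega> p < 3" for p using assms by (simp add: Omega_def)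
  have 02: "\<omega> p = 0 \<or> \<omega> p = 2" if "m \<le> p" for p
    using m[OF that] letter[of p] by (auto simp: switch_def)
  show ?thesis
  proof (cases "\<exists>q\<ge>m. \<omega> q = 2")
    case True
    then obtain q where q: "m \<le> q" "\<omega> q = 2" by blast
    have "\<omega> (i + q) = 2" for i
    proof (induction i)
      case (Suc i)
      then show ?case using m[of "i + q"] 02[of "Suc i + q"] q(1) by (auto simp: switch_def)
    qed (simp add: q)
    then have "(shift ^^ q) \<omega> = (\<lambda>_. 2)" by (simp add: fun_eq_iff shift_funpow)
    then show ?thesis using focusing_twos assms focusing_of_shift_funpow[of q \<omega>] by simp
  next
    case False
    then have "(shift ^^ m) \<omega> = (\<lambda>_. 0)" using 02 by (fastforce simp: fun_eq_iff shift_funpow)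
    then show ?thesis using focusing_zeros assms focusing_of_shift_funpow[of m \<omega>] by simp
  qed
qed

section \<open>Uniformity over all sequences and convergence of the directions\<close>

lemma uniformly_focusing:
  assumes "0 < \<epsilon>"
  shows "\<exists>n. \<forall>w u v. length w = n \<longrightarrow> set w \<subseteq> {..<3} \<longrightarrow> set u \<subseteq> {..<3} \<longrightarrow> set v \<subseteq> {..<3} \<longrightarrow>
     abs_sum (unit_sum (vec_of (w @ u)) - unit_sum (vec_of (w @ v))) < \<epsilon>"
proof (rule ccontr)
  let ?bad = "\<lambda>w. \<exists>u v. set u \<subseteq> {..<3} \<and> set v \<subseteq> {..<3} \<and> set w \<subseteq> {..<3} \<and>
     \<not> abs_sum (unit_sum (vec_of (w @ u)) - unit_sum (vec_of (w @ v))) < \<epsilon>"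
  assume "\<not> ?thesis"
  then have "\<exists>w. length w = n \<and> set w \<subseteq> {..<3} \<and> ?bad w" for n by meson
  moreover have "?bad w" if bad: "?bad (w @ w')" for w w'
  proof -
    obtain u v where "set u \<subseteq> {..<3}" "set v \<subseteq> {..<3}" "set (w @ w') \<subseteq> {..<3}"
     "\<not> abs_sum (unit_sum (vec_of ((w @ w') @ u)) - unit_sum (vec_of ((w @ w') @ v))) < \<epsilon>"
      using bad by blast
    then show ?thesis by (intro exI[of _ "w' @ u"] exI[of _ "w' @ v"]) simp
  qed
  ultimately obtain \<omega> where \<omega>: "\<omega> \<in> Omega 3" "\<And>n. ?bad (pref \<omega> n)"
    using infinite_branch[of ?bad 3] by blast
  then show False using focusing_all[OF \<omega>(1)] assms unfolding focusing_def by meson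
qed

lemma c_seq_unit_sum: "c_seq c n \<omega> = unit_sum (vec_of (pref \<omega> n))"
  by (simp add: c_seq_def unit_sum_def)

lemma norm_le_abs_sum: "norm (x :: real ^ 'n) \<le> abs_sum x"
  unfolding abs_sum_def by (rule norm_le_l1_cart)

lemma uniformly_convergent_c_seq: "uniformly_convergent_on (Omega 3) (c_seq c)"
proof (rule Cauchy_uniformly_convergent, unfold uniformly_Cauchy_on_def, intro allI impI)
  fix \<epsilon> :: real assume "0 < \<epsilon>"
  then obtain N where N: "\<And>w u v. length w = N \<Longrightarrow> set w \<subseteq> {..<3} \<Longrightarrow> set u \<subseteq> {..<3} \<Longrightarrow>
      set v \<subseteq> {..<3} \<Longrightarrow> abs_sum (unit_sum (vec_of (w @ u)) - unit_sum (vec_of (w @ v))) < \<epsilon>"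
    using uniformly_focusing by metis
  have "dist (c_seq c m \<omega>) (c_seq c n \<omega>) < \<epsilon>" if \<omega>: "\<omega> \<in> Omega 3" and mn: "N \<le> m" "N \<le> n" for \<omega> m n
  proof -
    have split: "pref \<omega> k = pref \<omega> N @ pref ((shift ^^ N) \<omega>) (k - N)" if "N \<le> k" for k
      using pref_add[of \<omega> N "k - N"] that by simp
    have "dist (c_seq c m \<omega>) (c_seq c n \<omega>) \<le> abs_sum (c_seq c m \<omega> - c_seq c n \<omega>)"
      unfolding dist_norm by (rule norm_le_abs_sum)
    also have "\<dots> < \<epsilon>"
      unfolding c_seq_unit_sum split[OF mn(1)] split[OF mn(2)]
      by (intro N length_pref set_pref shift_funpow_Omega \<omega>)
    finally show ?thesis .
  qed
  then show "\<exists>M. \<forall>x\<in>Omega 3. \<forall>m\<ge>M. \<forall>n\<ge>M. dist (c_seq c m x) (c_seq c n x) < \<epsilon>" by blast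
qed

end

lemma positive_vector_exists:
  assumes "\<forall>i. c $ i > 0"
  shows "\<exists>\<delta>. positive_vector c \<delta>"
  using orbit_well_spread[OF assms] assms unfolding positive_vector_def by blast

subsection \<open>From the convergence of directions to the weak-Gibbs property\<close>

lemma open_pref_eq: "open {\<omega> :: nat \<Rightarrow> nat. pref \<omega> n = w}"
proof (cases "length w = n")
  case True
  have "{\<omega>. pref \<omega> n = w} = (\<Inter>i\<in>{..<n}. (\<lambda>\<omega>. \<omega> i) -` {w ! i})"
    using True by (auto simp: pref_def list_eq_iff_nth_eq)
  moreover have "open ((\<lambda>\<omega> :: nat \<Rightarrow> nat. \<omega> i) -` {w ! i})" for i
    by (intro open_vimage discrete_topology_class.open_discrete continuous_on_product_coordinates)
  ultimately show ?thesis by auto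
next
  case False
  then have "{\<omega>. pref \<omega> n = w} = {}" by (auto simp: pref_def)
  then show ?thesis by simp
qed

lemma continuous_on_pref:
  fixes f :: "nat list \<Rightarrow> 'b::topological_space"
  shows "continuous_on S (\<lambda>\<omega>. f (pref \<omega> n))"
proof (rule continuous_on_subset[OF _ subset_UNIV])
  have "open ((\<lambda>\<omega>. f (pref \<omega> n)) -` B)" for B
  proof -
    have "(\<lambda>\<omega>. f (pref \<omega> n)) -` B = (\<Union>w\<in>f -` B. {\<omega>. pref \<omega> n = w})" by auto
    then show ?thesis by (auto intro: open_pref_eq)
  qed
  then show "continuous_on UNIV (\<lambda>\<omega>. f (pref \<omega> n))" by (simp add: continuous_on_open_vimage)
qed

lemma ln_diff_le:
  fixes a b d :: real
  assumes "0 < d" "d \<le> a" "d \<le> b"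
  shows "\<bar>ln a - ln b\<bar> \<le> \<bar>a - b\<bar> / d"
proof -
  have *: "ln x - ln y \<le> \<bar>x - y\<bar> / d" if "d \<le> x" "d \<le> y" for x y
  proof -
    have "ln x - ln y = ln (x / y)" using that assms(1) by (simp add: ln_div)
    also have "\<dots> \<le> x / y - 1" using that assms(1) by (intro ln_le_minus_one) auto
    also have "\<dots> = (x - y) / y" using that assms(1) by (simp add: field_simps)
    also have "\<dots> \<le> \<bar>x - y\<bar> / d" using that assms(1) by (intro frac_le) auto
    finally show ?thesis .
  qed
  show ?thesis using *[OF assms(2,3)] *[OF assms(3,2)] by (simp add: abs_minus_commute abs_le_iff)
qed

lemma exp_ln_div: "0 < x \<Longrightarrow> 0 < n \<Longrightarrow> exp (ln x / real n) = root n x"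
  by (simp add: root_powr_inverse powr_def)

text \<open>The branches contract by the powers 1, 2 and 4 of 1/\<beta>, and undoing one factor
  \<beta> by self-similarity costs one factor 1/2.\<close>

definition letter_weight :: "nat \<Rightarrow> real" where
  "letter_weight k = [1 / 2, 1 / 4, 1 / 16] ! k"

definition word_weight :: "nat list \<Rightarrow> real" where
  "word_weight w = prod_list (map letter_weight w)"

text \<open>The mass of an untranslated cell is not itself a coordinate of the mass vector; it
  occurs only inside the sums at 1 and 5. It is read off one letter later, from the vector of the
  remaining word, at an entry that depends on the first letter.\<close>

definition first_coord :: "nat \<Rightarrow> 7" where
  "first_coord k = [1, 3, 5] ! k"

lemma letter_weight_bounds: "k < 3 \<Longrightarrow> 1 / 16 \<le> letter_weight k \<and> letter_weight k \<le> 1"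
  by (elim letter_cases) (simp_all add: letter_weight_def numeral_2_eq_2)

lemma word_weight_pos: "set w \<subseteq> {..<3} \<Longrightarrow> 0 < word_weight w"
proof (induction w)
  case (Cons k w)
  then show ?case using letter_weight_bounds[of k] by (simp add: word_weight_def)
qed (simp add: word_weight_def)

section \<open>Lower bounds for the coordinates 1, 3 and 5, and the potential\<close>

context positive_vector
begin

text \<open>A zero keeps entry 1 and raises the sum of the entries other than 6 by exactly entry 1,
  whereas the letters 1 and 2 restore a fixed share; so the quotient grows at most linearly. Entry 6
  is left out to make the increment exact, and is recovered at the end because entry 3 alone holds
  the share \<delta>.\<close>

lemma first_lower_bound:
  "\<exists>K>0. \<forall>w. set w \<subseteq> {..<3} \<longrightarrow> abs_sum (vec_of w) \<le> K * real (Suc (length w)) * vec_of w $ 1"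
proof -
  define K where "K = max (abs_sum c / c $ 1) (max 1 (3 / \<delta>))"
  have K: "abs_sum c / c $ 1 \<le> K" "1 \<le> K" "3 / \<delta> \<le> K" by (auto simp: K_def)
  have *: "abs_sum (vec_of w) - vec_of w $ 6 \<le> K * real (Suc (length w)) * vec_of w $ 1"
    if "set w \<subseteq> {..<3}" for w
    using that
  proof (induction w)
    case Nil
    have "abs_sum c \<le> K * c $ 1" using K(1) c_pos[of 1] by (simp add: field_simps)
    then show ?case using c_pos[of 6] by simp
  next
    case (Cons k w)
    let ?y = "vec_of w"
    have w: "set w \<subseteq> {..<3}" and k: "k < 3" using Cons.prems by auto
    have nM: "nonneg_vec (M_mat k *v ?y)" by (rule nonneg_M_mat[OF k vec_of_nonneg[OF w]])
    have ny: "nonneg_vec ?y" by (rule vec_of_nonneg[OF w])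
    show ?case
    proof (cases "k = 0")
      case True
      have "abs_sum (M0 *v ?y) - (M0 *v ?y) $ 6 = abs_sum ?y - ?y $ 6 + ?y $ 1"
        using nM unfolding abs_sum_nonneg_7[OF ny] True M_mat_simps
        by (simp add: abs_sum_nonneg_7 M0_mult)
      also have "\<dots> \<le> K * real (Suc (length w)) * ?y $ 1 + K * ?y $ 1"
        using Cons.IH[OF w] K(2) ny by (intro add_mono mult_right_le_one_le) (auto simp: nonneg_vec_7 mult_right_mono[of 1 K, simplified])
      finally show ?thesis unfolding vec_of_Cons True M_mat_simps M0_mult
        by (simp add: algebra_simps)
    next
      case False
      then have "k = 1 \<or> k = 2" using k by linarith
      then have "3 / \<delta> * (\<delta> / 3 * abs_sum (M_mat k *v ?y)) \<le> 3 / \<delta> * (M_mat k *v ?y) $ 1"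
        using M_mat_first_ge[OF spread[OF w]] \<delta>_pos by (intro mult_left_mono) auto
      also have "\<dots> \<le> (K * real (Suc (length (k # w)))) * (M_mat k *v ?y) $ 1"
      proof (rule mult_right_mono)
        have "3 / \<delta> * 1 \<le> K * real (Suc (length (k # w)))"
          using K \<delta>_pos by (intro mult_mono) auto
        then show "3 / \<delta> \<le> K * real (Suc (length (k # w)))" by simp
      qed (use nM in \<open>auto simp: nonneg_vec_def\<close>)
      finally show ?thesis unfolding vec_of_Cons using \<delta>_pos nM by (simp add: nonneg_vec_7)
    qed
  qed
  have "abs_sum (vec_of w) \<le> K / \<delta> * real (Suc (length w)) * vec_of w $ 1" if w: "set w \<subseteq> {..<3}" for w
  proof -
    have n: "nonneg_vec (vec_of w)" by (rule vec_of_nonneg[OF w])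
    have "\<delta> * abs_sum (vec_of w) \<le> abs_sum (vec_of w) - vec_of w $ 6"
      using spread[OF w] n unfolding well_spread_def
      by (simp add: abs_sum_nonneg_7[OF n] nonneg_vec_7)
    with *[OF w] have "\<delta> * abs_sum (vec_of w) \<le> K * real (Suc (length w)) * vec_of w $ 1" by linarith
    then show ?thesis using \<delta>_pos by (simp add: field_simps)
  qed
  moreover have "0 < K / \<delta>" using K \<delta>_pos by simp
  ultimately show ?thesis by blast
qed

text \<open>The same argument for the letter 2, which keeps entry 5 and raises f by twice entry 5.
  The function f suffices because it contains \<open>y $ 1 + y $ 7\<close>, a share of at least
  \<delta>.\<close>

lemma fifth_lower_bound:
  "\<exists>K>0. \<forall>w. set w \<subseteq> {..<3} \<longrightarrow> abs_sum (vec_of w) \<le> K * real (Suc (length w)) * vec_of w $ 5"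
proof -
  define f where "f y = y $ 1 + y $ 4 + y $ 5 + y $ 7" for y :: "real ^ 7"
  define K where "K = max (abs_sum c / c $ 5) (max 2 (3 / \<delta>))"
  have K: "abs_sum c / c $ 5 \<le> K" "2 \<le> K" "3 / \<delta> \<le> K" by (auto simp: K_def)
  have f_le: "f y \<le> abs_sum y" if "nonneg_vec y" for y
    using that unfolding f_def abs_sum_nonneg_7[OF that] nonneg_vec_7 by linarith
  have *: "f (vec_of w) \<le> K * real (Suc (length w)) * vec_of w $ 5"
    if "set w \<subseteq> {..<3}" for w
    using that
  proof (induction w)
    case Nil
    have "abs_sum c \<le> K * c $ 5" using K(1) c_pos[of 5] by (simp add: field_simps)
    then show ?case using f_le[OF vec_of_nonneg[of "[]"]] by simp
  next
    case (Cons k w)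
    let ?y = "vec_of w"
    have w: "set w \<subseteq> {..<3}" and k: "k < 3" using Cons.prems by auto
    have nM: "nonneg_vec (M_mat k *v ?y)" by (rule nonneg_M_mat[OF k vec_of_nonneg[OF w]])
    have ny: "nonneg_vec ?y" by (rule vec_of_nonneg[OF w])
    show ?case
    proof (cases "k = 2")
      case True
      have "f (M2 *v ?y) = f ?y + 2 * ?y $ 5" by (simp add: f_def M2_mult)
      also have "\<dots> \<le> K * real (Suc (length w)) * ?y $ 5 + K * ?y $ 5"
        using Cons.IH[OF w] K(2) ny by (intro add_mono mult_right_mono) (auto simp: nonneg_vec_7)
      finally show ?thesis unfolding vec_of_Cons True M_mat_simps M2_mult
        by (simp add: algebra_simps)
    next
      case False
      then have "k = 0 \<or> k = 1" using k by linarith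
      then have "3 / \<delta> * (\<delta> / 3 * abs_sum (M_mat k *v ?y)) \<le> 3 / \<delta> * (M_mat k *v ?y) $ 5"
        using M_mat_fifth_ge[OF spread[OF w]] \<delta>_pos by (intro mult_left_mono) auto
      also have "\<dots> \<le> (K * real (Suc (length (k # w)))) * (M_mat k *v ?y) $ 5"
      proof (rule mult_right_mono)
        have "3 / \<delta> * 1 \<le> K * real (Suc (length (k # w)))"
          using K \<delta>_pos by (intro mult_mono) auto
        then show "3 / \<delta> \<le> K * real (Suc (length (k # w)))" by simp
      qed (use nM in \<open>auto simp: nonneg_vec_def\<close>)
      finally show ?thesis unfolding vec_of_Cons using \<delta>_pos f_le[OF nM] by simp
    qed
  qed
  have "abs_sum (vec_of w) \<le> K / \<delta> * real (Suc (length w)) * vec_of w $ 5" if w: "set w \<subseteq> {..<3}" for w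
  proof -
    have n: "nonneg_vec (vec_of w)" by (rule vec_of_nonneg[OF w])
    have "\<delta> * abs_sum (vec_of w) \<le> f (vec_of w)"
      using spread[OF w] n unfolding well_spread_def f_def nonneg_vec_7 by simp
    with *[OF w] have "\<delta> * abs_sum (vec_of w) \<le> K * real (Suc (length w)) * vec_of w $ 5" by linarith
    then show ?thesis using \<delta>_pos by (simp add: field_simps)
  qed
  moreover have "0 < K / \<delta>" using K \<delta>_pos by simp
  ultimately show ?thesis by blast
qed

lemma first_coord_lower_bound:
  "\<exists>K>0. \<forall>w k. set w \<subseteq> {..<3} \<longrightarrow> k < 3 \<longrightarrow>
     abs_sum (vec_of w) \<le> K * real (Suc (length w)) * vec_of w $ first_coord k"
proof -
  obtain K1 where K1: "0 < K1" "\<And>w. set w \<subseteq> {..<3} \<Longrightarrow>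
      abs_sum (vec_of w) \<le> K1 * real (Suc (length w)) * vec_of w $ 1"
    using first_lower_bound by blast
  obtain K5 where K5: "0 < K5" "\<And>w. set w \<subseteq> {..<3} \<Longrightarrow>
      abs_sum (vec_of w) \<le> K5 * real (Suc (length w)) * vec_of w $ 5"
    using fifth_lower_bound by blast
  define K where "K = K1 + K5 + 1 / \<delta>"
  have K: "K1 \<le> K" "K5 \<le> K" "1 / \<delta> \<le> K" using K1(1) K5(1) \<delta>_pos by (auto simp: K_def)
  have "abs_sum (vec_of w) \<le> K * real (Suc (length w)) * vec_of w $ first_coord k"
    if w: "set w \<subseteq> {..<3}" and k: "k < 3" for w k
  proof -
    have n: "0 \<le> vec_of w $ i" for i using vec_of_nonneg[OF w] by (simp add: nonneg_vec_def)
    have mono: "L * real (Suc (length w)) * vec_of w $ i \<le> K * real (Suc (length w)) * vec_of w $ i"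
      if "L \<le> K" for L i using that n by (intro mult_right_mono) auto
    have "abs_sum (vec_of w) \<le> 1 / \<delta> * vec_of w $ 3"
      using spread[OF w] \<delta>_pos by (simp add: well_spread_def field_simps)
    also have "\<dots> \<le> 1 / \<delta> * real (Suc (length w)) * vec_of w $ 3"
      using n[of 3] \<delta>_pos by (intro mult_right_mono) (auto simp: divide_right_mono)
    finally have "abs_sum (vec_of w) \<le> 1 / \<delta> * real (Suc (length w)) * vec_of w $ 3" .
    note bounds = order_trans[OF K1(2)[OF w] mono[OF K(1)]] order_trans[OF this mono[OF K(3)]]
      order_trans[OF K5(2)[OF w] mono[OF K(2)]]
    have "first_coord k = 1 \<or> first_coord k = 3 \<or> first_coord k = 5"
      using k by (elim letter_cases) (simp_all add: first_coord_def numeral_2_eq_2)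
    with bounds show ?thesis by (elim disjE) simp_all
  qed
  moreover have "0 < K" using K1(1) K(1) by linarith
  ultimately show ?thesis by blast
qed

text \<open>The logarithm of the quotient of \<open>mass\<close> at the prefix of length n + 1 of
  \<omega> and at the prefix of length n of \<open>shift \<omega>\<close>. It depends on the latter
  only through a direction, and its uniform limit is the potential.\<close>

definition log_ratio :: "nat \<Rightarrow> (nat \<Rightarrow> nat) \<Rightarrow> real" where
  "log_ratio n \<omega> = ln (letter_weight (\<omega> 0) * abs_sum (M_mat (\<omega> 0) *v unit_sum (vec_of (pref (shift \<omega>) n))))"

definition mass :: "nat list \<Rightarrow> real" where
  "mass w = word_weight w * abs_sum (vec_of w)"

lemma mass_pos: "set w \<subseteq> {..<3} \<Longrightarrow> 0 < mass w"
  by (simp add: mass_def word_weight_pos vec_of_pos)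

lemma abs_sum_M_unit:
  assumes "k < 3" "set w \<subseteq> {..<3}"
  shows "\<delta> \<le> abs_sum (M_mat k *v unit_sum (vec_of w))" "abs_sum (M_mat k *v unit_sum (vec_of w)) \<le> 3"
    "abs_sum (M_mat k *v unit_sum (vec_of w)) * abs_sum (vec_of w) = abs_sum (vec_of (k # w))"
proof -
  have N: "0 < abs_sum (vec_of w)" by (rule vec_of_pos[OF assms(2)])
  have eq: "abs_sum (M_mat k *v unit_sum (vec_of w)) = abs_sum (M_mat k *v vec_of w) / abs_sum (vec_of w)"
    using N by (simp add: unit_sum_def matrix_vector_mult_scaleR field_simps)
  show "\<delta> \<le> abs_sum (M_mat k *v unit_sum (vec_of w))"
    using abs_sum_M_mat_ge[OF assms(1) spread[OF assms(2)]] N by (simp add: eq field_simps)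
  show "abs_sum (M_mat k *v unit_sum (vec_of w)) \<le> 3"
    using abs_sum_M_mat_le[OF assms(1), of "vec_of w"] N by (simp add: eq field_simps)
  show "abs_sum (M_mat k *v unit_sum (vec_of w)) * abs_sum (vec_of w) = abs_sum (vec_of (k # w))"
    using N unfolding vec_of_Cons by (simp add: eq)
qed

lemma log_ratio_arg:
  assumes "\<omega> \<in> Omega 3"
  shows "\<delta> / 16 \<le> letter_weight (\<omega> 0) * abs_sum (M_mat (\<omega> 0) *v unit_sum (vec_of (pref (shift \<omega>) n)))"
    and "letter_weight (\<omega> 0) * abs_sum (M_mat (\<omega> 0) *v unit_sum (vec_of (pref (shift \<omega>) n))) \<le> 3"
proof -
  have k: "\<omega> 0 < 3" using assms by (simp add: Omega_def)
  note s = abs_sum_M_unit[OF k set_pref[OF shift_Omega[OF assms], of n]]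
  note l = letter_weight_bounds[OF k]
  have "1 / 16 * \<delta> \<le> letter_weight (\<omega> 0) * abs_sum (M_mat (\<omega> 0) *v unit_sum (vec_of (pref (shift \<omega>) n)))"
    using s l \<delta>_pos by (intro mult_mono) auto
  then show "\<delta> / 16 \<le> letter_weight (\<omega> 0) * abs_sum (M_mat (\<omega> 0) *v unit_sum (vec_of (pref (shift \<omega>) n)))"
    by simp
  have "letter_weight (\<omega> 0) * abs_sum (M_mat (\<omega> 0) *v unit_sum (vec_of (pref (shift \<omega>) n))) \<le> 1 * 3"
    using s l \<delta>_pos by (intro mult_mono) auto
  then show "letter_weight (\<omega> 0) * abs_sum (M_mat (\<omega> 0) *v unit_sum (vec_of (pref (shift \<omega>) n))) \<le> 3"
    by simp
qed

text \<open>Telescoping. The k-th term sees only the n - k - 1 letters that remain, so the last few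
  terms need not be close to the potential.\<close>

lemma mass_pref:
  assumes "\<omega> \<in> Omega 3"
  shows "ln (mass (pref \<omega> n)) = ln (abs_sum c) + (\<Sum>k<n. log_ratio (n - Suc k) ((shift ^^ k) \<omega>))"
  using assms
proof (induction n arbitrary: \<omega>)
  case 0
  then show ?case by (simp add: mass_def word_weight_def)
next
  case (Suc n)
  let ?w = "pref (shift \<omega>) n"
  have k: "\<omega> 0 < 3" using Suc.prems by (simp add: Omega_def)
  have s: "set ?w \<subseteq> {..<3}" by (rule set_pref[OF shift_Omega[OF Suc.prems]])
  have "mass (pref \<omega> (Suc n)) = letter_weight (\<omega> 0) * abs_sum (M_mat (\<omega> 0) *v unit_sum (vec_of ?w)) * mass ?w"
    unfolding mass_def pref_Suc abs_sum_M_unit(3)[OF k s, symmetric] by (simp add: word_weight_def)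
  moreover have "0 < letter_weight (\<omega> 0) * abs_sum (M_mat (\<omega> 0) *v unit_sum (vec_of ?w))"
    using log_ratio_arg(1)[OF Suc.prems, of n] \<delta>_pos by linarith
  ultimately have "ln (mass (pref \<omega> (Suc n))) = log_ratio n \<omega> + ln (mass ?w)"
    using mass_pos[OF s] unfolding log_ratio_def by (simp only: ln_mult_pos)
  also have "\<dots> = ln (abs_sum c) + (\<Sum>k<Suc n. log_ratio (Suc n - Suc k) ((shift ^^ k) \<omega>))"
    unfolding Suc.IH[OF shift_Omega[OF Suc.prems]] sum.lessThan_Suc_shift
    by (simp add: funpow_swap1)
  finally show ?case .
qed

lemma log_ratio_bounded:
  assumes "\<omega> \<in> Omega 3"
  shows "\<bar>log_ratio n \<omega>\<bar> \<le> ln 3 - ln (\<delta> / 16)"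
proof -
  note b = log_ratio_arg[OF assms, of n]
  have "ln (\<delta> / 16) \<le> log_ratio n \<omega>" "log_ratio n \<omega> \<le> ln 3"
    unfolding log_ratio_def using b \<delta>_pos by (subst ln_le_cancel_iff; simp)+
  moreover have "ln (\<delta> / 16) \<le> 0" "(0::real) \<le> ln 3" using \<delta>_pos \<delta>_le by simp_all
  ultimately show ?thesis by linarith
qed

lemma continuous_on_log_ratio: "continuous_on S (log_ratio n)"
proof -
  define f where "f w = ln (letter_weight (hd w) * abs_sum (M_mat (hd w) *v unit_sum (vec_of (tl w))))" for w
  have "log_ratio n = (\<lambda>\<omega>. f (pref \<omega> (Suc n)))"
    by (simp add: fun_eq_iff f_def log_ratio_def pref_Suc)
  then show ?thesis by (simp add: continuous_on_pref)
qed

lemma uniformly_convergent_log_ratio: "uniformly_convergent_on (Omega 3) log_ratio"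
proof (rule Cauchy_uniformly_convergent, unfold uniformly_Cauchy_on_def, intro allI impI)
  fix \<epsilon> :: real assume \<epsilon>: "0 < \<epsilon>"
  then have "0 < \<delta> / 48 * \<epsilon>" using \<delta>_pos by simp
  from uniformly_focusing[OF this] obtain N where N: "\<And>w u v. length w = N \<Longrightarrow> set w \<subseteq> {..<3} \<Longrightarrow> set u \<subseteq> {..<3} \<Longrightarrow>
      set v \<subseteq> {..<3} \<Longrightarrow> abs_sum (unit_sum (vec_of (w @ u)) - unit_sum (vec_of (w @ v))) < \<delta> / 48 * \<epsilon>"
    by metis
  have "dist (log_ratio m \<omega>) (log_ratio n \<omega>) < \<epsilon>" if \<omega>: "\<omega> \<in> Omega 3" and mn: "N \<le> m" "N \<le> n" for \<omega> m n
  proof -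
    let ?d = "unit_sum (vec_of (pref (shift \<omega>) m)) - unit_sum (vec_of (pref (shift \<omega>) n))"
    let ?a = "\<lambda>n. abs_sum (M_mat (\<omega> 0) *v unit_sum (vec_of (pref (shift \<omega>) n)))"
    have k: "\<omega> 0 < 3" using \<omega> by (simp add: Omega_def)
    note sh = shift_Omega[OF \<omega>]
    have split: "pref (shift \<omega>) k = pref (shift \<omega>) N @ pref ((shift ^^ N) (shift \<omega>)) (k - N)" if "N \<le> k" for k
      using pref_add[of "shift \<omega>" N "k - N"] that by simp
    have d: "abs_sum ?d < \<delta> / 48 * \<epsilon>"
      unfolding split[OF mn(1)] split[OF mn(2)]
      by (rule N[OF length_pref set_pref[OF sh] set_pref[OF shift_funpow_Omega[OF sh]]
            set_pref[OF shift_funpow_Omega[OF sh]]])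
    have "\<bar>?a m - ?a n\<bar> \<le> abs_sum (M_mat (\<omega> 0) *v ?d)"
      using abs_sum_triangle_diff[of "M_mat (\<omega> 0) *v unit_sum (vec_of (pref (shift \<omega>) m))" 0
          "M_mat (\<omega> 0) *v unit_sum (vec_of (pref (shift \<omega>) n))"]
        abs_sum_triangle[of "M_mat (\<omega> 0) *v ?d" "M_mat (\<omega> 0) *v unit_sum (vec_of (pref (shift \<omega>) n))"]
        abs_sum_triangle[of "- (M_mat (\<omega> 0) *v ?d)" "M_mat (\<omega> 0) *v unit_sum (vec_of (pref (shift \<omega>) m))"]
        abs_sum_minus_commute[of "0" "M_mat (\<omega> 0) *v ?d"]
      by (simp add: matrix_vector_mult_diff_distrib)
    also have "\<dots> \<le> 3 * abs_sum ?d" by (rule abs_sum_M_mat_le[OF k])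
    finally have a: "\<bar>?a m - ?a n\<bar> \<le> 3 * abs_sum ?d" .
    have l: "0 < letter_weight (\<omega> 0)" using letter_weight_bounds[OF k] by simp
    have s: "0 < ?a n" "\<delta> \<le> ?a n" for n
      using abs_sum_M_unit(1)[OF k set_pref[OF shift_Omega[OF \<omega>], of n]] \<delta>_pos by auto
    have "dist (log_ratio m \<omega>) (log_ratio n \<omega>) = \<bar>ln (?a m) - ln (?a n)\<bar>"
      using l s(1)[of m] s(1)[of n] by (simp add: log_ratio_def dist_real_def ln_mult)
    also have "\<dots> \<le> \<bar>?a m - ?a n\<bar> / \<delta>" by (intro ln_diff_le s \<delta>_pos)
    also have "\<dots> \<le> 3 * abs_sum ?d / \<delta>" using a \<delta>_pos by (intro divide_right_mono) auto
    also have "\<dots> < \<epsilon>"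
    proof -
      have "3 * abs_sum ?d < \<epsilon> * \<delta>" using d abs_sum_nonneg[of ?d] by argo
      then show ?thesis using \<delta>_pos by (simp add: divide_less_eq)
    qed
    finally show ?thesis .
  qed
  then show "\<exists>M. \<forall>x\<in>Omega 3. \<forall>m\<ge>M. \<forall>n\<ge>M. dist (log_ratio m x) (log_ratio n x) < \<epsilon>" by blast
qed

lemma weak_gibbs_of_cylinders:
  assumes \<nu>: "prob_space \<nu>" "space \<nu> = Omega 3" "sets \<nu> = sets (restrict_space borel (Omega 3))"
    and cyl: "\<And>k w. set (k # w) \<subseteq> {..<3} \<Longrightarrow>
      measure \<nu> (cylinder 3 (k # w)) = word_weight (k # w) * vec_of w $ first_coord k"
  shows "weak_gibbs 3 \<nu>"
proof -
  obtain \<Phi> where \<Phi>: "uniform_limit (Omega 3) log_ratio \<Phi> sequentially"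
    using uniformly_convergent_log_ratio unfolding uniformly_convergent_on_def by blast
  have cont: "continuous_on (Omega 3) \<Phi>"
    by (rule uniform_limit_theorem[OF _ \<Phi>]) (simp_all add: continuous_on_log_ratio)
  define B where "B = ln 3 - ln (\<delta> / 16)"
  have \<Phi>_bound: "\<bar>\<Phi> \<omega>\<bar> \<le> B" if "\<omega> \<in> Omega 3" for \<omega>
  proof -
    have "(\<lambda>n. \<bar>log_ratio n \<omega>\<bar>) \<longlonglongrightarrow> \<bar>\<Phi> \<omega>\<bar>"
      using tendsto_uniform_limitI[OF \<Phi> that] by (rule tendsto_rabs)
    then show ?thesis
      by (rule LIMSEQ_le_const2) (use log_ratio_bounded[OF that] in \<open>auto simp: B_def\<close>)
  qed
  obtain K where K: "0 < K" "\<And>w k. set w \<subseteq> {..<3} \<Longrightarrow> k < 3 \<Longrightarrow>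
      abs_sum (vec_of w) \<le> K * real (Suc (length w)) * vec_of w $ first_coord k"
    using first_coord_lower_bound by blast
  define A where "A = \<bar>ln (3 * K)\<bar> + \<bar>ln \<delta>\<bar>"
  have cyl_mass: "0 < measure \<nu> (cylinder 3 (pref \<omega> n)) \<and>
      \<bar>ln (measure \<nu> (cylinder 3 (pref \<omega> n))) - ln (mass (pref \<omega> n))\<bar> \<le> A + ln (real n)"
    if \<omega>: "\<omega> \<in> Omega 3" and n: "0 < n" for \<omega> n
  proof -
    obtain m where m: "n = Suc m" using n by (cases n) auto
    define k where "k = \<omega> 0"
    define w where "w = pref (shift \<omega>) m"
    have p: "pref \<omega> n = k # w" by (simp add: m pref_Suc k_def w_def)
    have k: "k < 3" using \<omega> by (simp add: Omega_def k_def)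
    have w: "set w \<subseteq> {..<3}" unfolding w_def by (rule set_pref[OF shift_Omega[OF \<omega>]])
    have kw: "set (k # w) \<subseteq> {..<3}" using k w by simp
    let ?x = "vec_of w $ first_coord k" and ?N = "abs_sum (vec_of w)" and ?M = "abs_sum (vec_of (k # w))"
    have N: "0 < ?N" by (rule vec_of_pos[OF w])
    have M: "0 < ?M" by (rule vec_of_pos[OF kw])
    have W: "0 < word_weight (k # w)" by (rule word_weight_pos[OF kw])
    have lo: "?N \<le> K * real n * ?x" using K(2)[OF w k] by (simp add: m w_def)
    have x: "0 < ?x"
    proof (rule ccontr)
      assume "\<not> 0 < ?x"
      then have "K * real n * ?x \<le> 0" using K(1) by (simp add: mult_nonneg_nonpos)
      then show False using lo N by linarith
    qed
    have hi: "?x \<le> ?N"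
    proof -
      have "\<bar>vec_of w $ first_coord k\<bar> \<le> ?N" unfolding abs_sum_def by (rule member_le_sum) auto
      then show ?thesis by simp
    qed
    have MN: "\<delta> * ?N \<le> ?M" "?M \<le> 3 * ?N"
      unfolding vec_of_Cons using abs_sum_M_mat_ge[OF k spread[OF w]] abs_sum_M_mat_le[OF k] by auto
    have "ln ?x \<le> ln ?N" using hi x N by simp
    moreover have "ln \<delta> + ln ?N \<le> ln ?M"
      using MN(1) \<delta>_pos N M
      by (simp only: ln_mult_pos[symmetric] ln_le_cancel_iff mult_pos_pos)
    moreover have "ln ?M \<le> ln (3 * K) + ln (real n) + ln ?x"
    proof -
      have "?M \<le> 3 * K * real n * ?x" using MN(2) lo by simp
      then have "ln ?M \<le> ln (3 * K * real n * ?x)" using M by simp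
      also have "\<dots> = ln (3 * K) + ln (real n) + ln ?x"
        using K(1) n x by (simp add: ln_mult)
      finally show ?thesis .
    qed
    moreover have "0 \<le> ln (real n)" using n by simp
    ultimately have "\<bar>ln ?x - ln ?M\<bar> \<le> A + ln (real n)" unfolding A_def by linarith
    moreover have "measure \<nu> (cylinder 3 (pref \<omega> n)) = word_weight (k # w) * ?x"
      unfolding p by (rule cyl[OF kw])
    moreover have "ln (word_weight (k # w) * ?x) - ln (mass (pref \<omega> n)) = ln ?x - ln ?M"
      using W x M unfolding p mass_def by (simp add: ln_mult)
    ultimately show ?thesis using W x by simp
  qed
  let ?q = "\<lambda>n \<omega>. measure \<nu> (cylinder 3 (pref \<omega> n)) / exp (\<Sum>k<n. \<Phi> ((shift ^^ k) \<omega>))"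
  have "uniform_limit (Omega 3) (\<lambda>n \<omega>. ln (?q n \<omega>) / real n) (\<lambda>_. 0) sequentially"
  proof (rule uniform_limitI)
    fix \<epsilon> :: real assume \<epsilon>: "0 < \<epsilon>"
    then have "\<forall>\<^sub>F n in sequentially. \<forall>\<omega>\<in>Omega 3. dist (log_ratio n \<omega>) (\<Phi> \<omega>) < \<epsilon> / 2"
      using uniform_limitD[OF \<Phi>, of "\<epsilon> / 2"] by simp
    then obtain J where J: "\<And>n \<omega>. J \<le> n \<Longrightarrow> \<omega> \<in> Omega 3 \<Longrightarrow> \<bar>log_ratio n \<omega> - \<Phi> \<omega>\<bar> \<le> \<epsilon> / 2"
      unfolding eventually_sequentially dist_real_def by (meson less_imp_le)
    \<comment> \<open>At most J terms have fewer than J letters left; each of them is off by at most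
      2 B, since both \<open>log_ratio\<close> and its limit are bounded by B.\<close>
    define D where "D = A + \<bar>ln (abs_sum c)\<bar> + real J * (2 * B)"
    have "(\<lambda>n. D / real n + ln (real n) / real n) \<longlonglongrightarrow> 0 + 0"
      by (intro tendsto_add lim_const_over_n lim_ln_over_n)
    then have "\<forall>\<^sub>F n in sequentially. D / real n + ln (real n) / real n < \<epsilon> / 2"
      using \<epsilon> by (intro order_tendstoD) auto
    then show "\<forall>\<^sub>F n in sequentially. \<forall>\<omega>\<in>Omega 3. dist (ln (?q n \<omega>) / real n) 0 < \<epsilon>"
      using eventually_gt_at_top[of 0]
    proof eventually_elim
      case (elim n)
      show ?case
      proof
        fix \<omega> assume \<omega>: "\<omega> \<in> Omega 3"
        let ?\<nu> = "measure \<nu> (cylinder 3 (pref \<omega> n))"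
        have sh: "(shift ^^ k) \<omega> \<in> Omega 3" for k using \<omega> by (rule shift_funpow_Omega)
        have e: "\<bar>log_ratio j \<xi> - \<Phi> \<xi>\<bar> \<le> \<epsilon> / 2 + (if j < J then 2 * B else 0)" if "\<xi> \<in> Omega 3" for j \<xi>
          using J[of j \<xi>] log_ratio_bounded[OF that, of j] \<Phi>_bound[OF that] that \<epsilon>
          by (auto simp: B_def)
        have "\<bar>(\<Sum>k<n. log_ratio (n - Suc k) ((shift ^^ k) \<omega>)) - (\<Sum>k<n. \<Phi> ((shift ^^ k) \<omega>))\<bar>
            \<le> (\<Sum>k<n. \<bar>log_ratio (n - Suc k) ((shift ^^ k) \<omega>) - \<Phi> ((shift ^^ k) \<omega>)\<bar>)"
          unfolding sum_subtractf[symmetric] by (rule sum_abs)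
        also have "\<dots> \<le> (\<Sum>k<n. \<epsilon> / 2 + (if n - Suc k < J then 2 * B else 0))"
          by (intro sum_mono e sh)
        \<comment> \<open>Reversing the sum indexes the terms by the number of remaining
          letters.\<close>
        also have "\<dots> = (\<Sum>j<n. \<epsilon> / 2 + (if j < J then 2 * B else 0))"
          by (rule sum.nat_diff_reindex)
        also have "\<dots> = real n * (\<epsilon> / 2) + (\<Sum>j\<in>{..<n} \<inter> {..<J}. 2 * B)"
          unfolding sum.distrib sum.inter_restrict[OF finite_lessThan] by simp
        also have "(\<Sum>j\<in>{..<n} \<inter> {..<J}. 2 * B) \<le> (\<Sum>j\<in>{..<J}. 2 * B)"
          using \<Phi>_bound[OF \<omega>] by (intro sum_mono2) auto
        finally have S: "\<bar>(\<Sum>k<n. log_ratio (n - Suc k) ((shift ^^ k) \<omega>)) - (\<Sum>k<n. \<Phi> ((shift ^^ k) \<omega>))\<bar>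
            \<le> real n * (\<epsilon> / 2) + real J * (2 * B)" by simp
        have pos: "0 < ?\<nu>" and m: "\<bar>ln ?\<nu> - ln (mass (pref \<omega> n))\<bar> \<le> A + ln (real n)"
          using cyl_mass[OF \<omega> elim(2)] by auto
        have "ln (?q n \<omega>) = ln ?\<nu> - (\<Sum>k<n. \<Phi> ((shift ^^ k) \<omega>))"
          using pos by (simp add: ln_div)
        then have "\<bar>ln (?q n \<omega>)\<bar> \<le> D + ln (real n) + real n * (\<epsilon> / 2)"
          using m S unfolding mass_pref[OF \<omega>] D_def by linarith
        then have "\<bar>ln (?q n \<omega>)\<bar> / real n \<le> (D + ln (real n) + real n * (\<epsilon> / 2)) / real n"
          by (intro divide_right_mono) auto
        also have "\<dots> = D / real n + ln (real n) / real n + \<epsilon> / 2"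
          using elim(2) by (simp add: add_divide_distrib)
        also have "\<dots> < \<epsilon>" using elim(1) by linarith
        finally show "dist (ln (?q n \<omega>) / real n) 0 < \<epsilon>" by simp
      qed
    qed
  qed
  note lim = this
  \<comment> \<open>The exponential is uniformly continuous only on bounded sets, so the logarithms
    are first confined to the interval from -1 to 1.\<close>
  have "uniform_limit (Omega 3) (\<lambda>n \<omega>. exp (ln (?q n \<omega>) / real n)) (exp \<circ> (\<lambda>_. 0)) sequentially"
  proof (rule uniform_limit_compose[OF lim])
    show "uniformly_continuous_on {-1..1 :: real} exp"
      by (intro compact_uniformly_continuous continuous_intros) auto
    show "\<forall>\<^sub>F n in sequentially. (\<lambda>\<omega>. ln (?q n \<omega>) / real n) ` Omega 3 \<subseteq> {-1..1}"
      using uniform_limitD[OF lim zero_less_one]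
    proof eventually_elim
      case (elim n)
      show ?case
      proof (rule image_subsetI)
        fix \<omega> assume "\<omega> \<in> Omega 3"
        with elim have "\<bar>ln (?q n \<omega>) / real n\<bar> < 1" by (simp add: dist_real_def)
        then show "ln (?q n \<omega>) / real n \<in> {-1..1}" unfolding atLeastAtMost_iff by linarith
      qed
    qed
  qed auto
  then have "uniform_limit (Omega 3) (\<lambda>n \<omega>. root n (?q n \<omega>)) (\<lambda>_. 1) sequentially"
  proof (rule uniform_limit_cong[THEN iffD1, rotated 2])
    show "\<forall>\<^sub>F n in sequentially. \<forall>\<omega>\<in>Omega 3. exp (ln (?q n \<omega>) / real n) = root n (?q n \<omega>)"
      using eventually_gt_at_top[of 0]
    proof eventually_elim
      case (elim n)
      show ?case
      proof
        fix \<omega> assume "\<omega> \<in> Omega 3"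
        then have "0 < ?q n \<omega>" using cyl_mass[OF _ elim] by simp
        then show "exp (ln (?q n \<omega>) / real n) = root n (?q n \<omega>)"
          using elim by (rule exp_ln_div)
      qed
    qed
  qed simp
  then show ?thesis unfolding weak_gibbs_def using \<nu> cont by blast
qed

end

subsection \<open>Self-similarity of the Bernoulli convolution\<close>

abbreviation coin :: "nat measure" where
  "coin \<equiv> measure_pmf (pmf_of_set {0, 1})"

abbreviation coins :: "(nat \<Rightarrow> nat) measure" where
  "coins \<equiv> \<Pi>\<^sub>M i\<in>UNIV. coin"

interpretation coins: sequence_space coin
  by unfold_locales

definition scaled_sum :: "real \<Rightarrow> (nat \<Rightarrow> nat) \<Rightarrow> real" where
  "scaled_sum \<beta> \<omega> = (\<beta> - 1) * (\<Sum>n. real (\<omega> n) / \<beta> ^ Suc n)"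

lemma measurable_digit_sum [measurable]:
  "(\<lambda>\<omega>. \<Sum>n. real (\<omega> n) / \<beta> ^ Suc n) \<in> borel_measurable coins"
  by measurable

lemma measurable_scaled_sum [measurable]: "scaled_sum \<beta> \<in> borel_measurable coins"
  unfolding scaled_sum_def by measurable

text \<open>The product space also contains sequences with large digits, for which the series may
  diverge and \<open>suminf\<close> carries no information; this removes them.\<close>

lemma AE_coins_le_1: "AE \<omega> in coins. \<forall>n. \<omega> n \<le> 1"
  unfolding AE_all_countable
proof
  fix n
  have "AE k in coin. k \<le> 1" by (simp add: AE_measure_pmf_iff)
  then show "AE \<omega> in coins. \<omega> n \<le> 1"
    by (intro AE_PiM_component[of UNIV "\<lambda>_. coin" n "\<lambda>k. k \<le> 1"]) (auto intro: measure_pmf.prob_space_axioms)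
qed

context
  fixes \<beta> :: real
  assumes \<beta>: "1 < \<beta>"
begin

lemma digit_sum_summable:
  assumes "\<forall>n. \<omega> n \<le> (1::nat)"
  shows "summable (\<lambda>n. real (\<omega> n) / \<beta> ^ Suc n)"
proof (rule summable_comparison_test)
  show "\<exists>N. \<forall>n\<ge>N. norm (real (\<omega> n) / \<beta> ^ Suc n) \<le> (1 / \<beta>) ^ Suc n"
    using assms \<beta> by (auto simp: power_one_over divide_simps)
  show "summable (\<lambda>n. (1 / \<beta>) ^ Suc n)"
    using \<beta> by (subst summable_Suc_iff) (auto intro: summable_geometric)
qed

lemma scaled_sum_bounds:
  assumes "\<forall>n. \<omega> n \<le> (1::nat)"
  shows "0 \<le> scaled_sum \<beta> \<omega>" "scaled_sum \<beta> \<omega> \<le> 1"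
proof -
  have "0 \<le> (\<Sum>n. real (\<omega> n) / \<beta> ^ Suc n)"
    using \<beta> by (intro suminf_nonneg digit_sum_summable assms) auto
  then show "0 \<le> scaled_sum \<beta> \<omega>" using \<beta> by (simp add: scaled_sum_def)
  have s: "(\<lambda>n. (1 / \<beta>) ^ Suc n) sums (1 / \<beta> * (1 / (1 - 1 / \<beta>)))"
    unfolding power_Suc using \<beta> by (intro sums_mult geometric_sums) auto
  have "(\<Sum>n. real (\<omega> n) / \<beta> ^ Suc n) \<le> (\<Sum>n. (1 / \<beta>) ^ Suc n)"
    using assms \<beta> sums_summable[OF s]
    by (intro suminf_le digit_sum_summable) (auto simp: power_one_over divide_simps)
  also have "\<dots> = 1 / (\<beta> - 1)"
    using sums_unique[OF s] \<beta> by (simp add: field_simps)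
  finally show "scaled_sum \<beta> \<omega> \<le> 1" using \<beta> by (simp add: scaled_sum_def field_simps)
qed

lemma scaled_sum_case_nat:
  assumes "\<forall>n. \<omega> n \<le> (1::nat)"
  shows "scaled_sum \<beta> (case_nat d \<omega>) = (scaled_sum \<beta> \<omega> + (\<beta> - 1) * real d) / \<beta>"
proof -
  let ?f = "\<lambda>n. real (case_nat d \<omega> n) / \<beta> ^ Suc n"
  have shift: "(\<lambda>n. ?f (Suc n)) = (\<lambda>n. 1 / \<beta> * (real (\<omega> n) / \<beta> ^ Suc n))"
    by (simp add: fun_eq_iff)
  have "summable (\<lambda>n. ?f (Suc n))"
    unfolding shift by (intro summable_mult digit_sum_summable assms)
  then have "summable ?f" by (rule iffD1[OF summable_Suc_iff])
  then have "suminf ?f = (\<Sum>n. ?f (Suc n)) + ?f 0" by (subst suminf_split_head) simp_all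
  also have "(\<Sum>n. ?f (Suc n)) = 1 / \<beta> * (\<Sum>n. real (\<omega> n) / \<beta> ^ Suc n)"
    unfolding shift by (intro suminf_mult digit_sum_summable assms)
  finally show ?thesis using \<beta> by (simp add: scaled_sum_def field_simps)
qed

definition law :: "real measure" where
  "law = distr coins borel (scaled_sum \<beta>)"

lemma law_eq: "law = distr (bernoulli_convolution2 \<beta>) borel (\<lambda>x. (\<beta> - 1) * x)"
  unfolding law_def bernoulli_convolution2_def
  by (subst distr_distr) (simp_all add: comp_def scaled_sum_def[abs_def])

lemma sets_law [simp, measurable_cong]: "sets law = sets borel" and space_law [simp]: "space law = UNIV"
  by (simp_all add: law_def)

lemma prob_space_law: "prob_space law"
  unfolding law_def by (intro coins.P.prob_space_distr) simp

interpretation law: prob_space law by (rule prob_space_law)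

lemma AE_law: "AE x in law. 0 \<le> x \<and> x \<le> 1"
  unfolding law_def
  by (subst AE_distr_iff) (use AE_coins_le_1 in \<open>auto elim!: eventually_mono simp: scaled_sum_bounds\<close>)

text \<open>A sequence of coins has the law of one coin followed by an independent sequence
  (\<open>coins.PiM_iter\<close>), and putting the digit d in front sends the value x to (x +
  (\<beta> - 1) d) / \<beta>.\<close>

lemma law_self_similar:
  assumes E: "E \<in> sets borel"
  shows "measure law E = (measure law {x. x / \<beta> \<in> E} + measure law {x. (x + (\<beta> - 1)) / \<beta> \<in> E}) / 2"
proof -
  have preE: "{x. (x + t) / \<beta> \<in> E} \<in> sets borel" for t
  proof -
    have "(\<lambda>x. (x + t) / \<beta>) -` E \<inter> space borel \<in> sets borel"
      using E by (intro measurable_sets[of _ borel borel]) auto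
    then show ?thesis by (simp add: vimage_def)
  qed
  have law_E: "emeasure law F = emeasure coins {\<omega>\<in>space coins. scaled_sum \<beta> \<omega> \<in> F}" if "F \<in> sets borel" for F
  proof -
    have "scaled_sum \<beta> -` F \<inter> space coins = {\<omega>\<in>space coins. scaled_sum \<beta> \<omega> \<in> F}" by blast
    then show ?thesis unfolding law_def by (simp only: emeasure_distr[OF measurable_scaled_sum that])
  qed
  define A where "A = {p \<in> space (coin \<Otimes>\<^sub>M coins). scaled_sum \<beta> (case_nat (fst p) (snd p)) \<in> E}"
  have mc: "(\<lambda>(s, \<omega>). case_nat s \<omega>) \<in> measurable (coin \<Otimes>\<^sub>M coins) coins"
    by (simp add: split_beta') measurable
  have F: "{\<omega>\<in>space coins. scaled_sum \<beta> \<omega> \<in> E} \<in> sets coins"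
    using E by measurable
  have A_eq: "A = (\<lambda>(s, \<omega>). case_nat s \<omega>) -` {\<omega>\<in>space coins. scaled_sum \<beta> \<omega> \<in> E}
      \<inter> space (coin \<Otimes>\<^sub>M coins)"
    using measurable_space[OF mc] by (auto simp: A_def split_beta')
  have A: "A \<in> sets (coin \<Otimes>\<^sub>M coins)"
    unfolding A_eq by (rule measurable_sets[OF mc F])
  have "emeasure law E = emeasure (distr (coin \<Otimes>\<^sub>M coins) coins (\<lambda>(s, \<omega>). case_nat s \<omega>)) {\<omega>\<in>space coins. scaled_sum \<beta> \<omega> \<in> E}"
    unfolding coins.PiM_iter by (rule law_E[OF E])
  also have "\<dots> = emeasure (coin \<Otimes>\<^sub>M coins) A"
    unfolding A_eq by (rule emeasure_distr[OF mc F])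
  also have "\<dots> = (\<integral>\<^sup>+d. emeasure coins (Pair d -` A) \<partial>coin)"
    by (rule coins.P.emeasure_pair_measure_alt[OF A])
  also have "\<dots> = (\<integral>\<^sup>+d. emeasure law {x. (x + (\<beta> - 1) * real d) / \<beta> \<in> E} \<partial>coin)"
  proof (rule nn_integral_cong)
    fix d
    have "emeasure coins (Pair d -` A) = emeasure coins {\<omega>\<in>space coins. scaled_sum \<beta> \<omega> \<in> {x. (x + (\<beta> - 1) * real d) / \<beta> \<in> E}}"
    \<comment> \<open>The sections agree only almost everywhere, as the formula for a prepended
      digit needs digits at most 1.\<close>
    proof (rule emeasure_eq_AE)
      show "AE \<omega> in coins. \<omega> \<in> Pair d -` A \<longleftrightarrow>
          \<omega> \<in> {\<omega>\<in>space coins. scaled_sum \<beta> \<omega> \<in> {x. (x + (\<beta> - 1) * real d) / \<beta> \<in> E}}"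
        using AE_coins_le_1 AE_space
        by eventually_elim (simp add: A_def space_pair_measure scaled_sum_case_nat)
      show "Pair d -` A \<in> sets coins" using A by (rule sets_Pair1)
      show "{\<omega>\<in>space coins. scaled_sum \<beta> \<omega> \<in> {x. (x + (\<beta> - 1) * real d) / \<beta> \<in> E}} \<in> sets coins"
        using preE by measurable
    qed
    then show "emeasure coins (Pair d -` A) = emeasure law {x. (x + (\<beta> - 1) * real d) / \<beta> \<in> E}"
      using law_E[OF preE] by simp
  qed
  also have "\<dots> = (emeasure law {x. x / \<beta> \<in> E} + emeasure law {x. (x + (\<beta> - 1)) / \<beta> \<in> E}) / 2"
    by (subst nn_integral_pmf_of_set) simp_all
  finally have "ennreal (measure law E) = ennreal ((measure law {x. x / \<beta> \<in> E} + measure law {x. (x + (\<beta> - 1)) / \<beta> \<in> E}) / 2)"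
    unfolding law.emeasure_eq_measure
    by (simp add: ennreal_plus[symmetric] divide_ennreal[symmetric] del: ennreal_plus)
  then show ?thesis by (subst (asm) ennreal_inj) auto
qed

end

subsection \<open>The interval system of the cubic base\<close>

definition branch_exp :: "nat \<Rightarrow> nat" where
  "branch_exp k = [1, 2, 4] ! k"

lemma branch_exp_simps:
  "branch_exp 0 = 1" "branch_exp (Suc 0) = 2" "branch_exp 1 = 2" "branch_exp 2 = 4"
  by (simp_all add: branch_exp_def numeral_2_eq_2)

locale cubic_base =
  fixes \<beta> :: real
  assumes \<beta>_gt: "1 < \<beta>" and cubic: "\<beta> ^ 3 = 2 * \<beta>\<^sup>2 - \<beta> + 1"
begin

section \<open>Arithmetic of the base\<close>

lemma \<beta>_pos: "0 < \<beta>" "\<beta> \<noteq> 0"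
  using \<beta>_gt by auto

text \<open>The cubic has constant term -1, so \<beta> is a unit and its negative powers are integer
  polynomials in \<beta>. This keeps all translates below integral.\<close>

lemma inverse_\<beta>: "1 / \<beta> = 1 - 2 * \<beta> + \<beta>\<^sup>2"
  using cubic \<beta>_pos by (simp add: field_simps power2_eq_square power3_eq_cube)

lemma inverse_\<beta>2: "1 / \<beta>\<^sup>2 = \<beta>\<^sup>2 - \<beta> - 1"
proof -
  have "1 / \<beta>\<^sup>2 = 1 / \<beta> * (1 / \<beta>)" by (simp add: power2_eq_square)
  also have "\<dots> = 1 / \<beta> - 2 + \<beta>"
    using \<beta>_pos by (subst (2) inverse_\<beta>) (simp add: field_simps power2_eq_square)
  finally show ?thesis by (simp add: inverse_\<beta>)
qed

text \<open>The lengths of the three branches add up to 1, so that they tile the unit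
  interval.\<close>

lemma inverse_\<beta>4: "1 / \<beta> ^ 4 = 1 - 1 / \<beta> - 1 / \<beta>\<^sup>2"
proof -
  have 3: "\<beta> * \<beta>\<^sup>2 = 2 * \<beta>\<^sup>2 - \<beta> + 1" using cubic by (simp add: power2_eq_square power3_eq_cube)
  have "1 / \<beta> ^ 4 = 1 / \<beta>\<^sup>2 * (1 / \<beta>\<^sup>2)" by (simp flip: power_add)
  also have "\<dots> = 1 - 1 / \<beta> - 1 / \<beta>\<^sup>2"
    using \<beta>_pos by (subst (2) inverse_\<beta>2) (simp add: field_simps power2_eq_square)
  finally show ?thesis .
qed

text \<open>The cubic reads \<beta> (\<beta> - 1)^2 = 1, and the left side increases for \<beta> >
  1. Four decimals are enough to decide which translates miss the unit interval.\<close>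

lemma \<beta>_bounds: "17548 / 10000 < \<beta>" "\<beta> < 17549 / 10000"
proof -
  have 1: "\<beta> * (\<beta> - 1)\<^sup>2 = 1"
    using cubic by (simp add: power2_eq_square power3_eq_cube algebra_simps)
  show "17548 / 10000 < \<beta>"
  proof (rule ccontr)
    assume "\<not> ?thesis"
    then have "\<beta> * (\<beta> - 1)\<^sup>2 \<le> 17548 / 10000 * (17548 / 10000 - 1)\<^sup>2"
      using \<beta>_gt by (intro mult_mono power_mono) auto
    then show False unfolding 1 by (simp add: power2_eq_square)
  qed
  show "\<beta> < 17549 / 10000"
  proof (rule ccontr)
    assume "\<not> ?thesis"
    then have "17549 / 10000 * (17549 / 10000 - 1)\<^sup>2 \<le> \<beta> * (\<beta> - 1)\<^sup>2"
      using \<beta>_gt by (intro mult_mono power_mono) auto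
    then show False unfolding 1 by (simp add: power2_eq_square)
  qed
qed

lemma \<beta>2_bounds: "30793 / 10000 < \<beta>\<^sup>2" "\<beta>\<^sup>2 < 30797 / 10000"
proof -
  have "(17548 / 10000)\<^sup>2 < \<beta>\<^sup>2" "\<beta>\<^sup>2 < (17549 / 10000)\<^sup>2"
    using \<beta>_bounds by (intro power_strict_mono; simp)+
  then show "30793 / 10000 < \<beta>\<^sup>2" "\<beta>\<^sup>2 < 30797 / 10000"
    by (simp_all add: power2_eq_square)
qed

section \<open>Branches and cells\<close>

definition branch_offset :: "nat \<Rightarrow> real" where
  "branch_offset k = [0, 1 / \<beta>, 1 / \<beta> + 1 / \<beta>\<^sup>2] ! k"

lemma branch_offset_simps:
  "branch_offset 0 = 0" "branch_offset (Suc 0) = 1 / \<beta>" "branch_offset 1 = 1 / \<beta>"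
  "branch_offset 2 = 1 / \<beta> + 1 / \<beta>\<^sup>2"
  by (simp_all add: branch_offset_def numeral_2_eq_2)

lemma S_map_eq: "k < 3 \<Longrightarrow> S_map \<beta> k x = branch_offset k + x / \<beta> ^ branch_exp k"
  by (elim letter_cases) (simp_all add: S_map_def branch_offset_simps branch_exp_simps)

lemma branch_end:
  "branch_offset 0 + 1 / \<beta> ^ branch_exp 0 = 1 / \<beta>"
  "branch_offset 1 + 1 / \<beta> ^ branch_exp 1 = 1 / \<beta> + 1 / \<beta>\<^sup>2"
  "branch_offset 2 + 1 / \<beta> ^ branch_exp 2 = 1"
  using inverse_\<beta>4 by (simp_all add: branch_offset_simps branch_exp_simps)

lemma branch_range:
  assumes "k < 3"
  shows "0 \<le> branch_offset k" "branch_offset k + 1 / \<beta> ^ branch_exp k \<le> 1"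
proof -
  have "0 \<le> 1 / \<beta>" "0 \<le> 1 / \<beta>\<^sup>2" "0 \<le> 1 / \<beta> ^ 4" using \<beta>_pos by simp_all
  then have *: "0 \<le> 1 / \<beta>" "0 \<le> 1 / \<beta> + 1 / \<beta>\<^sup>2" "1 / \<beta> \<le> 1" "1 / \<beta> + 1 / \<beta>\<^sup>2 \<le> 1"
    using inverse_\<beta>4 by linarith+
  have "0 \<le> branch_offset k \<and> branch_offset k + 1 / \<beta> ^ branch_exp k \<le> 1"
    using assms
  proof (cases rule: letter_cases)
    case 1
    show ?thesis unfolding 1 branch_end using *(3) by (simp only: branch_offset_simps order_refl)
  next
    case 2
    show ?thesis unfolding 2 branch_end using *(1,4) by (simp only: branch_offset_simps order_refl)
  next
    case 3
    show ?thesis unfolding 3 branch_end using *(2) by (simp only: branch_offset_simps order_refl)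
  qed
  then show "0 \<le> branch_offset k" "branch_offset k + 1 / \<beta> ^ branch_exp k \<le> 1" by blast+
qed

lemma mem_S_image:
  assumes "k < 3"
  shows "x \<in> S_map \<beta> k ` A \<longleftrightarrow> \<beta> ^ branch_exp k * (x - branch_offset k) \<in> A"
proof
  assume "x \<in> S_map \<beta> k ` A"
  then show "\<beta> ^ branch_exp k * (x - branch_offset k) \<in> A"
    using \<beta>_pos by (auto simp: S_map_eq[OF assms])
next
  assume *: "\<beta> ^ branch_exp k * (x - branch_offset k) \<in> A"
  have "x = S_map \<beta> k (\<beta> ^ branch_exp k * (x - branch_offset k))"
    using \<beta>_pos by (simp add: S_map_eq[OF assms])
  then show "x \<in> S_map \<beta> k ` A" using * by blast
qed

lemma S_image_interval:
  assumes "k < 3"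
  shows "S_map \<beta> k ` {0..<1} = {branch_offset k..<branch_offset k + 1 / \<beta> ^ branch_exp k}"
proof (rule set_eqI)
  fix x
  define p where "p = \<beta> ^ branch_exp k"
  have p: "0 < p" using \<beta>_pos by (simp add: p_def)
  have "p * (x - branch_offset k) < 1 \<longleftrightarrow> x - branch_offset k < 1 / p"
    using p by (simp add: pos_less_divide_eq mult.commute)
  moreover have "0 \<le> p * (x - branch_offset k) \<longleftrightarrow> branch_offset k \<le> x"
    using p by (simp add: zero_le_mult_iff)
  ultimately show "x \<in> S_map \<beta> k ` {0..<1} \<longleftrightarrow>
      x \<in> {branch_offset k..<branch_offset k + 1 / \<beta> ^ branch_exp k}"
    unfolding mem_S_image[OF assms] atLeastLessThan_iff p_def[symmetric] by linarith
qed

definition cell :: "nat list \<Rightarrow> real set" where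
  "cell w = comp_word (S_map \<beta>) w ` {0..<1}"

lemma cell_Nil: "cell [] = {0..<1}"
  by (simp add: cell_def)

lemma cell_Cons: "cell (k # w) = S_map \<beta> k ` cell w"
  by (simp add: cell_def image_comp)

lemma mem_cell_Cons:
  "k < 3 \<Longrightarrow> x \<in> cell (k # w) \<longleftrightarrow> \<beta> ^ branch_exp k * (x - branch_offset k) \<in> cell w"
  unfolding cell_Cons by (rule mem_S_image)

lemma cell_subset: "set w \<subseteq> {..<3} \<Longrightarrow> cell w \<subseteq> {0..<1}"
proof (induction w)
  case (Cons k w)
  then have k: "k < 3" and "cell w \<subseteq> {0..<1}" by auto
  then have "cell (k # w) \<subseteq> S_map \<beta> k ` {0..<1}" unfolding cell_Cons by (intro image_mono)
  also have "\<dots> \<subseteq> {0..<1}" using branch_range[OF k] unfolding S_image_interval[OF k] by auto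
  finally show ?case .
qed (simp add: cell_Nil)

lemma affine_vimage_borel:
  fixes r s :: real
  assumes "A \<in> sets borel"
  shows "{x. r * (x - s) \<in> A} \<in> sets borel"
proof -
  have "(\<lambda>x. r * (x - s)) -` A \<inter> space borel \<in> sets borel"
    using assms by (intro measurable_sets[of _ borel borel]) auto
  then show ?thesis by (simp add: vimage_def)
qed

lemma cell_borel: "set w \<subseteq> {..<3} \<Longrightarrow> cell w \<in> sets borel"
proof (induction w)
  case (Cons k w)
  then have k: "k < 3" and "cell w \<in> sets borel" by auto
  then have "{x. \<beta> ^ branch_exp k * (x - branch_offset k) \<in> cell w} \<in> sets borel"
    by (intro affine_vimage_borel)
  moreover have "cell (k # w) = {x. \<beta> ^ branch_exp k * (x - branch_offset k) \<in> cell w}"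
    using mem_cell_Cons[OF k] by blast
  ultimately show ?case by simp
qed (simp add: cell_Nil)

lemma affine_partition: "affine_partition_system 3 (S_map \<beta>)"
  unfolding affine_partition_system_def
proof (intro conjI allI impI)
  fix k :: nat assume k: "k < 3"
  let ?r = "1 / \<beta> ^ branch_exp k"
  have e: "branch_exp k \<noteq> 0" using k by (elim letter_cases) (simp_all add: branch_exp_simps)
  have r: "0 < ?r" "?r < 1" using \<beta>_gt e by (auto simp: one_less_power)
  show "affine_contraction (S_map \<beta> k)"
    unfolding affine_contraction_def
  proof
    show "S_map \<beta> k ` {0..1} \<subseteq> {0..1}"
    proof (rule image_subsetI)
      fix x :: real assume "x \<in> {0..1}"
      then have "0 \<le> x / \<beta> ^ branch_exp k" "x / \<beta> ^ branch_exp k \<le> ?r"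
        using \<beta>_pos by (auto intro: divide_right_mono)
      then show "S_map \<beta> k x \<in> {0..1}"
        using branch_range[OF k] unfolding S_map_eq[OF k] atLeastAtMost_iff by linarith
    qed
    show "\<exists>r t. \<bar>r\<bar> < 1 \<and> (\<forall>x\<in>{0..1}. S_map \<beta> k x = r * x + t)"
      by (rule exI[of _ ?r], rule exI[of _ "branch_offset k"]) (use r in \<open>simp add: S_map_eq[OF k]\<close>)
  qed
next
  define p q where "p = 1 / \<beta>" and "q = 1 / \<beta>\<^sup>2"
  have "0 < 1 / \<beta>" "0 < 1 / \<beta>\<^sup>2" "0 < 1 / \<beta> ^ 4" using \<beta>_pos by simp_all
  then have o: "0 < p" "0 < q" "p + q < 1" using inverse_\<beta>4 by (auto simp only: p_def q_def)
  have i: "S_map \<beta> 0 ` {0..<1} = {0..<p}" "S_map \<beta> 1 ` {0..<1} = {p..<p + q}"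
      "S_map \<beta> 2 ` {0..<1} = {p + q..<1}"
    using S_image_interval[of 0] S_image_interval[of 1] S_image_interval[of 2]
    unfolding branch_end unfolding branch_offset_simps p_def q_def by simp_all
  have 3: "{..<3::nat} = {0, 1, 2}" by auto
  show "disjoint_family_on (\<lambda>k. S_map \<beta> k ` {0..<1}) {..<3}"
    using o by (auto simp: 3 disjoint_family_on_def i simp del: One_nat_def)
  show "(\<Union>k<3. S_map \<beta> k ` {0..<1}) = {0..<1}"
    using o by (auto simp: 3 i simp del: One_nat_def)
qed

section \<open>Coding points by their itineraries\<close>

definition digit :: "real \<Rightarrow> nat" where
  "digit x = (if x < 1 / \<beta> then 0 else if x < 1 / \<beta> + 1 / \<beta>\<^sup>2 then 1 else 2)"

lemma digit_less: "digit x < 3"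
  by (simp add: digit_def)

lemma T_map_digit: "T_map \<beta> x = \<beta> ^ branch_exp (digit x) * (x - branch_offset (digit x))"
  by (simp add: T_map_def digit_def branch_exp_simps branch_offset_simps algebra_simps)

lemma digit_of_S_image:
  assumes "k < 3" "x \<in> S_map \<beta> k ` {0..<1}"
  shows "digit x = k"
proof -
  define q where "q = 1 / \<beta>\<^sup>2"
  have q: "0 < q" using \<beta>_pos by (simp add: q_def)
  have x: "branch_offset k \<le> x" "x < branch_offset k + 1 / \<beta> ^ branch_exp k"
    using assms(2) unfolding S_image_interval[OF assms(1)] by auto
  show ?thesis using assms(1)
  proof (cases rule: letter_cases)
    case 1
    show ?thesis using x unfolding 1 branch_end by (simp add: digit_def)
  next
    case 2
    show ?thesis using x unfolding 2 branch_end by (simp add: digit_def branch_offset_simps)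
  next
    case 3
    show ?thesis using x q unfolding 3 branch_end
      by (simp add: digit_def branch_offset_simps flip: q_def)
  qed
qed

lemma inverse_map: "inverse_map_of 3 (S_map \<beta>) (T_map \<beta>)"
  unfolding inverse_map_of_def
proof (intro allI impI ballI)
  fix k :: nat and x :: real assume k: "k < 3" and x: "x \<in> {0..<1}"
  have "digit (S_map \<beta> k x) = k" using x by (intro digit_of_S_image k) blast
  then show "T_map \<beta> (S_map \<beta> k x) = x" using \<beta>_pos by (simp add: T_map_digit S_map_eq[OF k])
qed

lemma mem_cell_Cons_digit:
  assumes "set (k # w) \<subseteq> {..<3}"
  shows "x \<in> cell (k # w) \<longleftrightarrow> digit x = k \<and> T_map \<beta> x \<in> cell w"
proof
  assume x: "x \<in> cell (k # w)"
  have k: "k < 3" using assms by simp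
  have "x \<in> S_map \<beta> k ` {0..<1}" using x cell_subset[of w] assms unfolding cell_Cons by auto
  then have "digit x = k" by (rule digit_of_S_image[OF k])
  then show "digit x = k \<and> T_map \<beta> x \<in> cell w"
    using x mem_cell_Cons[OF k] by (simp add: T_map_digit)
next
  assume "digit x = k \<and> T_map \<beta> x \<in> cell w"
  then show "x \<in> cell (k # w)"
    using mem_cell_Cons[of k] assms by (auto simp: T_map_digit)
qed

lemma T_map_range:
  assumes "x \<in> {0..<1}"
  shows "T_map \<beta> x \<in> {0..<1}"
proof -
  have "x \<in> (\<Union>k<3. S_map \<beta> k ` {0..<1})"
    using affine_partition assms by (simp add: affine_partition_system_def)
  then obtain k where k: "k < 3" "x \<in> S_map \<beta> k ` {0..<1}" by blast
  have "x \<in> cell [k]" using k by (simp add: cell_Cons cell_Nil)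
  then show ?thesis using mem_cell_Cons_digit[of k "[]"] k by (simp add: cell_Nil)
qed

definition code :: "real \<Rightarrow> nat \<Rightarrow> nat" where
  "code x n = digit ((T_map \<beta> ^^ n) x)"

lemma code_Omega: "code x \<in> Omega 3"
  by (simp add: Omega_def code_def digit_less)

lemma code_mem_cylinder:
  assumes "set w \<subseteq> {..<3}" "x \<in> {0..<1}"
  shows "code x \<in> cylinder 3 w \<longleftrightarrow> x \<in> cell w"
  using assms
proof (induction w arbitrary: x)
  case Nil
  then show ?case by (simp add: cylinder_def code_Omega cell_Nil)
next
  case (Cons k w)
  have "code x \<in> cylinder 3 (k # w) \<longleftrightarrow> digit x = k \<and> (\<forall>i<length w. code (T_map \<beta> x) i = w ! i)"
    by (auto simp: cylinder_def code_Omega code_def All_less_Suc2 funpow_swap1)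
  also have "\<dots> \<longleftrightarrow> digit x = k \<and> code (T_map \<beta> x) \<in> cylinder 3 w"
    by (simp add: cylinder_def code_Omega)
  also have "\<dots> \<longleftrightarrow> x \<in> cell (k # w)"
    using Cons.IH[of "T_map \<beta> x"] T_map_range[OF Cons.prems(2)] mem_cell_Cons_digit[OF Cons.prems(1)] Cons.prems
    by simp
  finally show ?case .
qed

lemma measurable_digit [measurable]: "digit \<in> measurable borel (count_space UNIV)"
  unfolding digit_def by measurable

lemma measurable_T_map [measurable]: "T_map \<beta> \<in> borel_measurable borel"
  unfolding T_map_def by measurable

lemma measurable_code: "code \<in> borel_measurable borel"
proof (rule measurable_coordinatewise_then_product)
  fix n
  have "(T_map \<beta> ^^ n) \<in> borel_measurable borel"
    by (induction n) (auto simp: comp_def intro: measurable_compose)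
  from measurable_compose[OF this measurable_digit]
  have "(\<lambda>x. code x n) \<in> measurable borel (count_space UNIV)" by (simp add: code_def)
  then show "(\<lambda>x. code x n) \<in> borel_measurable borel"
    by (rule measurable_compose) simp
qed

lemma cylinder_sets: "cylinder 3 w \<in> sets (restrict_space borel (Omega 3))"
proof -
  have "{\<xi> :: nat \<Rightarrow> nat. \<forall>i<length w. \<xi> i = w ! i} = (\<Inter>i<length w. (\<lambda>\<xi>. \<xi> i) -` {w ! i})"
    by auto
  moreover have "open ((\<lambda>\<xi> :: nat \<Rightarrow> nat. \<xi> i) -` {w ! i})" for i
    by (intro open_vimage discrete_topology_class.open_discrete continuous_on_product_coordinates)
  ultimately have "open {\<xi> :: nat \<Rightarrow> nat. \<forall>i<length w. \<xi> i = w ! i}" by (auto intro: open_INT)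
  then have "{\<xi> :: nat \<Rightarrow> nat. \<forall>i<length w. \<xi> i = w ! i} \<in> sets borel" by simp
  moreover have "cylinder 3 w = Omega 3 \<inter> {\<xi>. \<forall>i<length w. \<xi> i = w ! i}"
    by (auto simp: cylinder_def)
  ultimately show ?thesis by (auto simp: sets_restrict_space)
qed

subsection \<open>The mass vectors of the cells\<close>

abbreviation \<mu> :: "real measure" where
  "\<mu> \<equiv> law \<beta>"

interpretation \<mu>: prob_space \<mu>
  by (rule prob_space_law[OF \<beta>_gt])

lemma sets_\<mu>: "sets \<mu> = sets borel" and space_\<mu>: "space \<mu> = UNIV"
  using sets_law[OF \<beta>_gt] space_law[OF \<beta>_gt] by auto

lemma \<mu>_zero:
  assumes "A \<in> sets borel" "\<And>x. 0 \<le> x \<Longrightarrow> x \<le> 1 \<Longrightarrow> x \<notin> A"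
  shows "measure \<mu> A = 0"
proof -
  have "AE x in \<mu>. x \<in> A \<longleftrightarrow> x \<in> {}"
    using AE_law[OF \<beta>_gt] by eventually_elim (use assms(2) in blast)
  then have "measure \<mu> A = measure \<mu> {}"
    using assms(1) by (intro \<mu>.finite_measure_eq_AE) (simp_all add: sets_\<mu>)
  then show ?thesis by simp
qed

text \<open>Of the two preimages of 1 under the similarities, \<beta> lies outside the support and
  the other is 1 itself, so the mass is half of itself. This matters because cells are half-open and
  none contains 1.\<close>

lemma \<mu>_one: "measure \<mu> {1} = 0"
proof -
  have 1: "{x. x / \<beta> \<in> {1}} = {\<beta>}" "{x. (x + (\<beta> - 1)) / \<beta> \<in> {1}} = {1}"
    using \<beta>_pos by (auto simp: field_simps)
  have "measure \<mu> {1} = (measure \<mu> {\<beta>} + measure \<mu> {1}) / 2"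
    using law_self_similar[OF \<beta>_gt, of "{1}"] unfolding 1 by simp
  moreover have "measure \<mu> {\<beta>} = 0" using \<beta>_gt by (intro \<mu>_zero) auto
  ultimately show ?thesis by simp
qed

lemma AE_\<mu>: "AE x in \<mu>. x \<in> {0..<1}"
proof -
  have "AE x in \<mu>. x \<notin> {1}"
    using \<mu>_one by (intro AE_not_in) (auto simp: null_sets_def sets_\<mu> \<mu>.emeasure_eq_measure)
  then show ?thesis using AE_law[OF \<beta>_gt] by eventually_elim auto
qed

text \<open>The mass of the cell contracted by the n-th power of 1/\<beta> and then translated by t,
  written as a preimage. A new first letter raises n, and each use of self-similarity lowers it by
  one.\<close>

definition cell_mass :: "nat \<Rightarrow> real \<Rightarrow> nat list \<Rightarrow> real" where
  "cell_mass n t w = measure \<mu> {y. \<beta> ^ n * (y - t) \<in> cell w}"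

lemma cell_mass_Suc:
  assumes "set w \<subseteq> {..<3}"
  shows "cell_mass (Suc n) t w = (cell_mass n (\<beta> * t) w + cell_mass n (\<beta> * t - (\<beta> - 1)) w) / 2"
proof -
  have "{x. x / \<beta> \<in> {y. \<beta> ^ Suc n * (y - t) \<in> cell w}} = {y. \<beta> ^ n * (y - \<beta> * t) \<in> cell w}"
      "{x. (x + (\<beta> - 1)) / \<beta> \<in> {y. \<beta> ^ Suc n * (y - t) \<in> cell w}} =
        {y. \<beta> ^ n * (y - (\<beta> * t - (\<beta> - 1))) \<in> cell w}"
  proof -
    have "\<beta> ^ Suc n * (x / \<beta> - t) = \<beta> ^ n * (x - \<beta> * t)"
      "\<beta> ^ Suc n * ((x + (\<beta> - 1)) / \<beta> - t) = \<beta> ^ n * (x - (\<beta> * t - (\<beta> - 1)))" for x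
      using \<beta>_pos by (simp_all add: field_simps)
    then show "{x. x / \<beta> \<in> {y. \<beta> ^ Suc n * (y - t) \<in> cell w}} = {y. \<beta> ^ n * (y - \<beta> * t) \<in> cell w}"
      "{x. (x + (\<beta> - 1)) / \<beta> \<in> {y. \<beta> ^ Suc n * (y - t) \<in> cell w}} =
        {y. \<beta> ^ n * (y - (\<beta> * t - (\<beta> - 1))) \<in> cell w}" by (simp_all only: mem_Collect_eq)
  qed
  then show ?thesis
    using law_self_similar[OF \<beta>_gt affine_vimage_borel[OF cell_borel[OF assms]], of "\<beta> ^ Suc n" t]
    by (simp only: cell_mass_def)
qed

lemma cell_mass_Cons:
  assumes "k < 3"
  shows "cell_mass 0 t (k # w) = cell_mass (branch_exp k) (t + branch_offset k) w"
  by (simp add: cell_mass_def mem_cell_Cons[OF assms] algebra_simps)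

lemma cell_mass_0: "cell_mass 0 0 w = measure \<mu> (cell w)"
  by (simp add: cell_mass_def)

lemma cell_mass_zero:
  assumes "set w \<subseteq> {..<3}" "1 \<le> t \<or> t \<le> -1"
  shows "cell_mass 0 t w = 0"
proof -
  have "AE y in \<mu>. y \<notin> {y. \<beta> ^ 0 * (y - t) \<in> cell w}"
    using AE_\<mu>
  proof eventually_elim
    case (elim y)
    have "y - t \<notin> cell w" using elim cell_subset[OF assms(1)] assms(2) by auto
    then show ?case by simp
  qed
  moreover have "{y. \<beta> ^ 0 * (y - t) \<in> cell w} \<in> sets \<mu>"
    unfolding sets_\<mu> by (rule affine_vimage_borel[OF cell_borel[OF assms(1)]])
  ultimately show ?thesis unfolding cell_mass_def by (simp add: \<mu>.prob_eq_0)
qed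

text \<open>Integer coordinates in the basis 1, \<beta>, \<beta>^2 turn the recursions for
  translates into integer arithmetic that rewriting can carry out.\<close>

definition shift_at :: "int \<Rightarrow> int \<Rightarrow> int \<Rightarrow> real" where
  "shift_at a b c = of_int a + of_int b * \<beta> + of_int c * \<beta>\<^sup>2"

lemma cell_mass_shift_at_Suc:
  assumes "set w \<subseteq> {..<3}"
  shows "cell_mass (Suc n) (shift_at a b c) w =
    (cell_mass n (shift_at c (a - c) (b + 2 * c)) w + cell_mass n (shift_at (c + 1) (a - c - 1) (b + 2 * c)) w) / 2"
proof -
  have "of_int c * \<beta> ^ 3 = of_int c * (2 * \<beta>\<^sup>2 - \<beta> + 1)" by (simp only: cubic)
  then have 1: "\<beta> * shift_at a b c = shift_at c (a - c) (b + 2 * c)"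
    by (simp add: shift_at_def algebra_simps power2_eq_square power3_eq_cube)
  have 2: "\<beta> * shift_at a b c - (\<beta> - 1) = shift_at (c + 1) (a - c - 1) (b + 2 * c)"
    unfolding 1 by (simp add: shift_at_def algebra_simps)
  show ?thesis unfolding cell_mass_Suc[OF assms] 2 unfolding 1 ..
qed

text \<open>The exponents are spelt with \<open>Suc\<close> so that
  \<open>cell_mass_shift_at_Suc\<close> can rewrite them down to 0.\<close>

lemma cell_mass_shift_at_Cons:
  "cell_mass 0 (shift_at a b c) (0 # w) = cell_mass (Suc 0) (shift_at a b c) w"
  "cell_mass 0 (shift_at a b c) (Suc 0 # w) = cell_mass (Suc (Suc 0)) (shift_at (a + 1) (b - 2) (c + 1)) w"
  "cell_mass 0 (shift_at a b c) (2 # w) =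
    cell_mass (Suc (Suc (Suc (Suc 0)))) (shift_at a (b - 3) (c + 2)) w"
proof -
  have "shift_at a b c + 1 / \<beta> = shift_at (a + 1) (b - 2) (c + 1)"
    "shift_at a b c + (1 / \<beta> + 1 / \<beta>\<^sup>2) = shift_at a (b - 3) (c + 2)"
    unfolding inverse_\<beta> inverse_\<beta>2 by (simp_all add: shift_at_def algebra_simps)
  moreover have "cell_mass 0 t (0 # w) = cell_mass 1 t w" "cell_mass 0 t (1 # w) = cell_mass 2 (t + 1 / \<beta>) w"
    "cell_mass 0 t (2 # w) = cell_mass 4 (t + (1 / \<beta> + 1 / \<beta>\<^sup>2)) w" for t
    by (simp_all only: cell_mass_Cons branch_exp_simps branch_offset_simps) simp_all
  moreover have "1 = Suc 0" "2 = Suc (Suc 0)" "4 = Suc (Suc (Suc (Suc 0)))" by simp_all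
  ultimately show "cell_mass 0 (shift_at a b c) (0 # w) = cell_mass (Suc 0) (shift_at a b c) w"
    "cell_mass 0 (shift_at a b c) (Suc 0 # w) = cell_mass (Suc (Suc 0)) (shift_at (a + 1) (b - 2) (c + 1)) w"
    "cell_mass 0 (shift_at a b c) (2 # w) =
      cell_mass (Suc (Suc (Suc (Suc 0)))) (shift_at a (b - 3) (c + 2)) w"
    by metis+
qed

lemma scaled_bounds:
  fixes l u x y :: real
  assumes "l / 10000 < x" "x < u / 10000"
  shows "0 \<le> y \<Longrightarrow> l * y \<le> 10000 * (y * x)" "y \<le> 0 \<Longrightarrow> u * y \<le> 10000 * (y * x)"
    "0 \<le> y \<Longrightarrow> 10000 * (y * x) \<le> u * y" "y \<le> 0 \<Longrightarrow> 10000 * (y * x) \<le> l * y"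
  using assms mult_left_mono[of l "10000 * x" y] mult_left_mono[of "10000 * x" u y]
    mult_left_mono_neg[of l "10000 * x" y] mult_left_mono_neg[of "10000 * x" u y]
  by (simp_all add: mult.left_commute mult.commute[of y])

text \<open>An integer condition, decidable by the simplifier, for the shift to lie outside \<open>]-1, 1[\<close>.\<close>

lemma cell_mass_shift_at_zero:
  assumes "set w \<subseteq> {..<3}"
    and "10000 \<le> 10000 * a + (if 0 \<le> b then 17548 * b else 17549 * b) + (if 0 \<le> c then 30793 * c else 30797 * c) \<or>
      10000 * a + (if 0 \<le> b then 17549 * b else 17548 * b) + (if 0 \<le> c then 30797 * c else 30793 * c) \<le> -10000"
  shows "cell_mass 0 (shift_at a b c) w = 0"
proof (rule cell_mass_zero[OF assms(1)])
  define B C where "B = (of_int b :: real)" and "C = (of_int c :: real)"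
  have b: "(if 0 \<le> b then 17548 * B else 17549 * B) \<le> 10000 * (B * \<beta>)"
      "10000 * (B * \<beta>) \<le> (if 0 \<le> b then 17549 * B else 17548 * B)"
    using scaled_bounds[OF \<beta>_bounds, of B] by (auto simp: B_def)
  have c: "(if 0 \<le> c then 30793 * C else 30797 * C) \<le> 10000 * (C * \<beta>\<^sup>2)"
      "10000 * (C * \<beta>\<^sup>2) \<le> (if 0 \<le> c then 30797 * C else 30793 * C)"
    using scaled_bounds[OF \<beta>2_bounds, of C] by (auto simp: C_def)
  have "10000 \<le> 10000 * of_int a + (if 0 \<le> b then 17548 * B else 17549 * B) + (if 0 \<le> c then 30793 * C else 30797 * C) \<or>
      10000 * of_int a + (if 0 \<le> b then 17549 * B else 17548 * B) + (if 0 \<le> c then 30797 * C else 30793 * C) \<le> (-10000 :: real)"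
  proof -
    define L where "L = 10000 * a + (if 0 \<le> b then 17548 * b else 17549 * b) + (if 0 \<le> c then 30793 * c else 30797 * c)"
    define H where "H = 10000 * a + (if 0 \<le> b then 17549 * b else 17548 * b) + (if 0 \<le> c then 30797 * c else 30793 * c)"
    have "10000 \<le> L \<or> H \<le> -10000" using assms(2) by (simp only: L_def H_def)
    then have "(10000 :: real) \<le> of_int L \<or> of_int H \<le> (-10000 :: real)" by linarith
    then show ?thesis
      by (cases "0 \<le> b"; cases "0 \<le> c") (simp_all add: L_def H_def B_def C_def)
  qed
  then show "1 \<le> shift_at a b c \<or> shift_at a b c \<le> -1"
    using b c unfolding shift_at_def B_def[symmetric] C_def[symmetric] by argo
qed

text \<open>The eight shifts used here are all the elements of \<open>]-1, 1[\<close> that arise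
  from 0 by the recursions above; the seven sums are those on which these recursions act by \<open>M0\<close>, \<open>M1\<close>, \<open>M2\<close>.\<close>

definition cell_vec :: "nat list \<Rightarrow> real ^ 7" where
  "cell_vec w = (let m = \<lambda>a b c. cell_mass 0 (shift_at a b c) w in vector
     [m 0 0 0 + m 1 (-1) 0, m 2 (-1) 0, m 0 2 (-1) + m 1 1 (-1), m (-1) 2 (-1),
      m 0 0 0 + m (-1) 1 0, m 0 2 (-1), m 1 (-2) 1])"

lemma cell_vec_nth:
  "cell_vec w $ 1 = cell_mass 0 (shift_at 0 0 0) w + cell_mass 0 (shift_at 1 (-1) 0) w"
  "cell_vec w $ 2 = cell_mass 0 (shift_at 2 (-1) 0) w"
  "cell_vec w $ 3 = cell_mass 0 (shift_at 0 2 (-1)) w + cell_mass 0 (shift_at 1 1 (-1)) w"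
  "cell_vec w $ 4 = cell_mass 0 (shift_at (-1) 2 (-1)) w"
  "cell_vec w $ 5 = cell_mass 0 (shift_at 0 0 0) w + cell_mass 0 (shift_at (-1) 1 0) w"
  "cell_vec w $ 6 = cell_mass 0 (shift_at 0 2 (-1)) w"
  "cell_vec w $ 7 = cell_mass 0 (shift_at 1 (-2) 1) w"
  by (simp_all only: cell_vec_def Let_def vector_7)

text \<open>Used as rewrite rules these compute: they absorb a letter into the exponent, halve until
  the exponent is 0, and discard the translates that miss the unit interval.\<close>

lemmas cell_mass_eval = cell_mass_shift_at_Cons cell_mass_shift_at_Suc cell_mass_shift_at_zero

lemma cell_vec_Cons_0:
  assumes w: "set w \<subseteq> {..<3}"
  shows "cell_vec (0 # w) = (1 / 2) *\<^sub>R (M0 *v cell_vec w)"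
  unfolding vec_eq_iff forall_7 vector_scaleR_component M0_mult cell_vec_nth
  by (simp add: cell_mass_eval w add_divide_distrib)

lemma cell_vec_Cons_1:
  assumes w: "set w \<subseteq> {..<3}"
  shows "cell_vec (Suc 0 # w) = (1 / 4) *\<^sub>R (M1 *v cell_vec w)"
  unfolding vec_eq_iff forall_7 vector_scaleR_component M1_mult cell_vec_nth
  by (simp add: cell_mass_eval w add_divide_distrib)

lemma cell_vec_Cons_2:
  assumes w: "set w \<subseteq> {..<3}"
  shows "cell_vec (2 # w) = (1 / 16) *\<^sub>R (M2 *v cell_vec w)"
  unfolding vec_eq_iff forall_7 vector_scaleR_component M2_mult cell_vec_nth
  by (simp add: cell_mass_eval w add_divide_distrib)

lemma measure_cell_Cons:
  assumes k: "k < 3" and w: "set w \<subseteq> {..<3}"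
  shows "measure \<mu> (cell (k # w)) = letter_weight k * cell_vec w $ first_coord k"
proof -
  have "measure \<mu> (cell (k # w)) = cell_mass 0 (shift_at 0 0 0) (k # w)"
    using cell_mass_0[of "k # w"] by (simp add: shift_at_def)
  then show ?thesis
    using k by (elim letter_cases)
      (simp_all add: cell_mass_eval w letter_weight_def first_coord_def cell_vec_nth)
qed

lemma cell_vec_Cons:
  assumes "k < 3" "set w \<subseteq> {..<3}"
  shows "cell_vec (k # w) = letter_weight k *\<^sub>R (M_mat k *v cell_vec w)"
  using assms(1)
proof (cases rule: letter_cases)
  case 1
  then show ?thesis
    using cell_vec_Cons_0[OF assms(2)] by (simp add: letter_weight_def M_mat_simps)
next
  case 2
  then show ?thesis
    using cell_vec_Cons_1[OF assms(2)] by (simp add: letter_weight_def M_mat_simps)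
next
  case 3
  then show ?thesis
    using cell_vec_Cons_2[OF assms(2)] by (simp add: letter_weight_def M_mat_simps)
qed

lemma cell_vec_eq:
  "set w \<subseteq> {..<3} \<Longrightarrow> cell_vec w = word_weight w *\<^sub>R (mat_word w *v cell_vec [])"
proof (induction w)
  case (Cons k w)
  then show ?case
    by (simp add: cell_vec_Cons word_weight_def matrix_vector_mult_scaleR matrix_vector_mul_assoc)
qed (simp add: word_weight_def)

lemma cell_mass_nonneg: "0 \<le> cell_mass n t w"
  by (simp add: cell_mass_def)

lemma cell_mass_first_letter_le:
  assumes "k < 3"
  shows "cell_mass 0 t [k] \<le> cell_mass 0 t []"
  unfolding cell_mass_def
proof (rule \<mu>.finite_measure_mono)
  show "{y. \<beta> ^ 0 * (y - t) \<in> cell [k]} \<subseteq> {y. \<beta> ^ 0 * (y - t) \<in> cell []}"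
    using cell_subset[of "[k]"] assms by (auto simp: cell_Nil)
  show "{y. \<beta> ^ 0 * (y - t) \<in> cell []} \<in> sets \<mu>"
    unfolding sets_\<mu> by (intro affine_vimage_borel cell_borel) simp
qed

text \<open>Positivity spreads from the total mass 1 at translate 0: a translate is bounded below by
  its part over one first letter, whose expansion contains a translate already known to be positive.
  The order of the steps follows these dependencies, for instance from m2 to m7 to m6 to m4.\<close>

lemma cell_vec_Nil_pos: "0 < cell_vec [] $ i"
proof -
  let ?m = "\<lambda>a b c. cell_mass 0 (shift_at a b c) []"
  note n = cell_mass_nonneg[of 0 "shift_at a b c" "[]" for a b c]
  have "?m 0 0 0 = measure \<mu> {0..<1}"
    using cell_mass_0[of "[]"] by (simp add: shift_at_def cell_Nil)
  also have "\<dots> = 1" using AE_\<mu> by (intro \<mu>.prob_eq_1[THEN iffD2]) (simp_all add: sets_\<mu>)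
  finally have m0: "?m 0 0 0 = 1" .
  note le0 = cell_mass_first_letter_le[of 0 "shift_at a b c" for a b c, simplified]
  note le1 = cell_mass_first_letter_le[of "Suc 0" "shift_at a b c" for a b c, simplified]
  note le2 = cell_mass_first_letter_le[of 2 "shift_at a b c" for a b c, simplified]
  have m1: "0 < ?m 1 (-1) 0"
  proof -
    have "cell_mass 0 (shift_at 1 (-1) 0) [2] = (?m 0 0 0 + ?m 1 (-1) 0 + ?m 1 (-2) 1) / 16"
      by (simp add: cell_mass_eval)
    then show ?thesis using le2[of 1 "-1" 0] m0 n[of 1 "-1" 0] n[of 1 "-2" 1] by argo
  qed
  have m2: "0 < ?m 0 2 (-1)"
    using le0[of 0 2 "-1"] m0 n[of "-1" 1 0] by (simp add: cell_mass_eval)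
  have m3: "0 < ?m 1 1 (-1)"
    using le1[of 1 1 "-1"] m0 n[of "-1" 1 0] n[of "-1" 2 "-1"] by (simp add: cell_mass_eval add_divide_distrib)
  have m5: "0 < ?m (-1) 2 (-1)"
    using le1[of "-1" 2 "-1"] m0 m1 by (simp add: cell_mass_eval add_divide_distrib)
  have m7: "0 < ?m 2 (-1) 0"
    using le1[of 2 "-1" 0] m2 by (simp add: cell_mass_eval add_divide_distrib)
  have m6: "0 < ?m 1 (-2) 1"
    using le0[of 1 "-2" 1] m7 by (simp add: cell_mass_eval add_divide_distrib)
  have m4: "0 < ?m (-1) 1 0"
    using le0[of "-1" 1 0] m6 by (simp add: cell_mass_eval add_divide_distrib)
  have "\<forall>i. 0 < cell_vec [] $ i"
    unfolding forall_7 cell_vec_nth using m0 m1 m2 m3 m4 m5 m6 m7 by simp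
  then show ?thesis ..
qed

section \<open>The coded measure and its weak-Gibbs property\<close>

lemma scaled_eq: "scaled_bernoulli_convolution2 \<beta> = restrict_space \<mu> {0..1}"
  by (simp add: scaled_bernoulli_convolution2_def law_eq[OF \<beta>_gt])

lemma prob_space_scaled: "prob_space (scaled_bernoulli_convolution2 \<beta>)"
  unfolding scaled_eq
proof (rule prob_space_restrict_space)
  show "emeasure \<mu> {0..1} = 1"
    using AE_law[OF \<beta>_gt] by (intro \<mu>.emeasure_eq_1_AE) (simp_all add: sets_\<mu>)
qed (simp add: sets_\<mu>)

lemma space_scaled: "space (scaled_bernoulli_convolution2 \<beta>) = {0..1}"
  unfolding scaled_eq by (simp add: space_restrict_space space_\<mu>)

lemma sets_scaled: "sets (scaled_bernoulli_convolution2 \<beta>) = sets (restrict_space borel {0..1})"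
  unfolding scaled_eq by (rule sets_restrict_space_cong[OF sets_\<mu>])

lemma measure_scaled:
  "A \<subseteq> {0..1} \<Longrightarrow> measure (scaled_bernoulli_convolution2 \<beta>) A = measure \<mu> A"
  unfolding scaled_eq by (rule measure_restrict_space) (simp_all add: sets_\<mu> space_\<mu>)

text \<open>As the image under the itinerary map the measure exists at once, and no extension from
  cylinders has to be constructed.\<close>

definition coded_measure :: "(nat \<Rightarrow> nat) measure" where
  "coded_measure = distr (scaled_bernoulli_convolution2 \<beta>) (restrict_space borel (Omega 3)) code"

lemma measurable_code_scaled:
  "code \<in> measurable (scaled_bernoulli_convolution2 \<beta>) (restrict_space borel (Omega 3))"
proof (rule measurable_restrict_space2)
  show "code \<in> borel_measurable (scaled_bernoulli_convolution2 \<beta>)"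
    unfolding measurable_cong_sets[OF sets_scaled refl]
    by (rule measurable_restrict_space1[OF measurable_code])
qed (simp add: code_Omega)

lemma coded_measure_cylinder:
  assumes w: "set w \<subseteq> {..<3}"
  shows "measure coded_measure (cylinder 3 w) = measure \<mu> (cell w)"
proof -
  have C: "code -` cylinder 3 w \<inter> {0..1} \<in> sets (restrict_space borel {0..1})"
    using measurable_sets[OF measurable_code_scaled cylinder_sets] unfolding space_scaled sets_scaled .
  then have C': "code -` cylinder 3 w \<inter> {0..1} \<in> sets \<mu>"
    by (auto simp: sets_\<mu> sets_restrict_space)
  have "measure coded_measure (cylinder 3 w) =
      measure (scaled_bernoulli_convolution2 \<beta>) (code -` cylinder 3 w \<inter> {0..1})"
    unfolding coded_measure_def measure_distr[OF measurable_code_scaled cylinder_sets] space_scaled ..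
  also have "\<dots> = measure \<mu> (code -` cylinder 3 w \<inter> {0..1})" by (rule measure_scaled) simp
  \<comment> \<open>The point 1 has an itinerary but lies in no cell, so the two sets agree only up
    to a null set.\<close>
  also have "\<dots> = measure \<mu> (cell w)"
  proof (rule \<mu>.finite_measure_eq_AE)
    show "AE x in \<mu>. x \<in> code -` cylinder 3 w \<inter> {0..1} \<longleftrightarrow> x \<in> cell w"
      using AE_\<mu> by eventually_elim (use code_mem_cylinder[OF w] in auto)
  qed (use C' cell_borel[OF w] in \<open>simp_all add: sets_\<mu>\<close>)
  finally show ?thesis .
qed

lemma weak_gibbs_coded_measure: "weak_gibbs 3 coded_measure"
proof -
  obtain \<delta> where "positive_vector (cell_vec []) \<delta>"
    using positive_vector_exists cell_vec_Nil_pos by blast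
  then interpret positive_vector "cell_vec []" \<delta> .
  show ?thesis
  proof (rule weak_gibbs_of_cylinders)
    show "prob_space coded_measure"
      unfolding coded_measure_def
      by (rule prob_space.prob_space_distr[OF prob_space_scaled measurable_code_scaled])
    show "space coded_measure = Omega 3" by (simp add: coded_measure_def space_restrict_space)
    show "sets coded_measure = sets (restrict_space borel (Omega 3))" by (simp add: coded_measure_def)
    fix k :: nat and w assume kw: "set (k # w) \<subseteq> {..<3}"
    then have k: "k < 3" and w: "set w \<subseteq> {..<3}" by auto
    show "measure coded_measure (cylinder 3 (k # w)) = word_weight (k # w) * vec_of w $ first_coord k"
      unfolding coded_measure_cylinder[OF kw] measure_cell_Cons[OF k w] cell_vec_eq[OF w]
      by (simp add: word_weight_def)
  qed
qed

lemma weak_gibbs_scaled: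
  "weak_gibbs_wrt 3 (S_map \<beta>) (T_map \<beta>) (scaled_bernoulli_convolution2 \<beta>)"
  unfolding weak_gibbs_wrt_def
proof (intro conjI exI[of _ coded_measure] allI impI)
  fix w :: "nat list" assume w: "set w \<subseteq> {..<3}"
  have "cell w \<subseteq> {0..1}" using cell_subset[OF w] by auto
  then show "measure (scaled_bernoulli_convolution2 \<beta>) (comp_word (S_map \<beta>) w ` {0..<1}) =
      measure coded_measure (cylinder 3 w)"
    using measure_scaled[of "cell w"] coded_measure_cylinder[OF w] by (simp add: cell_def)
qed (rule affine_partition inverse_map prob_space_scaled space_scaled sets_scaled weak_gibbs_coded_measure)+

end

theorem theorem4p3:
  fixes \<beta> :: real and c :: "real ^ 7"
  assumes "\<beta> > 1" and "\<beta> ^ 3 = 2 * \<beta>\<^sup>2 - \<beta> + 1"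
    and "\<forall>i. c $ i > 0"
  shows "uniformly_convergent_on (Omega 3) (c_seq c)
       \<and> weak_gibbs_wrt 3 (S_map \<beta>) (T_map \<beta>) (scaled_bernoulli_convolution2 \<beta>)"
proof
  obtain \<delta> where "positive_vector c \<delta>" using positive_vector_exists assms(3) by blast
  then show "uniformly_convergent_on (Omega 3) (c_seq c)"
    by (rule positive_vector.uniformly_convergent_c_seq)
  show "weak_gibbs_wrt 3 (S_map \<beta>) (T_map \<beta>) (scaled_bernoulli_convolution2 \<beta>)"
    using assms(1,2) by (intro cubic_base.weak_gibbs_scaled cubic_base.intro)
qed

end
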